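(* Let $\mathcal{H}$ be a hereditary $3$-graph property. Then $\mathcal{H}$ admits zero $\mathrm{disc}_{2,3}$-error if and only if $\mathcal{H}$ admits zero $\mathrm{vdisc}_3$-error.
   Context: For distinct $x,y,z$ write $xy=\{x,y\}$, $xyz=\{x,y,z\}$; $[n]=\{1,\dots,n\}$. $K_2[X,Y]=\{xy: x\in X,y\in Y,x\neq y\}$, $K_3[X,Y,Z]=\{xyz:x\in X,y\in Y,z\in Z\text{ pairwise distinct}\}$. A $3$-graph is a pair $H=(V,F)$ with $F\subseteq\binom{V}{3}$. A hereditary $3$-graph property is a class of finite $3$-graphs closed under isomorphism and induced sub-$3$-graphs. An equipartition is a partition whose parts differ in size by at most $1$. A $3$-partite $3$-graph $(U\cup V\cup W,F)$ with $|F|=d|U||V||W|$ has $\mathrm{vdisc}_3(\epsilon)$ if for all $U'\subseteq U$, $V'\subseteq V$, $W'\subseteq W$, $\big||F\cap K_3[U',V',W']|-d|U'||V'||W'|\big|\leq\epsilon|U||V||W|$. $\mathcal{H}$ admits zero $\mathrm{vdisc}_3$-error if for all $\epsilon>0$ and $t_0\geq1$ there are $T,N$ such that for every $H=(V,F)\in\mathcal{H}$ with $|V|\geq N$ there is an equipartition $\mathcal{P}$ of $V$ into $t$ parts, $t_0\leq t\leq T$, such that for every three distinct parts $X,Y,Z\in\mathcal{P}$ the $3$-graph $(X\cup Y\cup Z,F\cap K_3[X,Y,Z])$ has $\mathrm{vdisc}_3(\epsilon)$. A bipartite graph $(U\cup W,E)$ with $|E|=d|U||W|$ has $\mathrm{disc}_2(\epsilon)$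 if for all $U'\subseteq U$, $W'\subseteq W$, $\big||E\cap K_2[U',W']|-d|U'||W'|\big|\leq\epsilon|U||W|$; it has $\mathrm{disc}_2(\epsilon;d')$ if moreover $\big||E|-d'|U||W|\big|\leq\epsilon|U||W|$. For a graph $G$, $K_3^{(2)}(G)$ is the set of vertex sets of triangles of $G$. If $G=(V_1\cup V_2\cup V_3,E)$ is a $3$-partite graph and $H'=(V_1\cup V_2\cup V_3,F')$ is a $3$-graph with $F'\subseteq K_3^{(2)}(G)$ and $|F'|=d_3|K_3^{(2)}(G)|$, then $(H',G)$ has $\mathrm{disc}_{2,3}(\epsilon_1,\epsilon_2)$ if there is $d_2\in(0,1]$ such that each bipartite graph $G[V_i,V_j]$ ($1\leq i<j\leq3$) has $\mathrm{disc}_2(\epsilon_2;d_2)$ and for every (not necessarily induced) subgraph $G'\subseteq G$, $\big||F'\cap K_3^{(2)}(G')|-d_3|K_3^{(2)}(G')|\big|\leq\epsilon_1d_2^3|V_1||V_2||V_3|$. A $(t,\ell,\epsilon_1,\epsilon_2)$-decomposition $\mathcal{P}$ of a set $V$ consists of a partition $V=V_1\cup\dots\cup V_t$ with $|V_1|\leq\dots\leq|V_t|\leq|V_1|+1$ and for each $ij\in\binom{[t]}{2}$ a partition $K_2[V_i,V_j]=\bigcup_{\alpha\leq\ell}P_{ij}^\alpha$, such that for all but at most $\epsilon_1|V|^3$ triples $xyz\in\binom V3$ there are $ijk\in\binom{[t]}{3}$ and $\alpha,\beta,\gamma\in[\ell]$ with $xy\in P^\alpha_{ij}$, $xz\in P^\beta_{ik}$,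 $yz\in P^\gamma_{jk}$, and each of $P^\alpha_{ij},P^\beta_{ik},P^\gamma_{jk}$ (as bipartite graphs) has $\mathrm{disc}_2(\epsilon_2;1/\ell)$. A triad of $\mathcal{P}$ is a $3$-partite graph $G_{ijk}^{\alpha,\beta,\gamma}=(V_i\cup V_j\cup V_k,P_{ij}^\alpha\cup P_{ik}^\beta\cup P_{jk}^\gamma)$ with $ijk\in\binom{[t]}{3}$, $\alpha,\beta,\gamma\in[\ell]$. For $H=(V,F)$, a triad $G$ of $\mathcal{P}$ has $\mathrm{disc}_{2,3}(\epsilon_1,\epsilon_2)$ with respect to $H$ if $(H',G)$ does, where $H'=(V_i\cup V_j\cup V_k,F\cap K_3^{(2)}(G))$. $\mathcal{H}$ admits zero $\mathrm{disc}_{2,3}$-error if for all $t_0,\ell_0\geq1$, $\epsilon_1>0$, $\epsilon_2:\mathbb{N}\to(0,1]$ there are $N,T,L$ such that for every $H=(V,F)\in\mathcal{H}$ with $|V|\geq N$ there are $t_0\leq t\leq T$, $\ell_0\leq\ell\leq L$ and a $(t,\ell,\epsilon_1,\epsilon_2(\ell))$-decomposition $\mathcal{P}$ of $V$ such that every triad of $\mathcal{P}$ has $\mathrm{disc}_{2,3}(\epsilon_1,\epsilon_2(\ell))$ with respect to $H$. *)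

theory Defs
  imports Complex_Main "HOL-Library.Ramsey" "HOL-Library.Disjoint_Sets"
begin

(* Vertices come from an arbitrary type 'a; if 'a is infinite, every finite 3-graph has an
   isomorphic copy with vertices in 'a.  Edges of graphs and 3-graphs are sets of vertices, and
   nsets V k (written [V]^k in HOL-Library.Ramsey) is the set of k-element subsets of V. *)

type_synonym 'a three_graph = "'a set \<times> 'a set set"

definition finite_three_graph :: "'a three_graph \<Rightarrow> bool" where
  "finite_three_graph H \<longleftrightarrow> (case H of (V, F) \<Rightarrow> finite V \<and> F \<subseteq> nsets V 3)"

definition three_graph_iso :: "'a three_graph \<Rightarrow> 'a three_graph \<Rightarrow> bool" where
  "three_graph_iso H H' \<longleftrightarrow>
     (\<exists>f. bij_betw f (fst H) (fst H') \<and> snd H' = (\<lambda>e. f ` e) ` snd H)"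

definition induced_three_graph :: "'a three_graph \<Rightarrow> 'a set \<Rightarrow> 'a three_graph" where
  "induced_three_graph H W = (W, snd H \<inter> nsets W 3)"

definition hereditary_property :: "'a three_graph set \<Rightarrow> bool" where
  "hereditary_property \<H> \<longleftrightarrow>
     (\<forall>H\<in>\<H>. finite_three_graph H) \<and>
     (\<forall>H\<in>\<H>. \<forall>H'. three_graph_iso H H' \<longrightarrow> H' \<in> \<H>) \<and>
     (\<forall>H\<in>\<H>. \<forall>W. W \<subseteq> fst H \<longrightarrow> induced_three_graph H W \<in> \<H>)"

definition K2 :: "'a set \<Rightarrow> 'a set \<Rightarrow> 'a set set" where
  "K2 X Y = {{x, y} | x y. x \<in> X \<and> y \<in> Y \<and> x \<noteq> y}"

definition K3 :: "'a set \<Rightarrow> 'a set \<Rightarrow> 'a set \<Rightarrow> 'a set set" where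
  "K3 X Y Z = {{x, y, z} | x y z. x \<in> X \<and> y \<in> Y \<and> z \<in> Z \<and> x \<noteq> y \<and> x \<noteq> z \<and> y \<noteq> z}"

(* The vertex sets of the triangles of the graph with edge set E. *)
definition triangles :: "'a set set \<Rightarrow> 'a set set" where
  "triangles E = {{x, y, z} | x y z. x \<noteq> y \<and> x \<noteq> z \<and> y \<noteq> z \<and>
                                     {x, y} \<in> E \<and> {x, z} \<in> E \<and> {y, z} \<in> E}"


(* In the discrepancy notions below a multipartite (3-)graph is given by its parts and its edge
   set.  The densities d with |F| = d|U||V||W|, |E| = d|U||W|, |F'| = d|triangles E| are written as
   quotients.  If the denominator is 0, then d is not determined, but it is only ever multiplied
   by quantities that are then 0. *)

definition vdisc3 :: "'a set \<Rightarrow> 'a set \<Rightarrow> 'a set \<Rightarrow> 'a set set \<Rightarrow> real \<Rightarrow> bool" where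
  "vdisc3 U V W F \<epsilon> \<longleftrightarrow>
     (let d = real (card F) / (real (card U) * real (card V) * real (card W)) in
      \<forall>U' V' W'. U' \<subseteq> U \<longrightarrow> V' \<subseteq> V \<longrightarrow> W' \<subseteq> W \<longrightarrow>
        \<bar>real (card (F \<inter> K3 U' V' W')) - d * real (card U') * real (card V') * real (card W')\<bar>
          \<le> \<epsilon> * real (card U) * real (card V) * real (card W))"

definition disc2 :: "'a set \<Rightarrow> 'a set \<Rightarrow> 'a set set \<Rightarrow> real \<Rightarrow> bool" where
  "disc2 U W E \<epsilon> \<longleftrightarrow>
     (let d = real (card E) / (real (card U) * real (card W)) in
      \<forall>U' W'. U' \<subseteq> U \<longrightarrow> W' \<subseteq> W \<longrightarrow>
        \<bar>real (card (E \<inter> K2 U' W')) - d * real (card U') * real (card W')\<bar>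
          \<le> \<epsilon> * real (card U) * real (card W))"

definition disc2_density :: "'a set \<Rightarrow> 'a set \<Rightarrow> 'a set set \<Rightarrow> real \<Rightarrow> real \<Rightarrow> bool" where
  "disc2_density U W E \<epsilon> d' \<longleftrightarrow>
     disc2 U W E \<epsilon> \<and>
     \<bar>real (card E) - d' * real (card U) * real (card W)\<bar> \<le> \<epsilon> * real (card U) * real (card W)"

(* E is the edge set of the 3-partite graph G.  Since only the triangles of a subgraph of G
   matter, subgraphs are represented by their edge sets E'. *)
definition disc23 ::
  "'a set \<Rightarrow> 'a set \<Rightarrow> 'a set \<Rightarrow> 'a set set \<Rightarrow> 'a set set \<Rightarrow> real \<Rightarrow> real \<Rightarrow> bool" where
  "disc23 V1 V2 V3 F' E \<epsilon>1 \<epsilon>2 \<longleftrightarrow>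
     (let d3 = real (card F') / real (card (triangles E)) in
      \<exists>d2. 0 < d2 \<and> d2 \<le> 1 \<and>
        disc2_density V1 V2 (E \<inter> K2 V1 V2) \<epsilon>2 d2 \<and>
        disc2_density V1 V3 (E \<inter> K2 V1 V3) \<epsilon>2 d2 \<and>
        disc2_density V2 V3 (E \<inter> K2 V2 V3) \<epsilon>2 d2 \<and>
        (\<forall>E'. E' \<subseteq> E \<longrightarrow>
          \<bar>real (card (F' \<inter> triangles E')) - d3 * real (card (triangles E'))\<bar>
            \<le> \<epsilon>1 * d2 ^ 3 * real (card V1) * real (card V2) * real (card V3)))"


definition equipartition :: "'a set \<Rightarrow> 'a set set \<Rightarrow> bool" where
  "equipartition V \<P> \<longleftrightarrow>
     partition_on V \<P> \<and> (\<forall>X\<in>\<P>. \<forall>Y\<in>\<P>. card X \<le> card Y + 1)"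

definition zero_vdisc3_error :: "'a three_graph set \<Rightarrow> bool" where
  "zero_vdisc3_error \<H> \<longleftrightarrow>
     (\<forall>\<epsilon>>0. \<forall>t0\<ge>1. \<exists>T N. \<forall>(V, F)\<in>\<H>. N \<le> card V \<longrightarrow>
        (\<exists>\<P>. equipartition V \<P> \<and> t0 \<le> card \<P> \<and> card \<P> \<le> T \<and>
             (\<forall>X\<in>\<P>. \<forall>Y\<in>\<P>. \<forall>Z\<in>\<P>. X \<noteq> Y \<longrightarrow> X \<noteq> Z \<longrightarrow> Y \<noteq> Z \<longrightarrow>
                vdisc3 X Y Z (F \<inter> K3 X Y Z) \<epsilon>)))"


(* Partition into an indexed family; empty parts are allowed. *)
definition indexed_partition :: "'b set \<Rightarrow> nat set \<Rightarrow> (nat \<Rightarrow> 'b set) \<Rightarrow> bool" where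
  "indexed_partition A I f \<longleftrightarrow> disjoint_family_on f I \<and> (\<Union>i\<in>I. f i) = A"

(* The parts of V are Vs 1, ..., Vs t.  The classes P_ij^\<alpha> are indexed by the unordered pair
   ij, as P {i, j} \<alpha>. *)
definition decomposition ::
  "nat \<Rightarrow> nat \<Rightarrow> real \<Rightarrow> real \<Rightarrow> 'a set \<Rightarrow> (nat \<Rightarrow> 'a set) \<Rightarrow>
    (nat set \<Rightarrow> nat \<Rightarrow> 'a set set) \<Rightarrow> bool" where
  "decomposition t l \<epsilon>1 \<epsilon>2 V Vs P \<longleftrightarrow>
     indexed_partition V {1..t} Vs \<and>
     (\<forall>i\<in>{1..t}. \<forall>j\<in>{1..t}. i \<le> j \<longrightarrow> card (Vs i) \<le> card (Vs j)) \<and>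
     card (Vs t) \<le> card (Vs 1) + 1 \<and>
     (\<forall>i j. {i, j} \<in> nsets {1..t} 2 \<longrightarrow>
        indexed_partition (K2 (Vs i) (Vs j)) {1..l} (P {i, j})) \<and>
     real (card {e \<in> nsets V 3. \<not> (\<exists>x y z i j k \<alpha> \<beta> \<gamma>.
        e = {x, y, z} \<and> {i, j, k} \<in> nsets {1..t} 3 \<and>
        \<alpha> \<in> {1..l} \<and> \<beta> \<in> {1..l} \<and> \<gamma> \<in> {1..l} \<and>
        {x, y} \<in> P {i, j} \<alpha> \<and> {x, z} \<in> P {i, k} \<beta> \<and> {y, z} \<in> P {j, k} \<gamma> \<and>
        disc2_density (Vs i) (Vs j) (P {i, j} \<alpha>) \<epsilon>2 (1 / real l) \<and>
        disc2_density (Vs i) (Vs k) (P {i, k} \<beta>) \<epsilon>2 (1 / real l) \<and>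
        disc2_density (Vs j) (Vs k) (P {j, k} \<gamma>) \<epsilon>2 (1 / real l))})
       \<le> \<epsilon>1 * real (card V) ^ 3"

definition triad_edges ::
  "(nat set \<Rightarrow> nat \<Rightarrow> 'a set set) \<Rightarrow> nat \<Rightarrow> nat \<Rightarrow> nat \<Rightarrow> nat \<Rightarrow> nat \<Rightarrow> nat \<Rightarrow> 'a set set" where
  "triad_edges P i j k \<alpha> \<beta> \<gamma> = P {i, j} \<alpha> \<union> P {i, k} \<beta> \<union> P {j, k} \<gamma>"

definition all_triads_disc23 ::
  "nat \<Rightarrow> nat \<Rightarrow> real \<Rightarrow> real \<Rightarrow> 'a set set \<Rightarrow> (nat \<Rightarrow> 'a set) \<Rightarrow>
    (nat set \<Rightarrow> nat \<Rightarrow> 'a set set) \<Rightarrow> bool" where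
  "all_triads_disc23 t l \<epsilon>1 \<epsilon>2 F Vs P \<longleftrightarrow>
     (\<forall>i j k. {i, j, k} \<in> nsets {1..t} 3 \<longrightarrow>
       (\<forall>\<alpha>\<in>{1..l}. \<forall>\<beta>\<in>{1..l}. \<forall>\<gamma>\<in>{1..l}.
         let G = triad_edges P i j k \<alpha> \<beta> \<gamma> in
         disc23 (Vs i) (Vs j) (Vs k) (F \<inter> triangles G) G \<epsilon>1 \<epsilon>2))"

definition zero_disc23_error :: "'a three_graph set \<Rightarrow> bool" where
  "zero_disc23_error \<H> \<longleftrightarrow>
     (\<forall>t0\<ge>1. \<forall>l0\<ge>1. \<forall>\<epsilon>1>0. \<forall>\<epsilon>2 :: nat \<Rightarrow> real. (\<forall>n. 0 < \<epsilon>2 n \<and> \<epsilon>2 n \<le> 1) \<longrightarrow>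
       (\<exists>N T L. \<forall>(V, F)\<in>\<H>. N \<le> card V \<longrightarrow>
          (\<exists>t l Vs P. t0 \<le> t \<and> t \<le> T \<and> l0 \<le> l \<and> l \<le> L \<and>
             decomposition t l \<epsilon>1 (\<epsilon>2 l) V Vs P \<and>
             all_triads_disc23 t l \<epsilon>1 (\<epsilon>2 l) F Vs P)))"

end

theory Submission
  imports Defs
begin

text \<open>If all triads of a decomposition are regular, then counting triangles in them shows that every
  triple of vertex classes is regular: zero error for \<open>disc23\<close> implies zero error for \<open>vdisc3\<close>.

  Conversely, let \<open>\<H>\<close> have zero error for \<open>vdisc3\<close>.  The 3-graph with vertices \<open>a\<^sub>i, b\<^sub>j, c\<^sub>l\<close> for
  \<open>i, j, l < k\<close> and crossing edges \<open>a\<^sub>i b\<^sub>j c\<^sub>l\<close> for \<open>i < j\<close>, a half-graph blown up by \<open>k\<close> vertices, has no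
  equipartition all of whose triples are regular, so for some \<open>k\<close> it does not occur in \<open>\<H>\<close>.  Without it,
  almost every vertex link contains few half-graphs, and a 3-partite 3-graph with this property has
  a box of positive relative size whose density is close to 0 or 1.  Hence a regular triple
  itself has density close to 0 or 1.  In an equipartition all of whose triples have such
  densities, colour the pairs between any two parts quasirandomly with \<open>l\<close> colours: every
  triad is then regular, because almost all or almost none of its triangles are edges.

  The box is found as follows.  If the link of \<open>x\<close> is sparse on \<open>Y\<^sub>x \<times> Z\<^sub>x\<close>, then for a random tuple \<open>Q\<close>
  of \<open>q\<close> vertices of \<open>Y\<^sub>x\<close> the set \<open>R\<^sub>Q(x)\<close> of all \<open>z\<close> with \<open>x y z\<close> not an edge for all \<open>y \<in> Q\<close> retains much of \<open>Z\<^sub>x\<close>,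
  while all but an exponentially small proportion of the \<open>z\<close> with many edges \<open>x y z\<close>, \<open>y \<in> Y\<^sub>x\<close>, is
  discarded.  Fix \<open>Q\<close>.  By Ramsey's theorem the relation \<open>z \<in> R\<^sub>Q(x)\<close> has few half-graphs, so it nearly
  contains a box \<open>X' \<times> Z'\<close>, where \<open>Z'\<close> no longer depends on \<open>x\<close>.  A second round, sampling from \<open>Z'\<close>,
  removes the dependence of \<open>Y\<^sub>x\<close> on \<open>x\<close>.\<close>

section \<open>Half-graphs in bipartite relations\<close>

text \<open>The constants of the sampling argument look circular. For \<open>Q\<close> to keep a
  fixed share of \<open>Z\<^sub>x\<close>, the link of \<open>x\<close> must have density at most
  about \<open>1 / q\<close> on its box; but greedy embedding then guarantees
  \<open>Z\<^sub>x\<close> only a share of order \<open>(1 / q) ^ k\<close> of \<open>Z\<close>, and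
  the wrongly surviving \<open>z\<close> must be rare even against that. They survive with
  probability at most \<open>(1 - \<beta>) ^ q\<close>, where \<beta> is fixed before
  \<open>q\<close>: an exponential beats a polynomial, so \<open>q\<close> exists. The half-graph is
  blown up in one class only because this suits double counting: without the blow-up, each
  half-graph lies in the links of at most \<open>k\<close> vertices, so only boundedly many links
  contain many half-graphs. Ramsey's theorem enters because surviving \<open>Q\<close> is a
  conjunction of \<open>q\<close> relations, and few half-graphs are known only for each of them
  separately. In the direction from \<open>disc23\<close> to \<open>vdisc3\<close> the errors of
  \<open>l ^ 3\<close> triads add up. The sum stays bounded because each error is measured by the
  product of the densities of three bipartite graphs, up to a small shift, and these products sum to
  1.\<close>

abbreviation tuples :: "nat \<Rightarrow> 'b set \<Rightarrow> (nat \<Rightarrow> 'b) set" where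
  "tuples k A \<equiv> {..<k} \<rightarrow>\<^sub>E A"

lemma card_tuples: "card (tuples k A) = card A ^ k"
  by (simp add: card_PiE)

lemma finite_tuples: "finite A \<Longrightarrow> finite (tuples k A)"
  by (simp add: finite_PiE)

definition half_graph :: "nat \<Rightarrow> ('b \<Rightarrow> 'c \<Rightarrow> bool) \<Rightarrow> (nat \<Rightarrow> 'b) \<Rightarrow> (nat \<Rightarrow> 'c) \<Rightarrow> bool" where
  "half_graph k R f g \<longleftrightarrow> (\<forall>i<k. \<forall>j<k. R (f i) (g j) \<longleftrightarrow> i < j)"

definition has_half_graph :: "nat \<Rightarrow> ('b \<Rightarrow> 'c \<Rightarrow> bool) \<Rightarrow> 'b set \<Rightarrow> 'c set \<Rightarrow> bool" where
  "has_half_graph k R A B \<longleftrightarrow> (\<exists>f\<in>tuples k A. \<exists>g\<in>tuples k B. half_graph k R f g)"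

text \<open>Ramsey's theorem turns a half-graph of length \<open>h\<close> for a conjunction into
  one of length \<open>k\<close> for a single conjunct, at unspecified positions inside the same two
  tuples. Counting the longer tuples lets this step bound a count directly.\<close>

definition half_graph_tuples ::
  "nat \<Rightarrow> nat \<Rightarrow> ('b \<Rightarrow> 'c \<Rightarrow> bool) \<Rightarrow> 'b set \<Rightarrow> 'c set \<Rightarrow> ((nat \<Rightarrow> 'b) \<times> (nat \<Rightarrow> 'c)) set" where
  "half_graph_tuples k h R A B =
     {(f, g) \<in> tuples h A \<times> tuples h B. has_half_graph k R (f ` {..<h}) (g ` {..<h})}"

lemma has_half_graphI:
  assumes "f ` {..<k} \<subseteq> A" "g ` {..<k} \<subseteq> B" "half_graph k R f g"
  shows "has_half_graph k R A B"
  unfolding has_half_graph_def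
proof (intro bexI)
  show "half_graph k R (restrict f {..<k}) (restrict g {..<k})"
    using assms(3) by (simp add: half_graph_def)
qed (use assms in auto)

lemma finite_half_graph_tuples:
  "finite A \<Longrightarrow> finite B \<Longrightarrow> finite (half_graph_tuples k h R A B)"
  by (rule finite_subset[of _ "tuples h A \<times> tuples h B"])
     (auto simp: half_graph_tuples_def finite_tuples)

lemma half_graph_tuples_mono:
  "A \<subseteq> A' \<Longrightarrow> B \<subseteq> B' \<Longrightarrow> half_graph_tuples k h R A B \<subseteq> half_graph_tuples k h R A' B'"
  unfolding half_graph_tuples_def by (auto simp: PiE_def)

lemma half_graphs_subset_half_graph_tuples:
  "{(f, g) \<in> tuples k A \<times> tuples k B. half_graph k R f g} \<subseteq> half_graph_tuples k k R A B"
  unfolding half_graph_tuples_def by (auto intro!: has_half_graphI)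

text \<open>The complement of the pattern \<open>i < j\<close> is \<open>j \<le> i\<close>.
  Reversing both index orders gives \<open>i \<le> j\<close>, and shifting one side by one makes it
  strict; the shift uses up one index.\<close>

lemma has_half_graph_not:
  assumes "has_half_graph (Suc k) (\<lambda>x y. \<not> R x y) A B"
  shows "has_half_graph k R A B"
proof -
  obtain f g where fg: "f \<in> tuples (Suc k) A" "g \<in> tuples (Suc k) B"
    and hg: "half_graph (Suc k) (\<lambda>x y. \<not> R x y) f g"
    using assms by (auto simp: has_half_graph_def)
  show ?thesis
  proof (rule has_half_graphI[of "\<lambda>i. f (k - Suc i)" _ _ "\<lambda>j. g (k - j)"])
    show "half_graph k R (\<lambda>i. f (k - Suc i)) (\<lambda>j. g (k - j))"
      unfolding half_graph_def
    proof (intro allI impI)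
      fix i j assume "i < k" "j < k"
      then have "(\<not> R (f (k - Suc i)) (g (k - j))) = (k - Suc i < k - j)"
        using hg unfolding half_graph_def by simp
      also have "\<dots> \<longleftrightarrow> \<not> i < j" using \<open>i < k\<close> \<open>j < k\<close> by auto
      finally show "R (f (k - Suc i)) (g (k - j)) = (i < j)" by blast
    qed
  qed (use fg in \<open>auto simp: PiE_def Pi_def\<close>)
qed

lemma has_half_graph_Suc:
  assumes "has_half_graph (Suc k) R A B"
  shows "has_half_graph k R A B"
proof -
  obtain f g where fg: "f \<in> tuples (Suc k) A" "g \<in> tuples (Suc k) B"
    and hg: "half_graph (Suc k) R f g"
    using assms by (auto simp: has_half_graph_def)
  show ?thesis
    by (rule has_half_graphI[of f _ _ g]) (use fg hg in \<open>auto simp: half_graph_def PiE_def Pi_def\<close>)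
qed

lemma half_graph_tuples_Suc:
  "half_graph_tuples (Suc k) h R A B \<subseteq> half_graph_tuples k h R A B"
  "half_graph_tuples (Suc k) h (\<lambda>x y. \<not> R x y) A B \<subseteq> half_graph_tuples k h R A B"
  unfolding half_graph_tuples_def using has_half_graph_not has_half_graph_Suc by blast+


text \<open>Greedy embedding. The vertices \<open>f (h - 1)\<close>, ..., \<open>f 0\<close> are
  chosen in this order, and for every \<open>g j\<close> a candidate set is kept, of which each
  choice preserves a share of at least \<delta>. For each of the \<open>h\<close> candidate sets
  fewer than \<open>card A / (2 * h)\<close> vertices are a bad choice, so half of \<open>A\<close>
  is always available; at the end \<open>g j\<close> is free in its candidate set.\<close>

lemma card_half_graphs_ge:
  fixes R :: "'b \<Rightarrow> 'c \<Rightarrow> bool" and \<delta> :: real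
  assumes fin: "finite A" "finite B" and h: "0 < h" and \<delta>: "0 < \<delta>" "\<delta> \<le> 1"
    and deg: "\<And>B'. B' \<subseteq> B \<Longrightarrow> \<delta> ^ h * card B \<le> card B' \<Longrightarrow>
        2 * real h * card {x\<in>A. card {y\<in>B'. R x y} < \<delta> * card B'} < card A"
    and codeg: "\<And>B'. B' \<subseteq> B \<Longrightarrow> \<delta> ^ h * card B \<le> card B' \<Longrightarrow>
        2 * real h * card {x\<in>A. card {y\<in>B'. \<not> R x y} < \<delta> * card B'} < card A"
  shows "(card A / 2) ^ h * (\<delta> ^ h * card B) ^ h
           \<le> card {(f, g) \<in> tuples h A \<times> tuples h B. half_graph h R f g}"
proof -
  \<comment> \<open>Here \<open>n\<close> vertices \<open>f i\<close> are still to be chosen, and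
    \<open>Bs j\<close> holds the candidates for \<open>g j\<close> that fit all vertices chosen so
    far.\<close>
  define S where "S n Bs = {(f, g) \<in> tuples n A \<times> (PiE {..<h} Bs).
      \<forall>i<n. \<forall>j<h. R (f i) (g j) \<longleftrightarrow> i < j}" for n and Bs :: "nat \<Rightarrow> 'c set"
  have finS: "finite (S n Bs)" if "\<And>j. j < h \<Longrightarrow> Bs j \<subseteq> B" for n Bs
  proof (rule finite_subset)
    have "PiE {..<h} Bs \<subseteq> tuples h B" by (rule PiE_mono) (use that in auto)
    then show "S n Bs \<subseteq> tuples n A \<times> tuples h B" by (auto simp: S_def)
  qed (use fin in \<open>auto simp: finite_tuples\<close>)
  have main: "(card A / 2) ^ n * (\<delta> ^ h * card B) ^ h \<le> card (S n Bs)"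
    if "n \<le> h" "\<And>j. j < h \<Longrightarrow> Bs j \<subseteq> B" "\<And>j. j < h \<Longrightarrow> \<delta> ^ (h - n) * card B \<le> card (Bs j)" for n Bs
    using that
  proof (induction n arbitrary: Bs)
    case 0
    have "S 0 Bs = {\<lambda>x. undefined} \<times> PiE {..<h} Bs"
      by (auto simp: S_def)
    then have "card (S 0 Bs) = (\<Prod>j<h. card (Bs j))"
      by (simp add: card_cartesian_product card_PiE)
    moreover have "(\<Prod>j<h. \<delta> ^ h * card B) \<le> (\<Prod>j<h. real (card (Bs j)))"
      by (rule prod_mono) (use 0 \<delta> in auto)
    ultimately show ?case by simp
  next
    case (Suc n)
    have sizeB: "\<delta> ^ h * card B \<le> card (Bs j)" if "j < h" for j
    proof -
      have "\<delta> ^ h \<le> \<delta> ^ (h - Suc n)" by (rule power_decreasing) (use \<delta> in auto)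
      then have "\<delta> ^ h * card B \<le> \<delta> ^ (h - Suc n) * card B" by (simp add: mult_right_mono)
      then show ?thesis using Suc.prems(3)[OF that] by linarith
    qed
    \<comment> \<open>With \<open>x\<close> as \<open>f n\<close>, the candidates for
      \<open>g j\<close> shrink to neighbours or non-neighbours of \<open>x\<close>, as the pattern
      at \<open>(n, j)\<close> demands.\<close>
    define T where "T x j = {y\<in>Bs j. R x y \<longleftrightarrow> n < j}" for x j
    define bad where "bad j = {x\<in>A. card (T x j) < \<delta> * card (Bs j)}" for j
    have bad: "2 * real h * card (bad j) < card A" if "j < h" for j
      using deg[OF Suc.prems(2)[OF that] sizeB[OF that]]
        codeg[OF Suc.prems(2)[OF that] sizeB[OF that]]
      by (cases "n < j") (auto simp: bad_def T_def)
    define good where "good = A - (\<Union>j<h. bad j)"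
    have finbad: "finite (bad j)" for j using fin by (simp add: bad_def)
    have "2 * real h * card (\<Union>j<h. bad j) \<le> 2 * real h * (\<Sum>j<h. real (card (bad j)))"
      using card_UN_le[of "{..<h}" bad]
      by (intro mult_left_mono) (simp_all flip: of_nat_sum)
    also have "\<dots> = (\<Sum>j<h. 2 * real h * card (bad j))" by (simp add: sum_distrib_left)
    also have "\<dots> \<le> (\<Sum>j<h. real (card A))" by (rule sum_mono) (use bad in \<open>simp add: less_imp_le\<close>)
    finally have "2 * real h * card (\<Union>j<h. bad j) \<le> real h * card A" by simp
    then have "2 * real (card (\<Union>j<h. bad j)) \<le> card A" using h by simp
    moreover have "card good = card A - card (\<Union>j<h. bad j)"
      unfolding good_def by (intro card_Diff_subset finite_UN_I finbad) (auto simp: bad_def)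
    moreover have "card (\<Union>j<h. bad j) \<le> card A"
      by (rule card_mono) (auto simp: fin bad_def)
    ultimately have good: "card A / 2 \<le> card good" by simp
    have fingood: "finite good" using fin by (simp add: good_def)
    have IH: "(card A / 2) ^ n * (\<delta> ^ h * card B) ^ h \<le> card (S n (T x))" if "x \<in> good" for x
    proof (rule Suc.IH)
      show "T x j \<subseteq> B" if "j < h" for j using Suc.prems(2)[OF that] by (auto simp: T_def)
      fix j assume j: "j < h"
      have "\<delta> * card (Bs j) \<le> card (T x j)" using \<open>x \<in> good\<close> j by (force simp: good_def bad_def)
      moreover have "\<delta> * (\<delta> ^ (h - Suc n) * card B) \<le> \<delta> * card (Bs j)"
        using Suc.prems(3)[OF j] \<delta> by (intro mult_left_mono) auto
      moreover have "\<delta> * \<delta> ^ (h - Suc n) = \<delta> ^ (h - n)"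
        using Suc.prems(1) by (metis Suc_diff_Suc Suc_le_eq power_Suc)
      ultimately show "\<delta> ^ (h - n) * card B \<le> card (T x j)"
        by (metis (no_types, lifting) mult.assoc order_trans)
    qed (use Suc.prems in auto)
    have sub: "(\<lambda>(x, f, g). (f(n := x), g)) ` (SIGMA x:good. S n (T x)) \<subseteq> S (Suc n) Bs"
    proof (rule image_subsetI)
      fix p assume "p \<in> (SIGMA x:good. S n (T x))"
      then obtain x f g where p: "p = (x, f, g)" and x: "x \<in> good" and f: "f \<in> tuples n A"
        and g: "g \<in> PiE {..<h} (T x)" and R: "\<forall>i<n. \<forall>j<h. R (f i) (g j) = (i < j)"
        by (auto simp: S_def)
      have "f(n := x) \<in> tuples (Suc n) A"
        using x f by (auto simp: good_def PiE_def Pi_def extensional_def)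
      moreover have "g \<in> PiE {..<h} Bs" using g by (auto simp: T_def PiE_def Pi_def)
      moreover have "\<forall>i<Suc n. \<forall>j<h. R ((f(n := x)) i) (g j) = (i < j)"
        using R g by (auto simp: T_def PiE_def Pi_def less_Suc_eq)
      ultimately show "(case p of (x, f, g) \<Rightarrow> (f(n := x), g)) \<in> S (Suc n) Bs"
        by (simp add: S_def p)
    qed
    have inj: "inj_on (\<lambda>(x, f, g). (f(n := x), g)) (SIGMA x:good. S n (T x))"
    proof (rule inj_onI, clarsimp simp: S_def)
      fix x f g x' f'
      assume f: "f \<in> tuples n A" "f' \<in> tuples n A" and eq: "f(n := x) = f'(n := x')"
      have "x = x'" using fun_cong[OF eq, of n] by simp
      moreover have "f i = f' i" for i
        using fun_cong[OF eq, of i] f by (cases "i = n") (auto simp: PiE_def extensional_def)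
      ultimately show "x = x' \<and> f = f'" by auto
    qed
    have finST: "finite (S n (T x))" for x
    proof (rule finS)
      show "T x j \<subseteq> B" if "j < h" for j using Suc.prems(2)[OF that] by (auto simp: T_def)
    qed
    have "(card A / 2) ^ Suc n * (\<delta> ^ h * card B) ^ h
        = card A / 2 * ((card A / 2) ^ n * (\<delta> ^ h * card B) ^ h)" by simp
    also have "\<dots> \<le> card good * ((card A / 2) ^ n * (\<delta> ^ h * card B) ^ h)"
      by (rule mult_right_mono) (use good \<delta> in auto)
    also have "\<dots> = (\<Sum>x\<in>good. (card A / 2) ^ n * (\<delta> ^ h * card B) ^ h)" by simp
    also have "\<dots> \<le> (\<Sum>x\<in>good. real (card (S n (T x))))"
      by (rule sum_mono) (rule IH)
    also have "\<dots> = card (SIGMA x:good. S n (T x))"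
      by (subst card_SigmaI) (auto simp: fingood finST)
    also have "\<dots> = card ((\<lambda>(x, f, g). (f(n := x), g)) ` (SIGMA x:good. S n (T x)))"
      by (simp add: card_image[OF inj])
    also have "\<dots> \<le> card (S (Suc n) Bs)"
      by (simp add: card_mono[OF finS[OF Suc.prems(2)] sub])
    finally show ?case .
  qed
  have "S h (\<lambda>_. B) = {(f, g) \<in> tuples h A \<times> tuples h B. half_graph h R f g}"
    by (auto simp: S_def half_graph_def)
  then show ?thesis using main[of h "\<lambda>_. B"] by simp
qed

section \<open>Dense boxes\<close>

text \<open>Density increment: among sub-boxes with sides of relative size at least
  \<open>m ^ j\<close> and density at least \<open>\<phi>0 * (1 + \<kappa>) ^ j\<close>, one with
  maximal \<open>j\<close> exists because \<phi> is at most 1. If a large sub-box of it were sparse,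
  the remainder would be denser than maximality allows. Only an upper bound on \<phi> is assumed,
  since it will be an indicator minus a large multiple of another indicator.\<close>

lemma regular_box:
  fixes \<phi>0 m1 :: real
  assumes "0 < \<phi>0" "0 < m1" "m1 \<le> 1"
  shows "\<exists>\<rho>::real>0. \<forall>(A::'b set) (B::'c set) \<phi>. finite A \<longrightarrow> finite B \<longrightarrow> A \<noteq> {} \<longrightarrow> B \<noteq> {} \<longrightarrow>
    (\<forall>x\<in>A. \<forall>y\<in>B. \<phi> x y \<le> 1) \<longrightarrow> \<phi>0 * card A * card B \<le> (\<Sum>x\<in>A. \<Sum>y\<in>B. \<phi> x y) \<longrightarrow>
    (\<exists>A1 B1. A1 \<subseteq> A \<and> B1 \<subseteq> B \<and> A1 \<noteq> {} \<and> B1 \<noteq> {} \<and> \<rho> * card A \<le> card A1 \<and> \<rho> * card B \<le> card B1 \<and>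
      (\<forall>A' B'. A' \<subseteq> A1 \<longrightarrow> B' \<subseteq> B1 \<longrightarrow> m1 * card A1 \<le> card A' \<longrightarrow> m1 * card B1 \<le> card B' \<longrightarrow>
         \<phi>0 / 2 * card A' * card B' \<le> (\<Sum>x\<in>A'. \<Sum>y\<in>B'. (\<phi> x y :: real))))"
proof -
  \<comment> \<open>For a sub-box with sides of relative size \<open>m1\<close>, \<kappa> makes the
    possible excess outside cost at most a quarter of its expected mass, and \<open>m\<close> makes
    the pieces too small for the maximality argument cost at most another quarter. The minimum in
    \<open>\<phi>1\<close> keeps \<open>m \<le> 1\<close>.\<close>
  define \<kappa> where "\<kappa> = m1\<^sup>2 / 4"
  define \<phi>1 where "\<phi>1 = min \<phi>0 1"
  define m where "m = \<phi>1 * m1\<^sup>2 / 8"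
  have \<kappa>: "\<kappa> > 0" using assms by (simp add: \<kappa>_def)
  have \<phi>1: "0 < \<phi>1" "\<phi>1 \<le> 1" "\<phi>1 \<le> \<phi>0" using assms by (auto simp: \<phi>1_def)
  have m: "0 < m" using assms \<phi>1 by (simp add: m_def)
  have "m1\<^sup>2 \<le> 1" using assms by (simp add: power_le_one)
  then have "\<phi>1 * m1\<^sup>2 \<le> 1 * 1" using \<phi>1 by (intro mult_mono) auto
  then have m_le: "m \<le> 1" by (simp add: m_def)
  obtain J where J: "1 / \<phi>0 < (1 + \<kappa>) ^ J" using \<kappa> real_arch_pow[of "1 + \<kappa>"] by auto
  show ?thesis
  proof (intro exI[of _ "m ^ J"] conjI allI impI)
    show "0 < m ^ J" using m by simp
    fix A :: "'b set" and B :: "'c set" and \<phi> :: "'b \<Rightarrow> 'c \<Rightarrow> real"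
    assume fin: "finite A" "finite B" and ne: "A \<noteq> {}" "B \<noteq> {}"
      and le1: "\<forall>x\<in>A. \<forall>y\<in>B. \<phi> x y \<le> 1"
      and avg: "\<phi>0 * card A * card B \<le> (\<Sum>x\<in>A. \<Sum>y\<in>B. \<phi> x y)"
    define s where "s A' B' = (\<Sum>x\<in>A'. \<Sum>y\<in>B'. \<phi> x y)" for A' B'
    define P where "P j A1 B1 \<longleftrightarrow> A1 \<subseteq> A \<and> B1 \<subseteq> B \<and> A1 \<noteq> {} \<and> B1 \<noteq> {} \<and>
      m ^ j * card A \<le> card A1 \<and> m ^ j * card B \<le> card B1 \<and>
      \<phi>0 * (1 + \<kappa>) ^ j * card A1 * card B1 \<le> s A1 B1" for j A1 B1
    have s_le: "s A' B' \<le> real (card A') * card B'" if "A' \<subseteq> A" "B' \<subseteq> B" for A' B'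
    proof -
      have "s A' B' \<le> (\<Sum>x\<in>A'. \<Sum>y\<in>B'. 1)"
        unfolding s_def by (intro sum_mono) (use that le1 in auto)
      then show ?thesis by simp
    qed
    have P0: "P 0 A B" using ne avg by (simp add: P_def s_def)
    have bnd: "j \<le> J" if "P j A1 B1" for j A1 B1
    proof (rule ccontr)
      assume "\<not> j \<le> J"
      then have "(1 + \<kappa>) ^ J \<le> (1 + \<kappa>) ^ j" using \<kappa> by (intro power_increasing) auto
      then have "1 / \<phi>0 < (1 + \<kappa>) ^ j" using J by linarith
      then have 1: "1 < \<phi>0 * (1 + \<kappa>) ^ j" using assms by (simp add: field_simps)
      have fin1: "finite A1" "finite B1" using that fin by (auto simp: P_def intro: finite_subset)
      then have pos: "0 < real (card A1) * card B1"
        using that by (simp add: P_def card_gt_0_iff)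
      have "\<phi>0 * (1 + \<kappa>) ^ j * (real (card A1) * card B1) \<le> 1 * (real (card A1) * card B1)"
        using that s_le[of A1 B1] by (simp add: P_def mult.assoc)
      then show False using mult_strict_right_mono[OF 1 pos] by linarith
    qed
    define j where "j = (GREATEST j. \<exists>A1 B1. P j A1 B1)"
    have "\<exists>A1 B1. P j A1 B1"
      unfolding j_def by (rule GreatestI_nat[of _ 0 J]) (use P0 bnd in blast)+
    then obtain A1 B1 where P: "P j A1 B1" by blast
    have jmax: "\<not> P (Suc j) A' B'" for A' B'
      using Greatest_le_nat[of "\<lambda>j. \<exists>A1 B1. P j A1 B1" "Suc j" J] bnd
      unfolding j_def[symmetric] by (metis Suc_n_not_le_n)
    have sub: "A1 \<subseteq> A" "B1 \<subseteq> B" and fin1: "finite A1" "finite B1" and ne1: "A1 \<noteq> {}" "B1 \<noteq> {}"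
      using P fin by (auto simp: P_def intro: finite_subset)
    define a b where "a = real (card A1)" and "b = real (card B1)"
    have ab: "0 < a" "0 < b" using fin1 ne1 by (auto simp: a_def b_def card_gt_0_iff)
    define d where "d = s A1 B1 / (a * b)"
    have d: "\<phi>0 * (1 + \<kappa>) ^ j \<le> d" and sd: "s A1 B1 = d * (a * b)"
      using P ab by (auto simp: d_def P_def a_def b_def field_simps)
    have "\<phi>0 * 1 \<le> \<phi>0 * (1 + \<kappa>) ^ j" using \<kappa> assms by (intro mult_left_mono) auto
    then have d0: "\<phi>0 \<le> d" using d by linarith
    then have d0': "0 < d" using assms by linarith
    note d0 = d0 d0'
    text \<open>By maximality of \<open>j\<close>, no sub-box that is large in both directions is much denser.\<close>
    have upper: "s A' B' \<le> (1 + \<kappa>) * d * (real (card A') * card B') + m * (a * b)"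
      if "A' \<subseteq> A1" "B' \<subseteq> B1" for A' B'
    proof -
      have fin': "finite A'" "finite B'" using that fin1 by (auto intro: finite_subset)
      have c: "card A' \<le> a" "card B' \<le> b"
        using that fin1 by (auto simp: a_def b_def card_mono)
      have le: "s A' B' \<le> real (card A') * card B'" by (rule s_le) (use that sub in auto)
      have nn: "0 \<le> (1 + \<kappa>) * d * (real (card A') * card B')" using \<kappa> d0 by simp
      consider "card A' < m * a" | "card B' < m * b" | "m * a \<le> card A'" "m * b \<le> card B'"
        by linarith
      then show ?thesis
      proof cases
        case 1
        then have "real (card A') * card B' \<le> (m * a) * b"
          using c m ab by (intro mult_mono) auto
        then show ?thesis using le nn by (simp add: mult.assoc)
      next
        case 2
        then have "real (card A') * card B' \<le> a * (m * b)"
          using c m ab by (intro mult_mono) auto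
        then show ?thesis using le nn by (simp add: mult_ac)
      next
        case 3
        have "m * (m ^ j * card A) \<le> m * a" "m * (m ^ j * card B) \<le> m * b"
          using P m by (auto simp: P_def a_def b_def)
        then have "m ^ Suc j * card A \<le> card A'" "m ^ Suc j * card B \<le> card B'"
          using 3 by (simp_all add: mult.assoc)
        moreover have "A' \<noteq> {}" "B' \<noteq> {}"
          using 3 m ab by (auto simp: mult_le_0_iff)
        ultimately have "s A' B' < \<phi>0 * (1 + \<kappa>) ^ Suc j * card A' * card B'"
          using jmax[of A' B'] that sub by (auto simp: P_def)
        also have "\<dots> = (1 + \<kappa>) * (\<phi>0 * (1 + \<kappa>) ^ j) * (real (card A') * card B')"
          by simp
        also have "\<dots> \<le> (1 + \<kappa>) * d * (real (card A') * card B')"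
          using d \<kappa> by (intro mult_right_mono mult_left_mono) auto
        finally have "s A' B' \<le> (1 + \<kappa>) * d * (real (card A') * card B')" by simp
        moreover have "0 \<le> m * (a * b)" using m ab by simp
        ultimately show ?thesis by linarith
      qed
    qed
    have "\<phi>0 / 2 * card A' * card B' \<le> s A' B'"
      if A': "A' \<subseteq> A1" "m1 * card A1 \<le> card A'" and B': "B' \<subseteq> B1" "m1 * card B1 \<le> card B'" for A' B'
    proof -
      define a' b' where "a' = real (card A')" and "b' = real (card B')"
      have cA: "real (card (A1 - A')) = a - a'"
        using A' fin1 by (simp add: card_Diff_subset finite_subset of_nat_diff card_mono a_def a'_def)
      have cB: "real (card (B1 - B')) = b - b'"
        using B' fin1 by (simp add: card_Diff_subset finite_subset of_nat_diff card_mono b_def b'_def)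
      \<comment> \<open>The complement of the sub-box is cut into two boxes, so that
        \<open>upper\<close> applies to each.\<close>
      have "s A1 B1 = s (A1 - A') B1 + s A' B1"
        unfolding s_def using sum.subset_diff[OF A'(1) fin1(1)] by blast
      also have "s A' B1 = s A' (B1 - B') + s A' B'"
        unfolding s_def sum.distrib[symmetric]
        by (rule sum.cong[OF refl]) (use sum.subset_diff[OF B'(1) fin1(2)] in blast)
      finally have "s A' B' = d * (a * b) - s (A1 - A') B1 - s A' (B1 - B')" using sd by simp
      moreover have "s (A1 - A') B1 \<le> (1 + \<kappa>) * d * ((a - a') * b) + m * (a * b)"
        using upper[of "A1 - A'" B1] by (simp add: cA flip: b_def)
      moreover have "s A' (B1 - B') \<le> (1 + \<kappa>) * d * (a' * (b - b')) + m * (a * b)"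
        using upper[of A' "B1 - B'"] A' by (simp add: cB flip: a'_def)
      ultimately have 1: "s A' B' \<ge> d * (a * b) - (1 + \<kappa>) * d * (a * b - a' * b') - 2 * (m * (a * b))"
        by (simp add: algebra_simps)
      have "m1 * a * (m1 * b) \<le> a' * b'"
        using A' B' assms ab unfolding a_def b_def a'_def b'_def by (intro mult_mono) auto
      then have ab': "m1\<^sup>2 * (a * b) \<le> a' * b'" by (simp add: power2_eq_square mult_ac)
      have ab'0: "0 \<le> a' * b'" by (simp add: a'_def b'_def)
      have "\<phi>1 \<le> d" using d0 \<phi>1 by linarith
      then have "2 * m \<le> d * m1\<^sup>2 / 4"
        unfolding m_def using mult_right_mono[of \<phi>1 d "m1\<^sup>2"] by simp
      then have "2 * m * (a * b) \<le> d * m1\<^sup>2 / 4 * (a * b)"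
        using ab by (intro mult_right_mono) auto
      then have 2: "2 * (m * (a * b)) \<le> \<kappa> * d * (a * b)" by (simp add: \<kappa>_def mult_ac)
      have "d * (m1\<^sup>2 * (a * b)) \<le> d * (a' * b')"
        using ab' d0 by (intro mult_left_mono) auto
      then have 3: "\<kappa> * d * (a * b) \<le> d * (a' * b') / 4" by (simp add: \<kappa>_def mult_ac)
      have 4: "0 \<le> \<kappa> * d * (a' * b')" using \<kappa> d0 ab'0 by simp
      have "s A' B' \<ge> d * (a' * b') + \<kappa> * d * (a' * b') - \<kappa> * d * (a * b) - 2 * (m * (a * b))"
        using 1 by (simp add: algebra_simps)
      then have "d * (a' * b') / 2 \<le> s A' B'" using 2 3 4 by linarith
      moreover have "\<phi>0 * (a' * b') \<le> d * (a' * b')" using d0 ab'0 by (intro mult_right_mono) auto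
      ultimately show ?thesis by (simp add: a'_def b'_def)
    qed
    moreover have "m ^ J \<le> m ^ j" using m m_le bnd[OF P] by (intro power_decreasing) auto
    then have "m ^ J * card A \<le> card A1" "m ^ J * card B \<le> card B1"
      using P mult_right_mono[of "m ^ J" "m ^ j" "real (card A)"] mult_right_mono[of "m ^ J" "m ^ j" "real (card B)"]
      by (auto simp: P_def)
    ultimately show "\<exists>A1 B1. A1 \<subseteq> A \<and> B1 \<subseteq> B \<and> A1 \<noteq> {} \<and> B1 \<noteq> {} \<and>
       m ^ J * card A \<le> card A1 \<and> m ^ J * card B \<le> card B1 \<and>
      (\<forall>A' B'. A' \<subseteq> A1 \<longrightarrow> B' \<subseteq> B1 \<longrightarrow> m1 * card A1 \<le> card A' \<longrightarrow> m1 * card B1 \<le> card B' \<longrightarrow>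
         \<phi>0 / 2 * card A' * card B' \<le> (\<Sum>x\<in>A'. \<Sum>y\<in>B'. \<phi> x y))"
      using sub ne1 unfolding s_def by blast
  qed
qed

text \<open>The contrapositive of greedy embedding: with few half-graphs one of the two degree
  conditions fails at some large \<open>B'\<close>, and the vertices witnessing the failure form
  \<open>A'\<close>. The relative size of \<open>A'\<close> depends on \<open>k\<close> alone,
  however small \<delta> is.\<close>

lemma homogeneous_box_of_few_half_graphs:
  fixes R :: "'b \<Rightarrow> 'c \<Rightarrow> bool" and \<delta> :: real
  assumes fin: "finite A" "finite B" and k: "0 < k" and \<delta>: "0 < \<delta>" "\<delta> \<le> 1"
    and few: "card (half_graph_tuples k k R A B) < (card A / 2) ^ k * (\<delta> ^ k * card B) ^ k"
  obtains A' B' where "A' \<subseteq> A" "B' \<subseteq> B" "\<delta> ^ k * card B \<le> card B'" "card A \<le> 2 * k * card A'"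
    "(\<forall>x\<in>A'. card {y\<in>B'. R x y} < \<delta> * card B') \<or> (\<forall>x\<in>A'. card {y\<in>B'. \<not> R x y} < \<delta> * card B')"
proof (rule ccontr)
  note box = that
  assume no: "\<not> thesis"
  have "card A > 2 * real k * card {x\<in>A. card {y\<in>B'. R x y} < \<delta> * card B'}"
    if "B' \<subseteq> B" "\<delta> ^ k * card B \<le> card B'" for B'
  proof (rule ccontr)
    assume "\<not> ?thesis"
    then have "card A \<le> 2 * k * card {x\<in>A. card {y\<in>B'. R x y} < \<delta> * card B'}"
      by (simp flip: of_nat_le_iff[where ?'a = real])
    then have thesis using that by (intro box[of "{x\<in>A. card {y\<in>B'. R x y} < \<delta> * card B'}" B']) auto
    with no show False by simp
  qed
  moreover have "card A > 2 * real k * card {x\<in>A. card {y\<in>B'. \<not> R x y} < \<delta> * card B'}"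
    if "B' \<subseteq> B" "\<delta> ^ k * card B \<le> card B'" for B'
  proof (rule ccontr)
    assume "\<not> ?thesis"
    then have "card A \<le> 2 * k * card {x\<in>A. card {y\<in>B'. \<not> R x y} < \<delta> * card B'}"
      by (simp flip: of_nat_le_iff[where ?'a = real])
    then have thesis using that by (intro box[of "{x\<in>A. card {y\<in>B'. \<not> R x y} < \<delta> * card B'}" B']) auto
    with no show False by simp
  qed
  ultimately have "(card A / 2) ^ k * (\<delta> ^ k * card B) ^ k
           \<le> card {(f, g) \<in> tuples k A \<times> tuples k B. half_graph k R f g}"
    by (intro card_half_graphs_ge fin k \<delta>) auto
  also have "\<dots> \<le> card (half_graph_tuples k k R A B)"
    by (intro of_nat_mono card_mono finite_half_graph_tuples fin half_graphs_subset_half_graph_tuples)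
  finally show False using few by simp
qed

section \<open>Relations with few half-graphs: passing to an almost complete box\<close>

lemma sum_of_bool_card: "finite B \<Longrightarrow> (\<Sum>y\<in>B. of_bool (P y)) = real (card {y\<in>B. P y})"
  by (simp add: of_bool_def sum.If_cases Int_def)

text \<open>Inside the box of \<open>regular_box\<close> the degree condition of greedy embedding
  cannot fail, as this would give a large sub-box of density below \<open>\<phi>0 / 2\<close>. Few
  half-graphs therefore force the condition on non-neighbours to fail, which yields a large sub-box
  where \<open>R\<close> is almost complete. The same sub-box nearly avoids \<open>Bad\<close>: the
  weighted sum over it is nonnegative, so \<open>lam\<close> times the number of bad pairs is at
  most its size.\<close>

lemma dense_box_of_few_half_graphs:
  fixes \<phi>0 \<delta> :: real
  assumes "0 < \<phi>0" "0 < \<delta>" "\<delta> < 1" "0 < h"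
  shows "\<exists>\<tau>::real>0. \<exists>\<rho>::real>0. \<forall>(A::'b set) (B::'c set) R Bad (lam::real). finite A \<longrightarrow> finite B \<longrightarrow> A \<noteq> {} \<longrightarrow> B \<noteq> {} \<longrightarrow>
    0 \<le> lam \<longrightarrow>
    \<phi>0 * card A * card B \<le> (\<Sum>x\<in>A. \<Sum>y\<in>B. of_bool (R x y) - lam * of_bool (Bad x y)) \<longrightarrow>
    card {(f, g) \<in> tuples h A \<times> tuples h B. half_graph h R f g} < \<tau> * card A ^ h * card B ^ h \<longrightarrow>
    (\<exists>A' B'. A' \<subseteq> A \<and> B' \<subseteq> B \<and> A' \<noteq> {} \<and> B' \<noteq> {} \<and> \<rho> * card A \<le> card A' \<and> \<rho> * card B \<le> card B' \<and>
       (\<Sum>x\<in>A'. \<Sum>y\<in>B'. of_bool (\<not> R x y)) \<le> \<delta> * card A' * card B' \<and>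
       lam * (\<Sum>x\<in>A'. \<Sum>y\<in>B'. of_bool (Bad x y)) \<le> real (card A') * card B')"
proof -
  define \<delta>' where "\<delta>' = min \<delta> (\<phi>0 / 2)"
  have \<delta>': "0 < \<delta>'" "\<delta>' < 1" "\<delta>' \<le> \<delta>" "\<delta>' \<le> \<phi>0 / 2" using assms by (auto simp: \<delta>'_def)
  \<comment> \<open>Greedy embedding tests sets \<open>B'\<close> of relative size at least
    \<open>\<delta>' ^ h\<close>, and its exceptional sets in \<open>A1\<close> have relative size
    at least \<open>1 / (2 * h)\<close>.\<close>
  define m1 where "m1 = min (\<delta>' ^ h) (1 / (2 * real h))"
  have m1: "0 < m1" "m1 \<le> 1" "m1 \<le> \<delta>' ^ h" "m1 \<le> 1 / (2 * real h)"
    using \<delta>' assms by (auto simp: m1_def power_le_one min_le_iff_disj)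
  obtain \<rho>0 :: real where \<rho>0: "0 < \<rho>0" and reg: "\<And>(A::'b set) (B::'c set) \<phi>. finite A \<Longrightarrow> finite B \<Longrightarrow> A \<noteq> {} \<Longrightarrow> B \<noteq> {} \<Longrightarrow>
    (\<forall>x\<in>A. \<forall>y\<in>B. \<phi> x y \<le> 1) \<Longrightarrow> \<phi>0 * card A * card B \<le> (\<Sum>x\<in>A. \<Sum>y\<in>B. \<phi> x y) \<Longrightarrow>
    (\<exists>A1 B1. A1 \<subseteq> A \<and> B1 \<subseteq> B \<and> A1 \<noteq> {} \<and> B1 \<noteq> {} \<and> \<rho>0 * card A \<le> card A1 \<and> \<rho>0 * card B \<le> card B1 \<and>
      (\<forall>A' B'. A' \<subseteq> A1 \<longrightarrow> B' \<subseteq> B1 \<longrightarrow> m1 * card A1 \<le> card A' \<longrightarrow> m1 * card B1 \<le> card B' \<longrightarrow>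
         \<phi>0 / 2 * card A' * card B' \<le> (\<Sum>x\<in>A'. \<Sum>y\<in>B'. (\<phi> x y :: real))))"
    using regular_box[OF assms(1) m1(1,2), where ?'b = 'b and ?'c = 'c] by metis
  \<comment> \<open>The first factor is the share of half-graphs that greedy embedding finds in the
    regular box; the powers of \<open>\<rho>0\<close> rescale it to tuples from \<open>A\<close> and
    \<open>B\<close>.\<close>
  define \<tau> where "\<tau> = (\<delta>' ^ h / 2) ^ h * \<rho>0 ^ h * \<rho>0 ^ h"
  show ?thesis
  proof (rule exI[of _ \<tau>], rule conjI, goal_cases)
    case 1 show ?case using \<delta>' \<rho>0 by (simp add: \<tau>_def)
  next
    case 2 show ?case
    proof (intro exI[of _ "m1 * \<rho>0"] conjI allI impI, goal_cases)
      case 1 show ?case using m1 \<rho>0 by simp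
    next
      case (2 A B R Bad lam)
      define \<phi> where "\<phi> x y = (of_bool (R x y) - lam * of_bool (Bad x y) :: real)" for x y
      have "\<forall>x\<in>A. \<forall>y\<in>B. \<phi> x y \<le> 1" using 2(5) by (auto simp: \<phi>_def of_bool_def)
      then obtain A1 B1 where sub: "A1 \<subseteq> A" "B1 \<subseteq> B" and ne1: "A1 \<noteq> {}" "B1 \<noteq> {}"
        and size1: "\<rho>0 * card A \<le> card A1" "\<rho>0 * card B \<le> card B1"
        and dense: "\<And>A' B'. A' \<subseteq> A1 \<Longrightarrow> B' \<subseteq> B1 \<Longrightarrow> m1 * card A1 \<le> card A' \<Longrightarrow> m1 * card B1 \<le> card B' \<Longrightarrow>
         \<phi>0 / 2 * card A' * card B' \<le> (\<Sum>x\<in>A'. \<Sum>y\<in>B'. \<phi> x y)"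
        using reg[OF 2(1-4), of \<phi>] 2(6) unfolding \<phi>_def by blast
      have fin1: "finite A1" "finite B1" using sub 2(1,2) by (auto intro: finite_subset)
      have pos1: "0 < card A1" "0 < card B1" using fin1 ne1 by (auto simp: card_gt_0_iff)
      have big: "m1 * card A1 \<le> card A'" if "card A1 \<le> 2 * real h * card A'" for A' :: "'b set"
      proof -
        have "m1 * card A1 \<le> 1 / (2 * real h) * card A1" using m1 by (intro mult_right_mono) auto
        also have "\<dots> \<le> card A'" using that assms(4) by (simp add: field_simps)
        finally show ?thesis .
      qed
      have big': "m1 * card B1 \<le> card B'" if "\<delta>' ^ h * card B1 \<le> card B'" for B' :: "'c set"
        using that m1 mult_right_mono[of m1 "\<delta>' ^ h" "real (card B1)"] by linarith
      show ?case
      proof (cases "\<exists>B'\<subseteq>B1. \<delta>' ^ h * card B1 \<le> card B' \<and>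
          card A1 \<le> 2 * real h * card {x\<in>A1. card {y\<in>B'. \<not> R x y} < \<delta>' * card B'}")
        case True
        then obtain B' where B': "B' \<subseteq> B1" "\<delta>' ^ h * card B1 \<le> card B'"
          and "card A1 \<le> 2 * real h * card {x\<in>A1. card {y\<in>B'. \<not> R x y} < \<delta>' * card B'}"
          by blast
        moreover define A' where "A' = {x\<in>A1. card {y\<in>B'. \<not> R x y} < \<delta>' * card B'}"
        ultimately have A': "A' \<subseteq> A1" "card A1 \<le> 2 * real h * card A'" by auto
        have finB': "finite B'" using B' fin1 by (auto intro: finite_subset)
        note m = big[OF A'(2)] big'[OF B'(2)]
        have "0 \<le> \<phi>0 / 2 * card A' * card B'" using assms by simp
        also have "\<dots> \<le> (\<Sum>x\<in>A'. \<Sum>y\<in>B'. \<phi> x y)" by (rule dense) (use A' B' m in auto)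
        also have "\<dots> = (\<Sum>x\<in>A'. \<Sum>y\<in>B'. of_bool (R x y)) - lam * (\<Sum>x\<in>A'. \<Sum>y\<in>B'. of_bool (Bad x y))"
          by (simp add: \<phi>_def sum_subtractf sum_distrib_left)
        also have "(\<Sum>x\<in>A'. \<Sum>y\<in>B'. of_bool (R x y)) \<le> (\<Sum>x\<in>A'. \<Sum>y\<in>B'. (1::real))"
          by (intro sum_mono) auto
        finally have bad: "lam * (\<Sum>x\<in>A'. \<Sum>y\<in>B'. of_bool (Bad x y)) \<le> real (card A') * card B'" by simp
        have "(\<Sum>x\<in>A'. \<Sum>y\<in>B'. of_bool (\<not> R x y)) \<le> (\<Sum>x\<in>A'. \<delta>' * card B')"
          by (rule sum_mono, subst sum_of_bool_card[OF finB'])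
             (auto simp: A'_def intro: less_imp_le)
        also have "\<dots> \<le> (\<Sum>x\<in>A'. \<delta> * card B')"
          by (intro sum_mono mult_right_mono) (use \<delta>' in auto)
        finally have nR: "(\<Sum>x\<in>A'. \<Sum>y\<in>B'. of_bool (\<not> R x y)) \<le> \<delta> * card A' * card B'"
          by (simp add: mult_ac)
        have "A' \<noteq> {}" "B' \<noteq> {}" using m pos1 m1 by (auto simp: mult_le_0_iff)
        moreover have "m1 * \<rho>0 * card A \<le> card A'" "m1 * \<rho>0 * card B \<le> card B'"
        proof -
          have "m1 * (\<rho>0 * card A) \<le> m1 * card A1" "m1 * (\<rho>0 * card B) \<le> m1 * card B1"
            using size1 m1 by (auto intro!: mult_left_mono)
          then show "m1 * \<rho>0 * card A \<le> card A'" "m1 * \<rho>0 * card B \<le> card B'"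
            using m by (auto simp: mult.assoc)
        qed
        ultimately show ?thesis
          using A' B' sub bad nR by (intro exI[of _ A'] exI[of _ B'] conjI) auto
      next
        case False
        have "2 * real h * card {x\<in>A1. card {y\<in>B'. R x y} < \<delta>' * card B'} < card A1"
          if B': "B' \<subseteq> B1" "\<delta>' ^ h * card B1 \<le> card B'" for B'
        proof (rule ccontr)
          define A' where "A' = {x\<in>A1. card {y\<in>B'. R x y} < \<delta>' * card B'}"
          assume "\<not> ?thesis"
          then have A': "A' \<subseteq> A1" "card A1 \<le> 2 * real h * card A'" by (auto simp: A'_def)
          have finB': "finite B'" using B' fin1 by (auto intro: finite_subset)
          have finA': "finite A'" using A' fin1 by (auto intro: finite_subset)
          note m = big[OF A'(2)] big'[OF B'(2)]
          have "A' \<noteq> {}" using m pos1 m1 by (auto simp: mult_le_0_iff)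
          have "\<phi>0 / 2 * card A' * card B' \<le> (\<Sum>x\<in>A'. \<Sum>y\<in>B'. \<phi> x y)"
            by (rule dense) (use A' B' m in auto)
          also have "\<dots> \<le> (\<Sum>x\<in>A'. \<Sum>y\<in>B'. of_bool (R x y))"
            by (intro sum_mono) (use 2(5) in \<open>auto simp: \<phi>_def\<close>)
          also have "\<dots> < (\<Sum>x\<in>A'. \<delta>' * card B')"
            by (rule sum_strict_mono, fact, fact, subst sum_of_bool_card[OF finB']) (auto simp: A'_def)
          also have "\<dots> \<le> (\<Sum>x\<in>A'. \<phi>0 / 2 * card B')"
            by (intro sum_mono mult_right_mono) (use \<delta>' in auto)
          finally show False by simp
        qed
        then have "(card A1 / 2) ^ h * (\<delta>' ^ h * card B1) ^ h
             \<le> card {(f, g) \<in> tuples h A1 \<times> tuples h B1. half_graph h R f g}"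
          using False \<delta>' by (intro card_half_graphs_ge fin1 assms(4)) (auto simp: not_le)
        also have "\<dots> \<le> card {(f, g) \<in> tuples h A \<times> tuples h B. half_graph h R f g}"
        proof (intro of_nat_mono card_mono)
          show "finite {(f, g). (f, g) \<in> tuples h A \<times> tuples h B \<and> half_graph h R f g}"
            by (rule finite_subset[of _ "tuples h A \<times> tuples h B"]) (auto simp: finite_tuples 2)
        qed (use sub in \<open>auto simp: PiE_def Pi_def\<close>)
        also have "\<dots> < \<tau> * card A ^ h * card B ^ h" by (rule 2(7))
        also have "\<dots> = (\<delta>' ^ h / 2) ^ h * (\<rho>0 * card A) ^ h * (\<rho>0 * card B) ^ h"
          by (simp add: \<tau>_def power_mult_distrib)
        also have "\<dots> \<le> (\<delta>' ^ h / 2) ^ h * real (card A1) ^ h * real (card B1) ^ h"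
          using \<delta>' \<rho>0 size1 by (intro mult_mono power_mono) auto
        also have "\<dots> = (card A1 / 2) ^ h * (\<delta>' ^ h * card B1) ^ h"
          by (simp add: power_mult_distrib power_divide)
        finally show ?thesis by simp
      qed
    qed
  qed
qed

text \<open>In a half-graph for the conjunction, each pair \<open>b < a\<close> has some
  \<open>L i\<close> that holds at \<open>(f a, g b)\<close>, while all of them fail at
  \<open>(f b, g a)\<close>. Colour the pair by such an \<open>i\<close>. On a monochromatic set of
  indices a single \<open>L i\<close> shows the half-graph pattern in reversed order, apart from the
  diagonal, about which nothing is known. Even positions for \<open>f\<close> and odd positions for
  \<open>g\<close> avoid the diagonal.\<close>

lemma half_graph_of_conjunction:
  "\<exists>h>0. \<forall>(L :: nat \<Rightarrow> 'b \<Rightarrow> 'c \<Rightarrow> bool) f g. half_graph h (\<lambda>x y. \<forall>i<q. \<not> L i x y) f g \<longrightarrow>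
     (\<exists>i<q. has_half_graph k (L i) (f ` {..<h}) (g ` {..<h}))"
proof -
  obtain N :: nat where N: "partn_lst {..<N} (replicate q (2 * k + 2)) 2"
    using ramsey_full[of "replicate q (2 * k + 2)" 2] by blast
  show ?thesis
  proof (rule exI[of _ "Suc N"], intro conjI allI impI)
    fix L :: "nat \<Rightarrow> 'b \<Rightarrow> 'c \<Rightarrow> bool" and f g
    assume hg: "half_graph (Suc N) (\<lambda>x y. \<forall>i<q. \<not> L i x y) f g"
    define c where "c e = (SOME i. i < q \<and> L i (f (Max e)) (g (Min e)))" for e
    have c: "c e < q \<and> L (c e) (f (Max e)) (g (Min e))" if e: "e \<in> nsets {..<N} 2" for e
    proof -
      obtain a b where ab: "e = {a, b}" "a < b" "b < N"
        using e unfolding ordered_nsets_2_eq by auto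
      then have "Max e = b" "Min e = a" by auto
      then have "\<exists>i. i < q \<and> L i (f (Max e)) (g (Min e))"
        using hg[unfolded half_graph_def, rule_format, of b a] ab by auto
      then show ?thesis unfolding c_def by (rule someI_ex)
    qed
    then have "c \<in> nsets {..<N} 2 \<rightarrow> {..<q}" by auto
    then have "\<exists>i<q. monochromatic {..<N} (2 * k + 2) 2 c i"
      using N by (fastforce simp: partn_lst_def)
    then obtain i where i: "i < q" "monochromatic {..<N} (2 * k + 2) 2 c i" by blast
    then obtain I where I: "I \<in> nsets {..<N} (2 * k + 2)" and mono: "c ` nsets I 2 \<subseteq> {i}"
      by (auto simp: monochromatic_def)
    have finI: "finite I" and cardI: "card I = 2 * k + 2" and IN: "I \<subseteq> {..<N}"
      using I by (auto simp: nsets_def)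
    define e where "e n = sorted_list_of_set I ! n" for n
    have e_in: "e n \<in> I" if "n < 2 * k + 2" for n
      using that finI cardI unfolding e_def
      by (metis length_sorted_list_of_set nth_mem set_sorted_list_of_set)
    have e_less: "e m < e n" if "m < n" "n < 2 * k + 2" for m n
      using that cardI strict_sorted_list_of_set[of I] unfolding e_def
      by (simp add: sorted_wrt_iff_nth_less)
    have L1: "L i (f (e n)) (g (e m))" if "m < n" "n < 2 * k + 2" for m n
    proof -
      have in2: "{e m, e n} \<in> nsets I 2"
        using e_less[OF that] e_in[of m] e_in[of n] that by auto
      then have "c {e m, e n} = i" using mono by blast
      moreover have "{e m, e n} \<in> nsets {..<N} 2"
        using in2 IN by (auto simp: nsets_def)
      moreover have "Max {e m, e n} = e n" "Min {e m, e n} = e m"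
        using e_less[OF that] by auto
      ultimately show ?thesis using c[of "{e m, e n}"] by auto
    qed
    have L0: "\<not> L i (f (e m)) (g (e n))" if "m < n" "n < 2 * k + 2" for m n
    proof -
      have "e n < N" using e_in[OF that(2)] IN by auto
      then have "\<forall>i<q. \<not> L i (f (e m)) (g (e n))"
        using hg[unfolded half_graph_def, rule_format, of "e m" "e n"] e_less[OF that] by auto
      then show ?thesis using i by blast
    qed
    have "has_half_graph k (L i) (f ` {..<Suc N}) (g ` {..<Suc N})"
    \<comment> \<open>The terms \<open>k - p\<close> and \<open>k - s\<close> undo the reversal. The
      largest position used is \<open>2 * k + 1\<close>, hence a monochromatic set of size
      \<open>2 * k + 2\<close>.\<close>
    proof (rule has_half_graphI[of "\<lambda>p. f (e (2 * (k - p)))" _ _ "\<lambda>s. g (e (2 * (k - s) + 1))"])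
      have "e (2 * (k - p)) < Suc N" "e (2 * (k - p) + 1) < Suc N" for p
        using e_in[of "2 * (k - p)"] e_in[of "2 * (k - p) + 1"] IN by fastforce+
      then show "(\<lambda>p. f (e (2 * (k - p)))) ` {..<k} \<subseteq> f ` {..<Suc N}"
        "(\<lambda>s. g (e (2 * (k - s) + 1))) ` {..<k} \<subseteq> g ` {..<Suc N}"
        by auto
      show "half_graph k (L i) (\<lambda>p. f (e (2 * (k - p)))) (\<lambda>s. g (e (2 * (k - s) + 1)))"
        unfolding half_graph_def
      proof (intro allI impI)
        fix p s assume "p < k" "s < k"
        show "L i (f (e (2 * (k - p)))) (g (e (2 * (k - s) + 1))) = (p < s)"
        proof (cases "p < s")
          case True
          then have "2 * (k - s) + 1 < 2 * (k - p)" using \<open>s < k\<close> by auto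
          then show ?thesis using L1[of "2 * (k - s) + 1" "2 * (k - p)"] True by auto
        next
          case False
          then have "2 * (k - p) < 2 * (k - s) + 1" by auto
          then show ?thesis using L0[of "2 * (k - p)" "2 * (k - s) + 1"] False by auto
        qed
      qed
    qed
    then show "\<exists>i<q. has_half_graph k (L i) (f ` {..<Suc N}) (g ` {..<Suc N})" using i by blast
  qed simp
qed

section \<open>Sampling a tuple to free one side of a box from its dependence on x\<close>

lemma sum_eq_card_Collect: "finite B \<Longrightarrow> (\<Sum>y\<in>B. if P y then a else 0) = a * real (card {y\<in>B. P y})"
  by (simp add: sum.If_cases Int_def)

text \<open>For a random tuple \<open>Q\<close> from \<open>Sx x\<close>, a \<open>t\<close> related
  to at most \<open>m / (2 * q)\<close> elements of \<open>Sx x\<close> avoids all of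
  \<open>Q\<close> with probability at least 1/2, whereas a \<open>t\<close> related to more than
  \<open>\<beta> * m\<close> of them does so with probability at most
  \<open>(1 - \<beta>) ^ q\<close>, which is small even after multiplication by \<open>lam\<close>.
  So some fixed \<open>Q\<close> does well on average, and
  \<open>dense_box_of_few_half_graphs\<close> applies to the relation of avoiding it. The fibre
  \<open>Sx x\<close> still depends on \<open>x\<close>; the set \<open>T'\<close> does not.\<close>

lemma sampling_box:
  fixes \<beta> lam \<eta> \<sigma> :: real
  assumes \<beta>: "0 \<le> \<beta>" "\<beta> < 1" and lam: "1 < lam" and \<eta>: "0 < \<eta>" and \<sigma>: "0 < \<sigma>"
    and q: "lam * (1 - \<beta>) ^ q \<le> \<eta> / 8"
  shows "\<exists>h>0. \<exists>\<tau>::real>0. \<exists>\<rho>::real>0. \<forall>(X::'b set) (S::'c set) (T::'d set) v Sx m.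
    finite X \<longrightarrow> finite S \<longrightarrow> finite T \<longrightarrow> X \<noteq> {} \<longrightarrow> S \<noteq> {} \<longrightarrow> T \<noteq> {} \<longrightarrow> 0 < m \<longrightarrow> \<sigma> * card S \<le> m \<longrightarrow>
    (\<forall>x\<in>X. Sx x \<subseteq> S \<and> card (Sx x) = m) \<longrightarrow>
    (\<forall>s\<in>S. card (half_graph_tuples k h (\<lambda>x t. v x s t) X T) < \<tau> * card X ^ h * card T ^ h) \<longrightarrow>
    \<eta> * card X * card T \<le> (\<Sum>x\<in>X. card {t\<in>T. 2 * q * card {s\<in>Sx x. v x s t} \<le> m}) \<longrightarrow>
    (\<exists>X' T'. X' \<subseteq> X \<and> T' \<subseteq> T \<and> X' \<noteq> {} \<and> T' \<noteq> {} \<and> \<rho> * card X \<le> card X' \<and> \<rho> * card T \<le> card T' \<and>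
       (\<Sum>x\<in>X'. \<Sum>t\<in>T'. card {s\<in>Sx x. v x s t}) \<le> (\<beta> + 2 / lam) * m * card X' * card T')"
proof -
  obtain h where h: "0 < h" and conj: "\<forall>(L :: nat \<Rightarrow> 'b \<Rightarrow> 'd \<Rightarrow> bool) f g. half_graph h (\<lambda>x y. \<forall>i<q. \<not> L i x y) f g \<longrightarrow>
     (\<exists>i<q. has_half_graph k (L i) (f ` {..<h}) (g ` {..<h}))"
    using half_graph_of_conjunction[where ?'b = 'b and ?'c = 'd, of q k] by (elim exE conjE)
  have "0 < \<eta> / 4" "0 < 1 / lam" "1 / lam < 1" using \<eta> lam by auto
  from dense_box_of_few_half_graphs[OF this h, where ?'b = 'b and ?'c = 'd]
  obtain \<tau>1 \<rho>1 :: real where \<tau>1: "0 < \<tau>1" and \<rho>1: "0 < \<rho>1" and box: "\<forall>(A::'b set) (B::'d set) R Bad (lam'::real). finite A \<longrightarrow> finite B \<longrightarrow> A \<noteq> {} \<longrightarrow> B \<noteq> {} \<longrightarrow>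
    0 \<le> lam' \<longrightarrow>
    \<eta> / 4 * card A * card B \<le> (\<Sum>x\<in>A. \<Sum>y\<in>B. of_bool (R x y) - lam' * of_bool (Bad x y)) \<longrightarrow>
    card {(f, g) \<in> tuples h A \<times> tuples h B. half_graph h R f g} < \<tau>1 * card A ^ h * card B ^ h \<longrightarrow>
    (\<exists>A' B'. A' \<subseteq> A \<and> B' \<subseteq> B \<and> A' \<noteq> {} \<and> B' \<noteq> {} \<and> \<rho>1 * card A \<le> card A' \<and> \<rho>1 * card B \<le> card B' \<and>
       (\<Sum>x\<in>A'. \<Sum>y\<in>B'. of_bool (\<not> R x y)) \<le> 1 / lam * card A' * card B' \<and>
       lam' * (\<Sum>x\<in>A'. \<Sum>y\<in>B'. of_bool (Bad x y)) \<le> real (card A') * card B')"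
    by (elim exE conjE) rule
  \<comment> \<open>Among all tuples from \<open>S\<close>, at least a share of
    \<open>\<sigma> ^ q\<close> lies in a given \<open>Sx x\<close>; \<open>\<eta> / 8\<close> is
    what the estimates below leave of the mean of \<open>\<psi>\<close>.\<close>
  define c where "c = \<sigma> ^ q * \<eta> / 8"
  have c: "0 < c" using \<sigma> \<eta> by (simp add: c_def)
  \<comment> \<open>The half-graphs of \<open>q\<close> relations are added up, and they are
    compared with tuples from \<open>XQ Q\<close>, which has relative size at least \<open>c\<close>
    in \<open>X\<close>.\<close>
  define \<tau> where "\<tau> = \<tau>1 * c ^ h / (real q + 1)"
  have \<tau>: "0 < \<tau>" using \<tau>1 c by (simp add: \<tau>_def)
  have q\<tau>: "q * \<tau> < \<tau>1 * c ^ h" using \<tau>1 c by (simp add: \<tau>_def field_simps)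
  define \<rho> where "\<rho> = \<rho>1 * min c 1"
  have \<rho>: "0 < \<rho>" "\<rho> \<le> \<rho>1 * c" "\<rho> \<le> \<rho>1" using \<rho>1 c by (auto simp: \<rho>_def)
  have main: "\<exists>X' T'. X' \<subseteq> X \<and> T' \<subseteq> T \<and> X' \<noteq> {} \<and> T' \<noteq> {} \<and> \<rho> * card X \<le> card X' \<and> \<rho> * card T \<le> card T' \<and>
       (\<Sum>x\<in>X'. \<Sum>t\<in>T'. card {s\<in>Sx x. v x s t}) \<le> (\<beta> + 2 / lam) * m * card X' * card T'"
    if fin: "finite X" "finite S" "finite T" and ne: "X \<noteq> {}" "S \<noteq> {}" "T \<noteq> {}"
      and m: "0 < m" "\<sigma> * card S \<le> m" and Sx: "\<forall>x\<in>X. Sx x \<subseteq> S \<and> card (Sx x) = m"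
      and few: "\<forall>s\<in>S. card (half_graph_tuples k h (\<lambda>x t. v x s t) X T) < \<tau> * card X ^ h * card T ^ h"
      and many: "\<eta> * card X * card T \<le> (\<Sum>x\<in>X. card {t\<in>T. 2 * q * card {s\<in>Sx x. v x s t} \<le> m})"
    for X :: "'b set" and S :: "'c set" and T :: "'d set" and v Sx and m :: nat
  proof -
    define p where "p x t = card {s\<in>Sx x. v x s t}" for x t
    define R where "R Q x t \<longleftrightarrow> (\<forall>i<q. \<not> v x (Q i) t)" for Q x t
    define Bad where "Bad x t \<longleftrightarrow> \<beta> * m < p x t" for x t
    \<comment> \<open>Because \<open>\<eta> / 4\<close> is subtracted at every pair, a nonnegative
      sum over \<open>XQ Q\<close> means density at least \<open>\<eta> / 4\<close> relative to
      \<open>XQ Q\<close> itself. A sum of at least \<open>c * card X * card T\<close> moreover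
      bounds the size of \<open>XQ Q\<close> from below, as \<open>\<psi> \<le> 1\<close>.\<close>
    define \<psi> where "\<psi> Q x t = of_bool (R Q x t) - lam * of_bool (R Q x t \<and> Bad x t) - \<eta> / 4" for Q x t
    define XQ where "XQ Q = {x\<in>X. Q \<in> tuples q (Sx x)}" for Q
    have finSx: "finite (Sx x)" if "x \<in> X" for x using Sx that fin finite_subset by blast
    have p_le: "p x t \<le> m" if "x \<in> X" for x t
      using Sx that finSx[OF that] unfolding p_def by (metis (mono_tags, lifting) card_mono mem_Collect_eq subsetI)
    have pointwise: "real m ^ q * (of_bool (2 * q * p x t \<le> m) / 2 - 3 * \<eta> / 8) \<le> (\<Sum>Q\<in>tuples q (Sx x). \<psi> Q x t)"
      if x: "x \<in> X" for x t
    proof -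
      have "{Q \<in> tuples q (Sx x). R Q x t} = tuples q {s\<in>Sx x. \<not> v x s t}"
        by (auto simp: R_def PiE_def Pi_def)
      moreover have "card {s\<in>Sx x. \<not> v x s t} = m - p x t"
      proof -
        have "{s\<in>Sx x. \<not> v x s t} = Sx x - {s\<in>Sx x. v x s t}" by auto
        then show ?thesis using Sx x finSx[OF x] by (simp add: card_Diff_subset p_def)
      qed
      ultimately have cardR: "card {Q \<in> tuples q (Sx x). R Q x t} = (m - p x t) ^ q"
        by (simp add: card_tuples)
      define a where "a = (1 - p x t / m) ^ q"
      have "real (m - p x t) = m * (1 - p x t / m)"
        using p_le[OF x, of t] m by (simp add: of_nat_diff field_simps)
      then have R_eq: "real ((m - p x t) ^ q) = real m ^ q * a" by (simp add: a_def power_mult_distrib)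
      have fr: "0 \<le> p x t / m" "p x t / m \<le> 1" using p_le[OF x, of t] m by auto
      then have a0: "0 \<le> a" by (simp add: a_def)
      have "(\<Sum>Q\<in>tuples q (Sx x). \<psi> Q x t)
          = (\<Sum>Q\<in>tuples q (Sx x). (if R Q x t then 1 - lam * of_bool (Bad x t) else 0) - \<eta> / 4)"
        by (rule sum.cong) (auto simp: \<psi>_def)
      also have "\<dots> = (1 - lam * of_bool (Bad x t)) * (real m ^ q * a) - real m ^ q * (\<eta> / 4)"
      proof -
        have "(\<Sum>Q\<in>tuples q (Sx x). if R Q x t then 1 - lam * of_bool (Bad x t) else 0)
            = (1 - lam * of_bool (Bad x t)) * (real m ^ q * a)"
          by (subst sum_eq_card_Collect) (simp_all only: cardR R_eq finite_tuples[OF finSx[OF x]])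
        moreover have "card (tuples q (Sx x)) = m ^ q" using Sx x by (simp add: card_tuples)
        ultimately show ?thesis by (simp add: sum_subtractf)
      qed
      also have "\<dots> = real m ^ q * (a - lam * (of_bool (Bad x t) * a) - \<eta> / 4)" by (simp add: algebra_simps)
      also have "\<dots> \<ge> real m ^ q * (of_bool (2 * q * p x t \<le> m) / 2 - 3 * \<eta> / 8)"
      proof (rule mult_left_mono)
        have "of_bool (Bad x t) * a \<le> (1 - \<beta>) ^ q"
        proof (cases "Bad x t")
          case True
          then have "\<beta> \<le> p x t / m" using m by (simp add: Bad_def field_simps)
          then have "a \<le> (1 - \<beta>) ^ q" unfolding a_def using fr by (intro power_mono) auto
          with True show ?thesis by simp
        qed (use \<beta> in simp)
        then have "lam * (of_bool (Bad x t) * a) \<le> lam * (1 - \<beta>) ^ q" using lam by (intro mult_left_mono) auto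
        moreover have "of_bool (2 * q * p x t \<le> m) / 2 \<le> a"
        proof (cases "2 * q * p x t \<le> m")
          case True
          \<comment> \<open>Bernoulli's inequality; the factor \<open>2 * q\<close> in the
            hypothesis is made to leave 1/2 here.\<close>
          have "1 + q * (- (p x t / m)) \<le> (1 + - (p x t / m)) ^ q"
            using fr by (intro Bernoulli_inequality) auto
          moreover have "q * (p x t / m) \<le> 1 / 2"
          proof -
            have "real (2 * q * p x t) \<le> real m" using True by (simp only: of_nat_le_iff)
            then show ?thesis using m by (simp add: field_simps)
          qed
          ultimately show ?thesis using True by (simp add: a_def)
        qed (use a0 in simp)
        ultimately show "of_bool (2 * q * p x t \<le> m) / 2 - 3 * \<eta> / 8 \<le> a - lam * (of_bool (Bad x t) * a) - \<eta> / 4"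
          using q by linarith
      qed simp
      finally show ?thesis .
    qed
    have "\<eta> * card X * card T \<le> (\<Sum>x\<in>X. \<Sum>t\<in>T. of_bool (2 * q * p x t \<le> m))"
      using many by (simp only: sum_of_bool_card[OF fin(3)] p_def of_nat_sum)
    then have "real m ^ q * (\<eta> * card X * card T / 2 - 3 * \<eta> / 8 * card X * card T)
        \<le> real m ^ q * ((\<Sum>x\<in>X. \<Sum>t\<in>T. of_bool (2 * q * p x t \<le> m)) / 2 - 3 * \<eta> / 8 * card X * card T)"
      by (intro mult_left_mono) auto
    also have "\<dots> = (\<Sum>x\<in>X. \<Sum>t\<in>T. real m ^ q * (of_bool (2 * q * p x t \<le> m) / 2 - 3 * \<eta> / 8))"
      by (simp add: sum_subtractf sum_distrib_left[symmetric] sum_divide_distrib[symmetric] algebra_simps)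
    also have "\<dots> \<le> (\<Sum>x\<in>X. \<Sum>t\<in>T. \<Sum>Q\<in>tuples q (Sx x). \<psi> Q x t)"
      by (intro sum_mono pointwise)
    also have "\<dots> = (\<Sum>x\<in>X. \<Sum>Q\<in>tuples q (Sx x). \<Sum>t\<in>T. \<psi> Q x t)"
      by (rule sum.cong[OF refl], rule sum.swap)
    also have "\<dots> = (\<Sum>x\<in>X. \<Sum>Q\<in>{Q\<in>tuples q S. Q \<in> tuples q (Sx x)}. \<Sum>t\<in>T. \<psi> Q x t)"
    proof (rule sum.cong[OF refl])
      fix x assume "x \<in> X"
      then have "tuples q (Sx x) \<subseteq> tuples q S" using Sx by (intro PiE_mono) auto
      then have "{Q\<in>tuples q S. Q \<in> tuples q (Sx x)} = tuples q (Sx x)" by auto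
      then show "(\<Sum>Q\<in>tuples q (Sx x). \<Sum>t\<in>T. \<psi> Q x t) = (\<Sum>Q\<in>{Q\<in>tuples q S. Q \<in> tuples q (Sx x)}. \<Sum>t\<in>T. \<psi> Q x t)"
        by simp
    qed
    also have "\<dots> = (\<Sum>Q\<in>tuples q S. \<Sum>x\<in>XQ Q. \<Sum>t\<in>T. \<psi> Q x t)"
      unfolding XQ_def by (rule sum.swap_restrict) (use fin in \<open>auto simp: finite_tuples\<close>)
    finally have total: "real m ^ q * (\<eta> / 8 * card X * card T) \<le> (\<Sum>Q\<in>tuples q S. \<Sum>x\<in>XQ Q. \<Sum>t\<in>T. \<psi> Q x t)"
      by (simp add: algebra_simps)
    have "\<exists>Q\<in>tuples q S. c * card X * card T \<le> (\<Sum>x\<in>XQ Q. \<Sum>t\<in>T. \<psi> Q x t)"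
    proof (rule ccontr)
      assume "\<not> ?thesis"
      then have "(\<Sum>x\<in>XQ Q. \<Sum>t\<in>T. \<psi> Q x t) < c * card X * card T" if "Q \<in> tuples q S" for Q
        using that by (meson not_le)
      then have "(\<Sum>Q\<in>tuples q S. \<Sum>x\<in>XQ Q. \<Sum>t\<in>T. \<psi> Q x t) < (\<Sum>Q\<in>tuples q S. c * card X * card T)"
        using ne fin by (intro sum_strict_mono) (auto simp: finite_tuples PiE_eq_empty_iff)
      also have "\<dots> = (\<sigma> * card S) ^ q * (\<eta> / 8 * card X * card T)"
        by (simp add: card_tuples c_def power_mult_distrib)
      also have "\<dots> \<le> real m ^ q * (\<eta> / 8 * card X * card T)"
        using m \<sigma> \<eta> by (intro mult_right_mono power_mono) auto
      finally show False using total by linarith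
    qed
    then obtain Q where Q: "Q \<in> tuples q S" "c * card X * card T \<le> (\<Sum>x\<in>XQ Q. \<Sum>t\<in>T. \<psi> Q x t)"
      by blast
    have subX: "XQ Q \<subseteq> X" and finXQ: "finite (XQ Q)" using fin by (auto simp: XQ_def)
    have "(\<Sum>x\<in>XQ Q. \<Sum>t\<in>T. \<psi> Q x t) \<le> (\<Sum>x\<in>XQ Q. \<Sum>t\<in>T. 1)"
      by (intro sum_mono) (use lam \<eta> in \<open>auto simp: \<psi>_def of_bool_def\<close>)
    then have "c * card X * card T \<le> card (XQ Q) * card T" using Q by simp
    moreover have posT: "0 < card T" and posX: "0 < card X" using ne fin by (auto simp: card_gt_0_iff)
    ultimately have cX: "c * card X \<le> card (XQ Q)" by simp
    moreover have "0 < c * card X" using c posX by simp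
    ultimately have "XQ Q \<noteq> {}" by (metis card.empty not_less of_nat_0)
    have "0 \<le> c * card X * card T" using c by simp
    have dens: "\<eta> / 4 * card (XQ Q) * card T
        \<le> (\<Sum>x\<in>XQ Q. \<Sum>t\<in>T. of_bool (R Q x t) - lam * of_bool (R Q x t \<and> Bad x t))"
    proof -
      have "(\<Sum>x\<in>XQ Q. \<Sum>t\<in>T. \<psi> Q x t) = (\<Sum>x\<in>XQ Q. \<Sum>t\<in>T. of_bool (R Q x t) - lam * of_bool (R Q x t \<and> Bad x t))
          - \<eta> / 4 * card (XQ Q) * card T"
        by (simp add: \<psi>_def sum_subtractf)
      then show ?thesis using Q(2) \<open>0 \<le> c * card X * card T\<close> by linarith
    qed
    have "{(f, g) \<in> tuples h (XQ Q) \<times> tuples h T. half_graph h (R Q) f g}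
        \<subseteq> (\<Union>i<q. half_graph_tuples k h (\<lambda>x t. v x (Q i) t) X T)"
    proof clarify
      fix f g assume f: "f \<in> tuples h (XQ Q)" and g: "g \<in> tuples h T" and hg: "half_graph h (R Q) f g"
      have "f \<in> tuples h X" using f subX by (auto simp: PiE_def)
      moreover obtain i where "i < q" "has_half_graph k (\<lambda>x t. v x (Q i) t) (f ` {..<h}) (g ` {..<h})"
        using conj[rule_format, of "\<lambda>i x t. v x (Q i) t" f g] hg unfolding R_def by blast
      ultimately show "(f, g) \<in> (\<Union>i<q. half_graph_tuples k h (\<lambda>x t. v x (Q i) t) X T)"
        using g by (auto simp: half_graph_tuples_def)
    qed
    then have "card {(f, g) \<in> tuples h (XQ Q) \<times> tuples h T. half_graph h (R Q) f g}
        \<le> card (\<Union>i<q. half_graph_tuples k h (\<lambda>x t. v x (Q i) t) X T)"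
      by (intro card_mono finite_UN_I finite_half_graph_tuples fin) auto
    also have "\<dots> \<le> (\<Sum>i<q. card (half_graph_tuples k h (\<lambda>x t. v x (Q i) t) X T))"
      by (rule card_UN_le) simp
    finally have "real (card {(f, g) \<in> tuples h (XQ Q) \<times> tuples h T. half_graph h (R Q) f g})
        \<le> (\<Sum>i<q. real (card (half_graph_tuples k h (\<lambda>x t. v x (Q i) t) X T)))"
      by (simp only: of_nat_sum[symmetric] of_nat_le_iff)
    also have "\<dots> \<le> (\<Sum>i<q. \<tau> * card X ^ h * card T ^ h)"
    proof (rule sum_mono)
      fix i assume "i \<in> {..<q}"
      then have "Q i \<in> S" using Q by auto
      then show "real (card (half_graph_tuples k h (\<lambda>x t. v x (Q i) t) X T)) \<le> \<tau> * card X ^ h * card T ^ h"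
        using few by (simp add: less_imp_le)
    qed
    also have "\<dots> = (q * \<tau>) * (real (card X) ^ h * real (card T) ^ h)" by simp
    also have "\<dots> < (\<tau>1 * c ^ h) * (real (card X) ^ h * real (card T) ^ h)"
      using posX posT by (intro mult_strict_right_mono q\<tau>) auto
    also have "\<dots> = \<tau>1 * (c * card X) ^ h * card T ^ h" by (simp add: power_mult_distrib)
    also have "\<dots> \<le> \<tau>1 * real (card (XQ Q)) ^ h * card T ^ h"
      using \<tau>1 c cX by (intro mult_right_mono mult_left_mono power_mono) auto
    finally have few': "card {(f, g) \<in> tuples h (XQ Q) \<times> tuples h T. half_graph h (R Q) f g}
       < \<tau>1 * card (XQ Q) ^ h * card T ^ h" by simp
    have "0 \<le> lam" using lam by simp
    from box[rule_format, OF finXQ fin(3) \<open>XQ Q \<noteq> {}\<close> ne(3) this dens few']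
    obtain X' T' where XT: "X' \<subseteq> XQ Q" "T' \<subseteq> T" "X' \<noteq> {}" "T' \<noteq> {}"
      and size: "\<rho>1 * card (XQ Q) \<le> card X'" "\<rho>1 * card T \<le> card T'"
      and nR: "(\<Sum>x\<in>X'. \<Sum>t\<in>T'. of_bool (\<not> R Q x t)) \<le> 1 / lam * card X' * card T'"
      and bad: "lam * (\<Sum>x\<in>X'. \<Sum>t\<in>T'. of_bool (R Q x t \<and> Bad x t)) \<le> real (card X') * card T'"
      by blast
    have "\<rho>1 * (c * card X) \<le> \<rho>1 * card (XQ Q)" using cX \<rho>1 by simp
    moreover have "\<rho> * card X \<le> \<rho>1 * c * card X" "\<rho> * card T \<le> \<rho>1 * card T"
      using \<rho> by (auto intro!: mult_right_mono)
    ultimately have size': "\<rho> * card X \<le> card X'" "\<rho> * card T \<le> card T'"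
      using size by (auto simp: mult.assoc)
    \<comment> \<open>A fibre count is at most \<open>m\<close> at pairs outside \<open>R Q\<close>
      and at surviving bad pairs, each kind having a share of at most \<open>1 / lam\<close>, and at
      most \<open>\<beta> * m\<close> at all other pairs.\<close>
    have "real (\<Sum>x\<in>X'. \<Sum>t\<in>T'. p x t)
        \<le> (\<Sum>x\<in>X'. \<Sum>t\<in>T'. m * of_bool (\<not> R Q x t) + m * of_bool (R Q x t \<and> Bad x t) + \<beta> * m)"
      unfolding of_nat_sum
    proof (intro sum_mono)
      fix x t assume "x \<in> X'" "t \<in> T'"
      then have "p x t \<le> m" using p_le XT subX by blast
      moreover have "0 \<le> \<beta> * m" using \<beta> by simp
      ultimately show "real (p x t) \<le> m * of_bool (\<not> R Q x t) + m * of_bool (R Q x t \<and> Bad x t) + \<beta> * m"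
        by (auto simp: Bad_def of_bool_def)
    qed
    also have "\<dots> = real m * (\<Sum>x\<in>X'. \<Sum>t\<in>T'. of_bool (\<not> R Q x t))
        + real m * (\<Sum>x\<in>X'. \<Sum>t\<in>T'. of_bool (R Q x t \<and> Bad x t)) + \<beta> * m * card X' * card T'"
      by (simp add: sum.distrib sum_distrib_left mult_ac)
    also have "\<dots> \<le> m * (1 / lam * card X' * card T') + m * (1 / lam * card X' * card T') + \<beta> * m * card X' * card T'"
    proof -
      have "(\<Sum>x\<in>X'. \<Sum>t\<in>T'. of_bool (R Q x t \<and> Bad x t)) \<le> 1 / lam * card X' * card T'"
        using bad lam by (simp add: field_simps)
      then have "real m * (\<Sum>x\<in>X'. \<Sum>t\<in>T'. of_bool (R Q x t \<and> Bad x t)) \<le> m * (1 / lam * card X' * card T')"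
        by (rule mult_left_mono) simp
      moreover have "real m * (\<Sum>x\<in>X'. \<Sum>t\<in>T'. of_bool (\<not> R Q x t)) \<le> m * (1 / lam * card X' * card T')"
        by (rule mult_left_mono[OF nR]) simp
      ultimately show ?thesis by linarith
    qed
    also have "\<dots> = (\<beta> + 2 / lam) * m * card X' * card T'" by (simp add: field_simps)
    finally have "(\<Sum>x\<in>X'. \<Sum>t\<in>T'. card {s\<in>Sx x. v x s t}) \<le> (\<beta> + 2 / lam) * m * card X' * card T'"
      by (simp add: p_def)
    then show ?thesis using XT subX size' by (intro exI[of _ X'] exI[of _ T']) auto
  qed
  show ?thesis
    by (rule exI[of _ h], rule conjI[OF h], rule exI[of _ \<tau>], rule conjI[OF \<tau>], rule exI[of _ \<rho>],
        rule conjI[OF \<rho>(1)], intro allI impI, rule main; assumption)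
qed

text \<open>Double counting of \<open>s\<close> against pairs of \<open>h\<close>-tuples: the ranges
  of such a pair contain at most \<open>h ^ k * h ^ k\<close> pairs of \<open>k\<close>-tuples, and
  each of these is a half-graph for at most \<open>c\<close> elements \<open>s\<close>. The bound on
  the number of exceptional \<open>s\<close> does not grow with \<open>S\<close>, \<open>A\<close>
  or \<open>B\<close>, so in a large set they can be discarded.\<close>

lemma card_many_half_graph_tuples:
  fixes L :: "'s \<Rightarrow> 'b \<Rightarrow> 'c \<Rightarrow> bool" and \<tau> :: real
  assumes fin: "finite S" "finite A" "finite B" and ne: "A \<noteq> {}" "B \<noteq> {}"
    and c: "\<And>f g. f \<in> tuples k A \<Longrightarrow> g \<in> tuples k B \<Longrightarrow> card {s\<in>S. half_graph k (L s) f g} \<le> c"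
  shows "\<tau> * card {s\<in>S. \<tau> * card A ^ h * card B ^ h \<le> card (half_graph_tuples k h (L s) A B)} \<le> c * h ^ k * h ^ k"
proof -
  let ?T = "tuples h A \<times> tuples h B"
  define M where "M = {s\<in>S. \<tau> * card A ^ h * card B ^ h \<le> card (half_graph_tuples k h (L s) A B)}"
  have "\<tau> * card M * (real (card A) ^ h * card B ^ h) = (\<Sum>s\<in>M. \<tau> * card A ^ h * card B ^ h)" by simp
  also have "\<dots> \<le> (\<Sum>s\<in>M. real (card (half_graph_tuples k h (L s) A B)))"
    by (rule sum_mono) (simp add: M_def)
  also have "\<dots> \<le> (\<Sum>s\<in>S. real (card (half_graph_tuples k h (L s) A B)))"
    by (rule sum_mono2) (auto simp: M_def fin)
  also have "\<dots> = real (\<Sum>s\<in>S. card {p\<in>?T. has_half_graph k (L s) (fst p ` {..<h}) (snd p ` {..<h})})"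
    by (simp add: half_graph_tuples_def case_prod_beta' mem_Times_iff conj_assoc)
  also have "(\<Sum>s\<in>S. card {p\<in>?T. has_half_graph k (L s) (fst p ` {..<h}) (snd p ` {..<h})})
      = (\<Sum>p\<in>?T. card {s\<in>S. has_half_graph k (L s) (fst p ` {..<h}) (snd p ` {..<h})})"
    by (rule sum_multicount_gen) (use fin in \<open>auto simp: finite_tuples\<close>)
  also have "real \<dots> \<le> (\<Sum>p\<in>?T. real (c * h ^ k * h ^ k))"
    unfolding of_nat_sum
  proof (intro sum_mono of_nat_mono)
    fix p assume p: "p \<in> ?T"
    obtain f g where fg: "p = (f, g)" by force
    let ?A = "f ` {..<h}" and ?B = "g ` {..<h}"
    have sub: "tuples k ?A \<subseteq> tuples k A" "tuples k ?B \<subseteq> tuples k B"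
      using p fg by (intro PiE_mono; force)+
    have fint: "finite (tuples k ?A)" "finite (tuples k ?B)" by (auto simp: finite_tuples)
    have "{s\<in>S. has_half_graph k (L s) ?A ?B} \<subseteq> (\<Union>q\<in>tuples k ?A \<times> tuples k ?B. {s\<in>S. half_graph k (L s) (fst q) (snd q)})"
    proof
      fix s assume "s \<in> {s\<in>S. has_half_graph k (L s) ?A ?B}"
      then obtain f' g' where "s \<in> S" "f' \<in> tuples k ?A" "g' \<in> tuples k ?B" "half_graph k (L s) f' g'"
        unfolding has_half_graph_def by blast
      then show "s \<in> (\<Union>q\<in>tuples k ?A \<times> tuples k ?B. {s\<in>S. half_graph k (L s) (fst q) (snd q)})"
        by (intro UN_I[of "(f', g')"]) auto
    qed
    then have "card {s\<in>S. has_half_graph k (L s) ?A ?B}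
        \<le> card (\<Union>q\<in>tuples k ?A \<times> tuples k ?B. {s\<in>S. half_graph k (L s) (fst q) (snd q)})"
      by (intro card_mono finite_UN_I) (auto simp: fint fin)
    also have "\<dots> \<le> (\<Sum>q\<in>tuples k ?A \<times> tuples k ?B. card {s\<in>S. half_graph k (L s) (fst q) (snd q)})"
      by (rule card_UN_le) (simp add: fint)
    also have "\<dots> \<le> (\<Sum>q\<in>tuples k ?A \<times> tuples k ?B. c)"
      by (rule sum_mono, rule c) (metis mem_Times_iff sub subsetD)+
    also have "\<dots> = c * card ?A ^ k * card ?B ^ k"
      by (simp add: card_cartesian_product card_tuples)
    also have "\<dots> \<le> c * h ^ k * h ^ k"
      using card_image_le[of "{..<h}" f] card_image_le[of "{..<h}" g]
      by (intro mult_mono power_mono) auto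
    finally show "card {s\<in>S. has_half_graph k (L s) (fst p ` {..<h}) (snd p ` {..<h})} \<le> c * h ^ k * h ^ k"
      by (simp add: fg)
  qed
  also have "\<dots> = real (c * h ^ k * h ^ k) * (real (card A) ^ h * card B ^ h)"
    by (simp add: card_cartesian_product card_tuples)
  finally have "\<tau> * card M \<le> real (c * h ^ k * h ^ k)"
    using fin ne by (subst (asm) mult_le_cancel_right) (auto simp: card_gt_0_iff)
  then show ?thesis by (simp add: M_def)
qed

section \<open>Two rounds of sampling: from sparse links to a sparse box\<close>

lemma markov_card:
  fixes f :: "'i \<Rightarrow> real"
  assumes "finite I" "\<And>i. i \<in> I \<Longrightarrow> 0 \<le> f i"
  shows "M * card {i\<in>I. M < f i} \<le> sum f I"
proof -
  have "M * card {i\<in>I. M < f i} = (\<Sum>i\<in>{i\<in>I. M < f i}. M)" by simp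
  also have "\<dots> \<le> (\<Sum>i\<in>{i\<in>I. M < f i}. f i)" by (rule sum_mono) auto
  also have "\<dots> \<le> sum f I" by (rule sum_mono2) (use assms in auto)
  finally show ?thesis .
qed

lemma sum_card_swap:
  "finite A \<Longrightarrow> finite B \<Longrightarrow> (\<Sum>a\<in>A. card {b\<in>B. R a b}) = (\<Sum>b\<in>B. card {a\<in>A. R a b})"
  by (rule sum_multicount_gen) auto

text \<open>The case \<open>a > 0\<close> serves the first round of sampling, where \<open>q\<close>
  has to beat a power of a parameter that it determines itself; the second round uses
  \<open>a = 0\<close>. For \<open>a > 0\<close>, taking an \<open>a\<close>-th root reduces the
  claim to the fact that \<open>n * g ^ n\<close> tends to 0.\<close>

lemma exponential_beats_polynomial:
  fixes \<gamma> c C :: real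
  assumes "0 \<le> \<gamma>" "\<gamma> < 1" "0 < c" "0 < C"
  shows "\<exists>q>0. C * \<gamma> ^ q \<le> c * (1 / real q) ^ a"
proof (cases "a = 0")
  case True
  have "(\<lambda>n. C * \<gamma> ^ n) \<longlonglongrightarrow> C * 0" using assms by (intro tendsto_intros) auto
  then have "eventually (\<lambda>n. C * \<gamma> ^ n < c) sequentially"
    by (rule order_tendstoD) (use assms in simp)
  then obtain N where "\<And>n. n \<ge> N \<Longrightarrow> C * \<gamma> ^ n < c" by (auto simp: eventually_sequentially)
  then show ?thesis using True by (intro exI[of _ "Suc N"]) (auto intro: less_imp_le simp del: power_Suc)
next
  case False
  define g where "g = root a \<gamma>"
  have g: "0 \<le> g" "g < 1" "g ^ a = \<gamma>" using assms False by (auto simp: g_def)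
  have "(\<lambda>n. of_nat n * g ^ n) \<longlonglongrightarrow> 0" by (rule powser_times_n_limit_0) (use g in auto)
  then have "(\<lambda>n. C * (of_nat n * g ^ n) ^ a) \<longlonglongrightarrow> C * 0 ^ a" by (intro tendsto_intros)
  then have "eventually (\<lambda>n. C * (of_nat n * g ^ n) ^ a < c) sequentially"
    by (rule order_tendstoD) (use assms False in \<open>simp add: zero_power\<close>)
  then obtain N where N: "\<And>n. n \<ge> N \<Longrightarrow> C * (of_nat n * g ^ n) ^ a < c" by (auto simp: eventually_sequentially)
  define q where "q = Suc N"
  have "C * (of_nat q * g ^ q) ^ a = C * \<gamma> ^ q * real q ^ a"
    by (simp add: power_mult_distrib g(3)[symmetric] power_mult[symmetric] mult.commute)
  then have "C * \<gamma> ^ q * real q ^ a \<le> c" using N[of q] unfolding q_def by linarith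
  then have "C * \<gamma> ^ q \<le> c * (1 / real q) ^ a"
    by (simp add: q_def power_divide field_simps del: power_Suc)
  then show ?thesis by (intro exI[of _ q]) (auto simp: q_def)
qed

text \<open>If every \<open>x\<close> has a box \<open>Ys x \<times> Zs x\<close> on which its link is sparse, then \<open>sampling_box\<close> first
  makes the set \<open>Z'\<close> independent of \<open>x\<close>, and then, with the roles of the last two coordinates
  exchanged, the set \<open>Y'\<close>.  It is essential that the relative size \<open>1 / (2 * a)\<close> of \<open>Ys x\<close> does not
  depend on \<open>\<delta>1\<close>.\<close>

lemma sparse_box_of_sparse_links:
  fixes \<delta> :: real
  assumes \<delta>: "0 < \<delta>" "\<delta> < 1" and a: "0 < a"
  shows "\<exists>\<delta>1::real>0. \<delta>1 \<le> 1 \<and> (\<exists>h1 h2. \<exists>\<tau>::real>0. \<exists>\<rho>::real>0.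
    \<forall>(X::'b set) (Y::'c set) (Z::'d set) w Ys Zs.
    finite X \<longrightarrow> finite Y \<longrightarrow> finite Z \<longrightarrow> X \<noteq> {} \<longrightarrow> Y \<noteq> {} \<longrightarrow> Z \<noteq> {} \<longrightarrow>
    (\<forall>y\<in>Y. card (half_graph_tuples k h1 (\<lambda>x z. w x y z) X Z) < \<tau> * card X ^ h1 * card Z ^ h1) \<longrightarrow>
    (\<forall>z\<in>Z. card (half_graph_tuples k h2 (\<lambda>x y. w x y z) X Y) < \<tau> * card X ^ h2 * card Y ^ h2) \<longrightarrow>
    (\<forall>x\<in>X. Ys x \<subseteq> Y \<and> Zs x \<subseteq> Z \<and> card Y \<le> 2 * a * card (Ys x) \<and> \<delta>1 ^ a * card Z \<le> card (Zs x) \<and>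
       (\<forall>y\<in>Ys x. card {z\<in>Zs x. w x y z} < \<delta>1 * card (Zs x))) \<longrightarrow>
    (\<exists>X' Y' Z'. X' \<subseteq> X \<and> Y' \<subseteq> Y \<and> Z' \<subseteq> Z \<and> X' \<noteq> {} \<and> Y' \<noteq> {} \<and> Z' \<noteq> {} \<and>
       \<rho> * card X \<le> card X' \<and> \<rho> * card Y \<le> card Y' \<and> \<rho> * card Z \<le> card Z' \<and>
       (\<Sum>x\<in>X'. \<Sum>y\<in>Y'. card {z\<in>Z'. w x y z}) \<le> \<delta> * card X' * card Y' * card Z'))"
proof -
  \<comment> \<open>The constants are fixed from the end backwards. The second round depends on
    \<delta> and \<open>a\<close> only and gives \<open>r\<close>; its two accuracies
    \<open>\<delta> / 2\<close> and \<open>2 / (4 / \<delta>)\<close> add up to \<delta>. The first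
    round has to reach density \<open>1 / (4 * r) = \<beta>1 + 2 / lam1\<close>; this gives
    \<open>q\<close>, and \<open>q\<close> gives \<open>\<delta>1\<close>. Since
    \<open>\<eta>2\<close> comes from the relative size of \<open>Ys x\<close>, a size depending on
    \<open>\<delta>1\<close> would close a circle.\<close>
  define \<eta>2 where "\<eta>2 = 1 / (4 * real a)"
  have \<eta>2: "0 < \<eta>2" using a by (simp add: \<eta>2_def)
  have "\<exists>r>0. 4 / \<delta> * (1 - \<delta> / 2) ^ r \<le> \<eta>2 / 8 * (1 / real r) ^ 0"
    by (rule exponential_beats_polynomial) (use \<delta> \<eta>2 in auto)
  then obtain r :: nat where r: "0 < r" "4 / \<delta> * (1 - \<delta> / 2) ^ r \<le> \<eta>2 / 8" by auto
  define \<beta>1 where "\<beta>1 = 1 / (8 * real r)"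
  define lam1 where "lam1 = 16 * real r"
  have \<beta>1: "0 \<le> \<beta>1" "\<beta>1 < 1" and lam1: "1 < lam1" using r by (auto simp: \<beta>1_def lam1_def field_simps)
  \<comment> \<open>The right-hand side is \<open>\<eta>1 / 8\<close> for the
    \<open>\<delta>1\<close> and \<open>\<eta>1\<close> defined below in terms of
    \<open>q\<close>.\<close>
  have "\<exists>q>0. lam1 * (1 - \<beta>1) ^ q \<le> (1 / 4) ^ a / 16 * (1 / real q) ^ a"
    by (rule exponential_beats_polynomial) (use \<beta>1 lam1 r in \<open>auto simp: \<beta>1_def\<close>)
  then obtain q :: nat where q: "0 < q" "lam1 * (1 - \<beta>1) ^ q \<le> (1 / 4) ^ a / 16 * (1 / real q) ^ a" by auto
  define \<delta>1 where "\<delta>1 = 1 / (4 * real q)"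
  have \<delta>1: "0 < \<delta>1" "\<delta>1 \<le> 1" using q by (auto simp: \<delta>1_def field_simps)
  define \<eta>1 where "\<eta>1 = \<delta>1 ^ a / 2"
  have \<eta>1: "0 < \<eta>1" using \<delta>1 by (simp add: \<eta>1_def)
  have q': "lam1 * (1 - \<beta>1) ^ q \<le> \<eta>1 / 8"
    using q by (simp add: \<eta>1_def \<delta>1_def power_divide power_mult_distrib)
  define \<sigma>1 where "\<sigma>1 = 1 / (2 * real a)"
  have \<sigma>1: "0 < \<sigma>1" using a by (simp add: \<sigma>1_def)
  from sampling_box[OF \<beta>1 lam1 \<eta>1 \<sigma>1 q', where ?'b = 'b and ?'c = 'c and ?'d = 'd and k = k]
  obtain h1 and \<tau>1 \<rho>1 :: real where pos1: "0 < \<tau>1" "0 < \<rho>1" and box1: "\<forall>(X::'b set) (S::'c set) (T::'d set) v Sx m.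
    finite X \<longrightarrow> finite S \<longrightarrow> finite T \<longrightarrow> X \<noteq> {} \<longrightarrow> S \<noteq> {} \<longrightarrow> T \<noteq> {} \<longrightarrow> 0 < m \<longrightarrow> \<sigma>1 * card S \<le> m \<longrightarrow>
    (\<forall>x\<in>X. Sx x \<subseteq> S \<and> card (Sx x) = m) \<longrightarrow>
    (\<forall>s\<in>S. card (half_graph_tuples k h1 (\<lambda>x t. v x s t) X T) < \<tau>1 * card X ^ h1 * card T ^ h1) \<longrightarrow>
    \<eta>1 * card X * card T \<le> (\<Sum>x\<in>X. card {t\<in>T. 2 * q * card {s\<in>Sx x. v x s t} \<le> m}) \<longrightarrow>
    (\<exists>X' T'. X' \<subseteq> X \<and> T' \<subseteq> T \<and> X' \<noteq> {} \<and> T' \<noteq> {} \<and> \<rho>1 * card X \<le> card X' \<and> \<rho>1 * card T \<le> card T' \<and>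
       (\<Sum>x\<in>X'. \<Sum>t\<in>T'. card {s\<in>Sx x. v x s t}) \<le> (\<beta>1 + 2 / lam1) * m * card X' * card T')"
    by (elim exE conjE) rule
  have b2: "0 \<le> \<delta> / 2" "\<delta> / 2 < 1" "1 < 4 / \<delta>" "0 < (1::real)" using \<delta> by auto
  from sampling_box[OF b2(1-3) \<eta>2 b2(4) r(2), where ?'b = 'b and ?'c = 'd and ?'d = 'c and k = k]
  obtain h2 and \<tau>2 \<rho>2 :: real where pos2: "0 < \<tau>2" "0 < \<rho>2" and box2: "\<forall>(X::'b set) (S::'d set) (T::'c set) v Sx m.
    finite X \<longrightarrow> finite S \<longrightarrow> finite T \<longrightarrow> X \<noteq> {} \<longrightarrow> S \<noteq> {} \<longrightarrow> T \<noteq> {} \<longrightarrow> 0 < m \<longrightarrow> (1::real) * card S \<le> m \<longrightarrow>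
    (\<forall>x\<in>X. Sx x \<subseteq> S \<and> card (Sx x) = m) \<longrightarrow>
    (\<forall>s\<in>S. card (half_graph_tuples k h2 (\<lambda>x t. v x s t) X T) < \<tau>2 * card X ^ h2 * card T ^ h2) \<longrightarrow>
    \<eta>2 * card X * card T \<le> (\<Sum>x\<in>X. card {t\<in>T. 2 * r * card {s\<in>Sx x. v x s t} \<le> m}) \<longrightarrow>
    (\<exists>X' T'. X' \<subseteq> X \<and> T' \<subseteq> T \<and> X' \<noteq> {} \<and> T' \<noteq> {} \<and> \<rho>2 * card X \<le> card X' \<and> \<rho>2 * card T \<le> card T' \<and>
       (\<Sum>x\<in>X'. \<Sum>t\<in>T'. card {s\<in>Sx x. v x s t}) \<le> (\<delta> / 2 + 2 / (4 / \<delta>)) * m * card X' * card T')"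
    by (elim exE conjE) rule
  define \<tau> where "\<tau> = min \<tau>1 (\<tau>2 * \<rho>1 ^ h2)"
  have \<tau>: "0 < \<tau>" "\<tau> \<le> \<tau>1" "\<tau> \<le> \<tau>2 * \<rho>1 ^ h2" using pos1 pos2 by (auto simp: \<tau>_def)
  define \<rho> where "\<rho> = min (\<rho>1 * \<rho>2) (min \<rho>1 \<rho>2)"
  have \<rho>: "0 < \<rho>" "\<rho> \<le> \<rho>2 * \<rho>1" "\<rho> \<le> \<rho>1" "\<rho> \<le> \<rho>2" using pos1 pos2 by (auto simp: \<rho>_def mult.commute)
  have main: "\<exists>X' Y' Z'. X' \<subseteq> X \<and> Y' \<subseteq> Y \<and> Z' \<subseteq> Z \<and> X' \<noteq> {} \<and> Y' \<noteq> {} \<and> Z' \<noteq> {} \<and>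
       \<rho> * card X \<le> card X' \<and> \<rho> * card Y \<le> card Y' \<and> \<rho> * card Z \<le> card Z' \<and>
       (\<Sum>x\<in>X'. \<Sum>y\<in>Y'. card {z\<in>Z'. w x y z}) \<le> \<delta> * card X' * card Y' * card Z'"
    if fin: "finite X" "finite Y" "finite Z" and ne: "X \<noteq> {}" "Y \<noteq> {}" "Z \<noteq> {}"
      and fewY: "\<forall>y\<in>Y. card (half_graph_tuples k h1 (\<lambda>x z. w x y z) X Z) < \<tau> * card X ^ h1 * card Z ^ h1"
      and fewZ: "\<forall>z\<in>Z. card (half_graph_tuples k h2 (\<lambda>x y. w x y z) X Y) < \<tau> * card X ^ h2 * card Y ^ h2"
      and sparse: "\<forall>x\<in>X. Ys x \<subseteq> Y \<and> Zs x \<subseteq> Z \<and> card Y \<le> 2 * a * card (Ys x) \<and> \<delta>1 ^ a * card Z \<le> card (Zs x) \<and>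
       (\<forall>y\<in>Ys x. card {z\<in>Zs x. w x y z} < \<delta>1 * card (Zs x))"
    for X :: "'b set" and Y :: "'c set" and Z :: "'d set" and w Ys Zs
  proof -
    \<comment> \<open>This is \<open>card Y / (2 * a)\<close> rounded up. All \<open>Ys x\<close>
      are trimmed to this common size because sampling requires fibres of equal size.\<close>
    define m where "m = (card Y + 2 * a - 1) div (2 * a)"
    have posY: "0 < card Y" using ne fin by (auto simp: card_gt_0_iff)
    have m_ge: "card Y \<le> 2 * a * m" and m_le: "\<And>n. card Y \<le> 2 * a * n \<Longrightarrow> m \<le> n" and "0 < m"
    proof -
      have "card Y + 2 * a - 1 < 2 * a * m + 2 * a"
        unfolding m_def using a by (metis add.commute div_mult_mod_eq mod_less_divisor mult.commute nat_0_less_mult_iff nat_add_left_cancel_less zero_less_numeral)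
      then show "card Y \<le> 2 * a * m" by linarith
      then show "0 < m" using posY by (cases m) auto
      fix n assume "card Y \<le> 2 * a * n"
      then have "m \<le> (2 * a * n + 2 * a - 1) div (2 * a)" unfolding m_def by (intro div_le_mono) simp
      also have "\<dots> = n" using a by (simp add: div_nat_eqI)
      finally show "m \<le> n" .
    qed
    have "\<exists>A. A \<subseteq> Ys x \<and> card A = m" if "x \<in> X" for x
    proof -
      have "m \<le> card (Ys x)" using m_le sparse that by blast
      then show ?thesis by (meson obtain_subset_with_card_n)
    qed
    then obtain Y1 where Y1: "\<And>x. x \<in> X \<Longrightarrow> Y1 x \<subseteq> Ys x" "\<And>x. x \<in> X \<Longrightarrow> card (Y1 x) = m" by metis
    have Y1Y: "Y1 x \<subseteq> Y" "finite (Y1 x)" if "x \<in> X" for x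
      using Y1 sparse that fin by (blast, meson finite_subset order_trans)
    \<comment> \<open>Markov's inequality: on average a \<open>z\<close> in \<open>Zs x\<close> is
      joined to at most \<open>m / (4 * q)\<close> elements of \<open>Y1 x\<close>, so for at most
      half of the \<open>z\<close> the number exceeds \<open>m / (2 * q)\<close>.\<close>
    have good: "\<eta>1 * card Z \<le> card {z\<in>Z. 2 * q * card {y\<in>Y1 x. w x y z} \<le> m}" if x: "x \<in> X" for x
    proof -
      have finZ: "finite (Zs x)" using sparse x fin finite_subset by blast
      define bad where "bad = {z\<in>Zs x. real m < 2 * q * card {y\<in>Y1 x. w x y z}}"
      have "m * card bad \<le> (\<Sum>z\<in>Zs x. real (2 * q * card {y\<in>Y1 x. w x y z}))"
        unfolding bad_def using markov_card[OF finZ, of "\<lambda>z. real (2 * q * card {y\<in>Y1 x. w x y z})" "real m"] by simp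
      also have "\<dots> = 2 * q * (\<Sum>z\<in>Zs x. card {y\<in>Y1 x. w x y z})" by (simp add: sum_distrib_left)
      also have "(\<Sum>z\<in>Zs x. card {y\<in>Y1 x. w x y z}) = (\<Sum>y\<in>Y1 x. card {z\<in>Zs x. w x y z})"
        by (rule sum_card_swap) (use finZ Y1Y x in auto)
      also have "real (2 * q * \<dots>) \<le> real (2 * q) * (\<Sum>y\<in>Y1 x. \<delta>1 * card (Zs x))"
        unfolding of_nat_mult[of "2 * q"] of_nat_sum
        by (intro mult_left_mono sum_mono) (use sparse x Y1 in \<open>auto simp: subset_iff intro!: less_imp_le\<close>)
      also have "\<dots> = m * (card (Zs x) / 2)" using Y1(2)[OF x] q by (simp add: \<delta>1_def)
      finally have "card bad \<le> real (card (Zs x)) / 2" using \<open>0 < m\<close> by simp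
      moreover have "card (Zs x) = card bad + card (Zs x - bad)"
        by (subst card_Diff_subset) (use finZ in \<open>auto simp: bad_def card_mono\<close>)
      moreover have "card (Zs x - bad) \<le> card {z\<in>Z. 2 * q * card {y\<in>Y1 x. w x y z} \<le> m}"
      proof (rule card_mono)
        have "2 * q * n \<le> m" if "\<not> real m < 2 * q * n" for n
          using that by (simp only: not_less of_nat_le_iff)
        then show "Zs x - bad \<subseteq> {z\<in>Z. 2 * q * card {y\<in>Y1 x. w x y z} \<le> m}"
          using sparse x by (auto simp: bad_def subset_iff)
      qed (use fin in auto)
      moreover have "\<delta>1 ^ a * card Z \<le> card (Zs x)" using sparse x by blast
      ultimately show ?thesis by (simp add: \<eta>1_def)
    qed
    have "\<eta>1 * card X * card Z = (\<Sum>x\<in>X. \<eta>1 * card Z)" by simp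
    also have "\<dots> \<le> (\<Sum>x\<in>X. real (card {z\<in>Z. 2 * q * card {y\<in>Y1 x. w x y z} \<le> m}))"
      by (rule sum_mono) (rule good)
    finally have many: "\<eta>1 * card X * card Z \<le> (\<Sum>x\<in>X. card {z\<in>Z. 2 * q * card {y\<in>Y1 x. w x y z} \<le> m})"
      by simp
    have "real (card Y) \<le> real (2 * a * m)" using m_ge by (simp only: of_nat_le_iff)
    then have sm: "\<sigma>1 * card Y \<le> m" using a by (simp add: \<sigma>1_def field_simps)
    have few1: "\<forall>y\<in>Y. card (half_graph_tuples k h1 (\<lambda>x z. w x y z) X Z) < \<tau>1 * card X ^ h1 * card Z ^ h1"
    proof
      fix y assume "y \<in> Y"
      then have "card (half_graph_tuples k h1 (\<lambda>x z. w x y z) X Z) < \<tau> * card X ^ h1 * card Z ^ h1"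
        using fewY by blast
      also have "\<dots> \<le> \<tau>1 * card X ^ h1 * card Z ^ h1" using \<tau> by (intro mult_right_mono) auto
      finally show "card (half_graph_tuples k h1 (\<lambda>x z. w x y z) X Z) < \<tau>1 * card X ^ h1 * card Z ^ h1" .
    qed
    have S1: "\<forall>x\<in>X. Y1 x \<subseteq> Y \<and> card (Y1 x) = m" using Y1 Y1Y by blast
    from box1[rule_format, OF fin ne \<open>0 < m\<close> sm S1[rule_format] few1[rule_format] many]
    obtain X2 Z2 where X2: "X2 \<subseteq> X" "X2 \<noteq> {}" "\<rho>1 * card X \<le> card X2"
      and Z2: "Z2 \<subseteq> Z" "Z2 \<noteq> {}" "\<rho>1 * card Z \<le> card Z2"
      and sum2: "(\<Sum>x\<in>X2. \<Sum>z\<in>Z2. card {y\<in>Y1 x. w x y z}) \<le> (\<beta>1 + 2 / lam1) * m * card X2 * card Z2"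
      by blast
    have fin2: "finite X2" "finite Z2" using X2 Z2 fin by (auto intro: finite_subset)
    have posZ2: "0 < card Z2" using fin2 Z2 by (auto simp: card_gt_0_iff)
    \<comment> \<open>Markov's inequality again, now summed over \<open>X2\<close>: the first round
      left mean density at most \<open>1 / (4 * r)\<close>, so on average over \<open>x\<close> at
      most half of \<open>Y1 x\<close> is joined to more than a share \<open>1 / (2 * r)\<close> of
      \<open>Z2\<close>.\<close>
    define bad where "bad x = {y\<in>Y1 x. real (card Z2) < 2 * r * card {z\<in>Z2. w x y z}}" for x
    have "card Z2 * (\<Sum>x\<in>X2. real (card (bad x))) = (\<Sum>x\<in>X2. card Z2 * real (card (bad x)))"
      by (simp add: sum_distrib_left)
    also have "\<dots> \<le> (\<Sum>x\<in>X2. \<Sum>y\<in>Y1 x. real (2 * r * card {z\<in>Z2. w x y z}))"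
    proof (rule sum_mono)
      fix x assume "x \<in> X2"
      then have "finite (Y1 x)" using Y1Y X2 by blast
      from markov_card[OF this, of "\<lambda>y. real (2 * r * card {z\<in>Z2. w x y z})" "real (card Z2)"]
      show "card Z2 * real (card (bad x)) \<le> (\<Sum>y\<in>Y1 x. real (2 * r * card {z\<in>Z2. w x y z}))"
        by (simp add: bad_def)
    qed
    also have "\<dots> = 2 * r * real (\<Sum>x\<in>X2. \<Sum>y\<in>Y1 x. card {z\<in>Z2. w x y z})"
      by (simp add: sum_distrib_left)
    also have "(\<Sum>x\<in>X2. \<Sum>y\<in>Y1 x. card {z\<in>Z2. w x y z}) = (\<Sum>x\<in>X2. \<Sum>z\<in>Z2. card {y\<in>Y1 x. w x y z})"
      by (rule sum.cong[OF refl], rule sum_card_swap) (use Y1Y X2 fin2 in auto)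
    also have "2 * r * real \<dots> \<le> 2 * r * ((\<beta>1 + 2 / lam1) * m * card X2 * card Z2)"
      using sum2 by (intro mult_left_mono) auto
    also have "\<dots> = card Z2 * (real m * card X2 / 2)"
      using r by (simp add: \<beta>1_def lam1_def field_simps)
    finally have bad: "(\<Sum>x\<in>X2. real (card (bad x))) \<le> real m * card X2 / 2" using posZ2 by simp
    have good2: "real m - card (bad x) \<le> card {y\<in>Y. 2 * r * card {z\<in>Z2. w x y z} \<le> card Z2}" if "x \<in> X2" for x
    proof -
      have x: "x \<in> X" using that X2 by blast
      have "card (Y1 x - bad x) = card (Y1 x) - card (bad x)"
        by (rule card_Diff_subset) (use Y1Y[OF x] in \<open>auto simp: bad_def\<close>)
      moreover have "card (Y1 x - bad x) \<le> card {y\<in>Y. 2 * r * card {z\<in>Z2. w x y z} \<le> card Z2}"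
      proof (rule card_mono)
        have "2 * r * n \<le> card Z2" if "\<not> real (card Z2) < 2 * r * n" for n
          using that by (simp only: not_less of_nat_le_iff)
        then show "Y1 x - bad x \<subseteq> {y\<in>Y. 2 * r * card {z\<in>Z2. w x y z} \<le> card Z2}"
          using Y1Y[OF x] by (auto simp: bad_def subset_iff)
      qed (use fin in auto)
      ultimately show ?thesis using Y1(2)[OF x] by linarith
    qed
    have "\<eta>2 * card X2 * card Y \<le> real m * card X2 / 2"
    proof -
      have "\<eta>2 * card Y \<le> m / 2" using sm by (simp add: \<eta>2_def \<sigma>1_def)
      then have "\<eta>2 * card Y * card X2 \<le> m / 2 * card X2" by (rule mult_right_mono) simp
      then show ?thesis by (simp add: mult_ac)
    qed
    also have "\<dots> \<le> (\<Sum>x\<in>X2. real m - card (bad x))" using bad by (simp add: sum_subtractf mult.commute)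
    also have "\<dots> \<le> (\<Sum>x\<in>X2. real (card {y\<in>Y. 2 * r * card {z\<in>Z2. w x y z} \<le> card Z2}))"
      by (rule sum_mono) (rule good2)
    finally have many2: "\<eta>2 * card X2 * card Y \<le> (\<Sum>x\<in>X2. card {y\<in>Y. 2 * r * card {z\<in>Z2. w x y z} \<le> card Z2})"
      by simp
    have few2: "card (half_graph_tuples k h2 (\<lambda>x y. w x y z) X2 Y) < \<tau>2 * card X2 ^ h2 * card Y ^ h2"
      if "z \<in> Z2" for z
    proof -
      have "card (half_graph_tuples k h2 (\<lambda>x y. w x y z) X2 Y) \<le> card (half_graph_tuples k h2 (\<lambda>x y. w x y z) X Y)"
        by (intro card_mono finite_half_graph_tuples half_graph_tuples_mono fin X2) auto
      moreover have "card (half_graph_tuples k h2 (\<lambda>x y. w x y z) X Y) < \<tau> * card X ^ h2 * card Y ^ h2"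
        using fewZ Z2 that by blast
      moreover have "\<tau> * card X ^ h2 * card Y ^ h2 \<le> \<tau>2 * card X2 ^ h2 * card Y ^ h2"
      proof -
        have "\<tau> * card X ^ h2 \<le> \<tau>2 * \<rho>1 ^ h2 * card X ^ h2" using \<tau> by (intro mult_right_mono) auto
        also have "\<dots> = \<tau>2 * (\<rho>1 * card X) ^ h2" by (simp add: power_mult_distrib)
        also have "\<dots> \<le> \<tau>2 * real (card X2) ^ h2"
          using pos1 pos2 X2 by (intro mult_left_mono power_mono) auto
        finally show ?thesis by (simp add: mult_right_mono)
      qed
      ultimately show ?thesis by linarith
    qed
    have "1 * real (card Z2) \<le> real (card Z2)" by simp
    \<comment> \<open>All fibres are now the same set \<open>Z2\<close>, so the outcome is a genuine
      box.\<close>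
    from box2[rule_format, of X2 Z2 Y "card Z2" "\<lambda>_. Z2" "\<lambda>x z y. w x y z",
        OF fin2 fin(2) X2(2) Z2(2) ne(2) posZ2 this _ few2 many2]
    obtain X3 Y3 where X3: "X3 \<subseteq> X2" "X3 \<noteq> {}" "\<rho>2 * card X2 \<le> card X3"
      and Y3: "Y3 \<subseteq> Y" "Y3 \<noteq> {}" "\<rho>2 * card Y \<le> card Y3"
      and sum3: "(\<Sum>x\<in>X3. \<Sum>y\<in>Y3. card {z\<in>Z2. w x y z}) \<le> (\<delta> / 2 + 2 / (4 / \<delta>)) * card Z2 * card X3 * card Y3"
      by blast
    have "\<rho>2 * (\<rho>1 * card X) \<le> \<rho>2 * card X2" using X2 pos2 by simp
    moreover have "\<rho> * card X \<le> \<rho>2 * \<rho>1 * card X" "\<rho> * card Y \<le> \<rho>2 * card Y" "\<rho> * card Z \<le> \<rho>1 * card Z"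
      using \<rho> by (auto intro!: mult_right_mono)
    ultimately have size: "\<rho> * card X \<le> card X3" "\<rho> * card Y \<le> card Y3" "\<rho> * card Z \<le> card Z2"
      using X3 Y3 Z2 by (auto simp: mult.assoc)
    have "(\<Sum>x\<in>X3. \<Sum>y\<in>Y3. card {z\<in>Z2. w x y z}) \<le> \<delta> * card X3 * card Y3 * card Z2"
      using sum3 by (simp add: mult_ac)
    then show ?thesis using X3 Y3 X2 Z2 size by (intro exI[of _ X3] exI[of _ Y3] exI[of _ Z2]) auto
  qed
  show ?thesis
    by (rule exI[of _ \<delta>1], intro conjI, rule \<delta>1, rule \<delta>1, rule exI[of _ h1], rule exI[of _ h2],
        rule exI[of _ \<tau>], rule conjI[OF \<tau>(1)], rule exI[of _ \<rho>], rule conjI[OF \<rho>(1)],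
        intro allI impI, rule main; assumption)
qed

text \<open>After boundedly many vertices are discarded from each side, the link of every remaining
  \<open>x\<close> has few half-graphs, so the link or its complement is sparse on some box, and one
  of the two cases occurs for half of these \<open>x\<close>. For that case,
  \<open>sparse_box_of_sparse_links\<close> is applied to \<open>v\<close> or to its negation; the
  length \<open>Suc k\<close> there pays for a negation.\<close>

lemma homogeneous_box:
  fixes \<delta> :: real
  assumes \<delta>: "0 < \<delta>" "\<delta> < 1" and k: "0 < k"
  shows "\<exists>\<rho>::real>0. \<exists>n0>0. \<forall>(X::'b set) (Y::'c set) (Z::'d set) v.
    finite X \<longrightarrow> finite Y \<longrightarrow> finite Z \<longrightarrow> n0 \<le> card X \<longrightarrow> n0 \<le> card Y \<longrightarrow> n0 \<le> card Z \<longrightarrow>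
    (\<forall>f\<in>tuples k Y. \<forall>g\<in>tuples k Z. card {x\<in>X. half_graph k (\<lambda>y z. v x y z) f g} \<le> k) \<longrightarrow>
    (\<forall>f\<in>tuples k X. \<forall>g\<in>tuples k Z. card {y\<in>Y. half_graph k (\<lambda>x z. v x y z) f g} \<le> k) \<longrightarrow>
    (\<forall>f\<in>tuples k X. \<forall>g\<in>tuples k Y. card {z\<in>Z. half_graph k (\<lambda>x y. v x y z) f g} \<le> k) \<longrightarrow>
    (\<exists>X' Y' Z'. X' \<subseteq> X \<and> Y' \<subseteq> Y \<and> Z' \<subseteq> Z \<and> X' \<noteq> {} \<and> Y' \<noteq> {} \<and> Z' \<noteq> {} \<and>
       \<rho> * card X \<le> card X' \<and> \<rho> * card Y \<le> card Y' \<and> \<rho> * card Z \<le> card Z' \<and>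
       ((\<Sum>x\<in>X'. \<Sum>y\<in>Y'. card {z\<in>Z'. v x y z}) \<le> \<delta> * card X' * card Y' * card Z' \<or>
        (\<Sum>x\<in>X'. \<Sum>y\<in>Y'. card {z\<in>Z'. \<not> v x y z}) \<le> \<delta> * card X' * card Y' * card Z'))"
proof -
  from sparse_box_of_sparse_links[OF \<delta> k, where ?'b = 'b and ?'c = 'c and ?'d = 'd and k = "Suc k"]
  obtain \<delta>1 :: real and h1 h2 and \<tau> \<rho> :: real where \<delta>1: "0 < \<delta>1" "\<delta>1 \<le> 1" and \<tau>: "0 < \<tau>" and \<rho>: "0 < \<rho>" and box:
   "\<forall>(X::'b set) (Y::'c set) (Z::'d set) w Ys Zs.
    finite X \<longrightarrow> finite Y \<longrightarrow> finite Z \<longrightarrow> X \<noteq> {} \<longrightarrow> Y \<noteq> {} \<longrightarrow> Z \<noteq> {} \<longrightarrow>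
    (\<forall>y\<in>Y. card (half_graph_tuples (Suc k) h1 (\<lambda>x z. w x y z) X Z) < \<tau> * card X ^ h1 * card Z ^ h1) \<longrightarrow>
    (\<forall>z\<in>Z. card (half_graph_tuples (Suc k) h2 (\<lambda>x y. w x y z) X Y) < \<tau> * card X ^ h2 * card Y ^ h2) \<longrightarrow>
    (\<forall>x\<in>X. Ys x \<subseteq> Y \<and> Zs x \<subseteq> Z \<and> card Y \<le> 2 * k * card (Ys x) \<and> \<delta>1 ^ k * card Z \<le> card (Zs x) \<and>
       (\<forall>y\<in>Ys x. card {z\<in>Zs x. w x y z} < \<delta>1 * card (Zs x))) \<longrightarrow>
    (\<exists>X' Y' Z'. X' \<subseteq> X \<and> Y' \<subseteq> Y \<and> Z' \<subseteq> Z \<and> X' \<noteq> {} \<and> Y' \<noteq> {} \<and> Z' \<noteq> {} \<and>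
       \<rho> * card X \<le> card X' \<and> \<rho> * card Y \<le> card Y' \<and> \<rho> * card Z \<le> card Z' \<and>
       (\<Sum>x\<in>X'. \<Sum>y\<in>Y'. card {z\<in>Z'. w x y z}) \<le> \<delta> * card X' * card Y' * card Z')"
    by (elim exE conjE) rule
  define \<tau>0 where "\<tau>0 = (1 / 2) ^ k * (\<delta>1 ^ k) ^ k"
  \<comment> \<open>The factors cover the loss in passing from \<open>X\<close> to
    \<open>X1 w\<close>, which has at least a quarter of it, and from \<open>Z\<close> to
    \<open>Z0\<close>, which has at least half; likewise for \<open>\<tau>2\<close>, with
    \<open>Y\<close> and \<open>Y0\<close>.\<close>
  define \<tau>1 where "\<tau>1 = \<tau> * (1 / 4) ^ h1 * (1 / 2) ^ h1"
  define \<tau>2 where "\<tau>2 = \<tau> * (1 / 4) ^ h2 * (1 / 2) ^ h2"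
  have \<tau>s: "0 < \<tau>0" "0 < \<tau>1" "0 < \<tau>2" using \<delta>1 \<tau> by (auto simp: \<tau>0_def \<tau>1_def \<tau>2_def)
  define K where "K h = k * h ^ k * h ^ k" for h :: nat
  \<comment> \<open>At least twice the number of exceptional vertices on each side, so that half of
    every side remains.\<close>
  obtain n0 :: nat where n0: "2 * K k / \<tau>0 + 2 * K h1 / \<tau>1 + 2 * K h2 / \<tau>2 + 1 \<le> n0"
    using real_arch_simple by blast
  have nn: "0 \<le> 2 * K k / \<tau>0" "0 \<le> 2 * K h1 / \<tau>1" "0 \<le> 2 * K h2 / \<tau>2"
    using \<tau>s by auto
  have n0_ge: "2 * K k / \<tau>0 \<le> n0" "2 * K h1 / \<tau>1 \<le> n0" "2 * K h2 / \<tau>2 \<le> n0" "0 < n0"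
  proof -
    show "2 * K k / \<tau>0 \<le> n0" "2 * K h1 / \<tau>1 \<le> n0" "2 * K h2 / \<tau>2 \<le> n0"
      using n0 nn by linarith+
    have "0 < real n0" using n0 nn by linarith
    then show "0 < n0" by simp
  qed
  have half: "real (card S) / 2 \<le> card {s\<in>S. real (c s) < t}"
    if "finite S" "n0 \<le> card S" "2 * K h / \<tau>' \<le> n0" "0 < \<tau>'" "\<tau>' * card {s\<in>S. t \<le> c s} \<le> K h"
    for S :: "'s set" and c :: "'s \<Rightarrow> nat" and t \<tau>' :: real and h
  proof -
    have "{s\<in>S. real (c s) < t} = S - {s\<in>S. t \<le> c s}" by auto
    then have "card {s\<in>S. real (c s) < t} = card S - card {s\<in>S. t \<le> c s}"
      using that(1) by (simp add: card_Diff_subset)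
    moreover have "real (card {s\<in>S. t \<le> c s}) \<le> K h / \<tau>'" using that(4,5) by (simp add: field_simps)
    moreover have "real n0 \<le> card S" using that(2) by simp
    ultimately show ?thesis using that(3) by linarith
  qed
  have main: "\<exists>X' Y' Z'. X' \<subseteq> X \<and> Y' \<subseteq> Y \<and> Z' \<subseteq> Z \<and> X' \<noteq> {} \<and> Y' \<noteq> {} \<and> Z' \<noteq> {} \<and>
       \<rho> / 4 * card X \<le> card X' \<and> \<rho> / 4 * card Y \<le> card Y' \<and> \<rho> / 4 * card Z \<le> card Z' \<and>
       ((\<Sum>x\<in>X'. \<Sum>y\<in>Y'. card {z\<in>Z'. v x y z}) \<le> \<delta> * card X' * card Y' * card Z' \<or>
        (\<Sum>x\<in>X'. \<Sum>y\<in>Y'. card {z\<in>Z'. \<not> v x y z}) \<le> \<delta> * card X' * card Y' * card Z')"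
    if fin: "finite X" "finite Y" "finite Z" and large: "n0 \<le> card X" "n0 \<le> card Y" "n0 \<le> card Z"
      and linkX: "\<forall>f\<in>tuples k Y. \<forall>g\<in>tuples k Z. card {x\<in>X. half_graph k (\<lambda>y z. v x y z) f g} \<le> k"
      and linkY: "\<forall>f\<in>tuples k X. \<forall>g\<in>tuples k Z. card {y\<in>Y. half_graph k (\<lambda>x z. v x y z) f g} \<le> k"
      and linkZ: "\<forall>f\<in>tuples k X. \<forall>g\<in>tuples k Y. card {z\<in>Z. half_graph k (\<lambda>x y. v x y z) f g} \<le> k"
    for X :: "'b set" and Y :: "'c set" and Z :: "'d set" and v
  proof -
    have pos: "0 < card X" "0 < card Y" "0 < card Z" using large n0_ge by linarith+
    then have ne: "X \<noteq> {}" "Y \<noteq> {}" "Z \<noteq> {}" by auto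
    define Y0 where "Y0 = {y\<in>Y. real (card (half_graph_tuples k h1 (\<lambda>x z. v x y z) X Z)) < \<tau>1 * card X ^ h1 * card Z ^ h1}"
    define Z0 where "Z0 = {z\<in>Z. real (card (half_graph_tuples k h2 (\<lambda>x y. v x y z) X Y)) < \<tau>2 * card X ^ h2 * card Y ^ h2}"
    have "\<tau>1 * card {y\<in>Y. \<tau>1 * card X ^ h1 * card Z ^ h1 \<le> card (half_graph_tuples k h1 (\<lambda>x z. v x y z) X Z)} \<le> K h1"
      unfolding K_def by (rule card_many_half_graph_tuples) (use fin ne linkY in auto)
    from half[OF fin(2) large(2) n0_ge(2) \<tau>s(2) this]
    have Y0: "card Y / 2 \<le> card Y0" "Y0 \<subseteq> Y" by (auto simp: Y0_def)
    have "\<tau>2 * card {z\<in>Z. \<tau>2 * card X ^ h2 * card Y ^ h2 \<le> card (half_graph_tuples k h2 (\<lambda>x y. v x y z) X Y)} \<le> K h2"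
      unfolding K_def by (rule card_many_half_graph_tuples) (use fin ne linkZ in auto)
    from half[OF fin(3) large(3) n0_ge(3) \<tau>s(3) this]
    have Z0: "card Z / 2 \<le> card Z0" "Z0 \<subseteq> Z" by (auto simp: Z0_def)
    have finYZ: "finite Y0" "finite Z0" using Y0 Z0 fin by (auto intro: finite_subset)
    have neYZ: "Y0 \<noteq> {}" "Z0 \<noteq> {}" using Y0 Z0 pos by auto
    \<comment> \<open>The links are tested on \<open>Y0\<close> and \<open>Z0\<close>, so that the
      boxes found for the individual \<open>x\<close> avoid the discarded vertices.\<close>
    define X0 where "X0 = {x\<in>X. real (card (half_graph_tuples k k (\<lambda>y z. v x y z) Y0 Z0)) < \<tau>0 * card Y0 ^ k * card Z0 ^ k}"
    have linkX0: "card {x\<in>X. half_graph k (\<lambda>y z. v x y z) f g} \<le> k" if "f \<in> tuples k Y0" "g \<in> tuples k Z0" for f g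
    proof -
      have "f \<in> tuples k Y" "g \<in> tuples k Z" using that Y0 Z0 by (auto simp: PiE_def Pi_def)
      then show ?thesis using linkX by blast
    qed
    have "\<tau>0 * card {x\<in>X. \<tau>0 * card Y0 ^ k * card Z0 ^ k \<le> card (half_graph_tuples k k (\<lambda>y z. v x y z) Y0 Z0)} \<le> K k"
      unfolding K_def by (rule card_many_half_graph_tuples) (use fin finYZ neYZ linkX0 in auto)
    from half[OF fin(1) large(1) n0_ge(1) \<tau>s(1) this]
    have X0: "card X / 2 \<le> card X0" "X0 \<subseteq> X" by (auto simp: X0_def)
    define colour where "colour x w A B \<longleftrightarrow> A \<subseteq> Y0 \<and> B \<subseteq> Z0 \<and> \<delta>1 ^ k * card Z0 \<le> card B \<and>
        card Y0 \<le> 2 * k * card A \<and> (\<forall>y\<in>A. card {z\<in>B. w x y z} < \<delta>1 * card B)"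
      for x :: 'b and w :: "'b \<Rightarrow> 'c \<Rightarrow> 'd \<Rightarrow> bool" and A B
    have "\<exists>A B. colour x v A B \<or> colour x (\<lambda>x y z. \<not> v x y z) A B" if "x \<in> X0" for x
    proof -
      have "\<tau>0 * card Y0 ^ k * card Z0 ^ k = (card Y0 / 2) ^ k * (\<delta>1 ^ k * card Z0) ^ k"
        by (simp add: \<tau>0_def power_mult_distrib power_divide)
      then have "card (half_graph_tuples k k (\<lambda>y z. v x y z) Y0 Z0) < (card Y0 / 2) ^ k * (\<delta>1 ^ k * card Z0) ^ k"
        using that by (simp add: X0_def)
      from homogeneous_box_of_few_half_graphs[OF finYZ k \<delta>1 this]
      obtain A B where "A \<subseteq> Y0" "B \<subseteq> Z0" "\<delta>1 ^ k * card Z0 \<le> card B" "card Y0 \<le> 2 * k * card A"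
        "(\<forall>y\<in>A. card {z\<in>B. v x y z} < \<delta>1 * card B) \<or> (\<forall>y\<in>A. card {z\<in>B. \<not> v x y z} < \<delta>1 * card B)"
        by blast
      then show ?thesis unfolding colour_def by blast
    qed
    then obtain A B where AB: "\<And>x. x \<in> X0 \<Longrightarrow> colour x v (A x) (B x) \<or> colour x (\<lambda>x y z. \<not> v x y z) (A x) (B x)"
      by (metis (mono_tags))
    have finX0: "finite X0" using X0 fin by (auto intro: finite_subset)
    define X1 where "X1 w = {x\<in>X0. colour x w (A x) (B x)}" for w
    have finX1: "finite (X1 w)" for w using finX0 by (simp add: X1_def)
    have "X0 = X1 v \<union> X1 (\<lambda>x y z. \<not> v x y z)" using AB by (auto simp: X1_def)
    then have "card X0 \<le> card (X1 v) + card (X1 (\<lambda>x y z. \<not> v x y z))" by (metis card_Un_le)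
    then have "real (card X) / 4 \<le> card (X1 v) \<or> real (card X) / 4 \<le> card (X1 (\<lambda>x y z. \<not> v x y z))"
      using X0 by linarith
    then obtain w where w: "w = v \<or> w = (\<lambda>x y z. \<not> v x y z)" and X1: "real (card X) / 4 \<le> card (X1 w)"
      by blast
    have X1X: "X1 w \<subseteq> X" using X0 by (auto simp: X1_def)
    have "X1 w \<noteq> {}" using X1 pos by auto
    have few: "half_graph_tuples (Suc k) h (\<lambda>x z. w x y z) X Z \<subseteq> half_graph_tuples k h (\<lambda>x z. v x y z) X Z" for y h
      using w half_graph_tuples_Suc[of k h "\<lambda>x z. v x y z" X Z] by auto
    have few': "half_graph_tuples (Suc k) h (\<lambda>x y. w x y z) X Y \<subseteq> half_graph_tuples k h (\<lambda>x y. v x y z) X Y" for z h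
      using w half_graph_tuples_Suc[of k h "\<lambda>x y. v x y z" X Y] by auto
    have scale: "\<tau> * (1 / 4) ^ h * (1 / 2) ^ h * card X ^ h * n ^ h \<le> \<tau> * card (X1 w) ^ h * n' ^ h"
      if "real n / 2 \<le> n'" for h n n' :: nat
    proof -
      have "\<tau> * (1 / 4) ^ h * (1 / 2) ^ h * card X ^ h * n ^ h = \<tau> * (card X / 4) ^ h * (n / 2) ^ h"
        by (simp add: power_divide)
      also have "\<dots> \<le> \<tau> * real (card (X1 w)) ^ h * real n' ^ h"
        using \<tau> X1 that by (intro mult_mono power_mono) auto
      finally show ?thesis by simp
    qed
    have fewY: "card (half_graph_tuples (Suc k) h1 (\<lambda>x z. w x y z) (X1 w) Z0) < \<tau> * card (X1 w) ^ h1 * card Z0 ^ h1"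
      if "y \<in> Y0" for y
    proof -
      have "half_graph_tuples (Suc k) h1 (\<lambda>x z. w x y z) (X1 w) Z0 \<subseteq> half_graph_tuples k h1 (\<lambda>x z. v x y z) X Z"
        using few half_graph_tuples_mono[OF X1X Z0(2)] by blast
      then have "card (half_graph_tuples (Suc k) h1 (\<lambda>x z. w x y z) (X1 w) Z0) \<le> card (half_graph_tuples k h1 (\<lambda>x z. v x y z) X Z)"
        by (intro card_mono finite_half_graph_tuples fin)
      moreover have "card (half_graph_tuples k h1 (\<lambda>x z. v x y z) X Z) < \<tau>1 * card X ^ h1 * card Z ^ h1"
        using that by (simp add: Y0_def)
      ultimately show ?thesis using scale[OF Z0(1), of h1] unfolding \<tau>1_def by linarith
    qed
    have fewZ: "card (half_graph_tuples (Suc k) h2 (\<lambda>x y. w x y z) (X1 w) Y0) < \<tau> * card (X1 w) ^ h2 * card Y0 ^ h2"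
      if "z \<in> Z0" for z
    proof -
      have "half_graph_tuples (Suc k) h2 (\<lambda>x y. w x y z) (X1 w) Y0 \<subseteq> half_graph_tuples k h2 (\<lambda>x y. v x y z) X Y"
        using few' half_graph_tuples_mono[OF X1X Y0(2)] by blast
      then have "card (half_graph_tuples (Suc k) h2 (\<lambda>x y. w x y z) (X1 w) Y0) \<le> card (half_graph_tuples k h2 (\<lambda>x y. v x y z) X Y)"
        by (intro card_mono finite_half_graph_tuples fin)
      moreover have "card (half_graph_tuples k h2 (\<lambda>x y. v x y z) X Y) < \<tau>2 * card X ^ h2 * card Y ^ h2"
        using that by (simp add: Z0_def)
      ultimately show ?thesis using scale[OF Y0(1), of h2] unfolding \<tau>2_def by linarith
    qed
    have "\<forall>x\<in>X1 w. A x \<subseteq> Y0 \<and> B x \<subseteq> Z0 \<and> card Y0 \<le> 2 * k * card (A x) \<and> \<delta>1 ^ k * card Z0 \<le> card (B x) \<and>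
       (\<forall>y\<in>A x. card {z\<in>B x. w x y z} < \<delta>1 * card (B x))"
      by (auto simp: X1_def colour_def)
    with fewY fewZ have "\<exists>X' Y' Z'. X' \<subseteq> X1 w \<and> Y' \<subseteq> Y0 \<and> Z' \<subseteq> Z0 \<and> X' \<noteq> {} \<and> Y' \<noteq> {} \<and> Z' \<noteq> {} \<and>
       \<rho> * card (X1 w) \<le> card X' \<and> \<rho> * card Y0 \<le> card Y' \<and> \<rho> * card Z0 \<le> card Z' \<and>
       (\<Sum>x\<in>X'. \<Sum>y\<in>Y'. card {z\<in>Z'. w x y z}) \<le> \<delta> * card X' * card Y' * card Z'"
      by (intro box[THEN spec, THEN spec, THEN spec, THEN spec, THEN spec, THEN spec, of "X1 w" Y0 Z0 w A B,
            THEN mp, THEN mp, THEN mp, THEN mp, THEN mp, THEN mp, THEN mp, THEN mp, THEN mp]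
          finX1 finYZ neYZ \<open>X1 w \<noteq> {}\<close> ballI) auto
    then obtain X' Y' Z' where sub: "X' \<subseteq> X1 w" "Y' \<subseteq> Y0" "Z' \<subseteq> Z0" "X' \<noteq> {}" "Y' \<noteq> {}" "Z' \<noteq> {}"
      and size: "\<rho> * card (X1 w) \<le> card X'" "\<rho> * card Y0 \<le> card Y'" "\<rho> * card Z0 \<le> card Z'"
      and sum: "(\<Sum>x\<in>X'. \<Sum>y\<in>Y'. card {z\<in>Z'. w x y z}) \<le> \<delta> * card X' * card Y' * card Z'"
      by blast
    have "\<rho> * (card X / 4) \<le> \<rho> * card (X1 w)" "\<rho> * (card Y / 4) \<le> \<rho> * card Y0" "\<rho> * (card Z / 4) \<le> \<rho> * card Z0"
      using X1 Y0 Z0 \<rho> by (auto intro!: mult_left_mono)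
    then have size': "\<rho> / 4 * card X \<le> card X'" "\<rho> / 4 * card Y \<le> card Y'" "\<rho> / 4 * card Z \<le> card Z'"
      using size by auto
    have "(\<Sum>x\<in>X'. \<Sum>y\<in>Y'. card {z\<in>Z'. v x y z}) \<le> \<delta> * card X' * card Y' * card Z' \<or>
        (\<Sum>x\<in>X'. \<Sum>y\<in>Y'. card {z\<in>Z'. \<not> v x y z}) \<le> \<delta> * card X' * card Y' * card Z'"
      using w sum by auto
    then show ?thesis
      using sub X1X Y0 Z0 size' by (intro exI[of _ X'] exI[of _ Y'] exI[of _ Z'] conjI) auto
  qed
  have \<rho>4: "0 < \<rho> / 4" using \<rho> by simp
  show ?thesis
    by (rule exI[of _ "\<rho> / 4"], rule conjI[OF \<rho>4], rule exI[of _ n0], rule conjI[OF n0_ge(4)],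
        intro allI impI, rule main; assumption)
qed

section \<open>Tripartite 3-graphs\<close>

lemma triple_eq_iff:
  assumes "U \<inter> V = {}" "U \<inter> W = {}" "V \<inter> W = {}" "x \<in> U" "y \<in> V" "z \<in> W" "x' \<in> U" "y' \<in> V" "z' \<in> W"
  shows "{x, y, z} = {x', y', z'} \<longleftrightarrow> x = x' \<and> y = y' \<and> z = z'"
proof
  assume eq: "{x, y, z} = {x', y', z'}"
  then have "x \<in> {x', y', z'}" "y \<in> {x', y', z'}" "z \<in> {x', y', z'}" by blast+
  then show "x = x' \<and> y = y' \<and> z = z'" using assms by blast
qed simp

lemma K3_disjoint:
  assumes "U \<inter> V = {}" "U \<inter> W = {}" "V \<inter> W = {}"
  shows "K3 U V W = (\<lambda>(x, y, z). {x, y, z}) ` (U \<times> V \<times> W)"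
proof -
  have "x \<noteq> y \<and> x \<noteq> z \<and> y \<noteq> z" if "x \<in> U" "y \<in> V" "z \<in> W" for x y z using that assms by blast
  then have "K3 U V W = {{x, y, z} | x y z. x \<in> U \<and> y \<in> V \<and> z \<in> W}" unfolding K3_def by blast
  also have "\<dots> = (\<lambda>(x, y, z). {x, y, z}) ` (U \<times> V \<times> W)" by (auto simp: image_iff)
  finally show ?thesis .
qed

lemma card_Int_K3:
  assumes disj: "U \<inter> V = {}" "U \<inter> W = {}" "V \<inter> W = {}" and fin: "finite U" "finite V" "finite W"
  shows "card (F \<inter> K3 U V W) = (\<Sum>x\<in>U. \<Sum>y\<in>V. card {z\<in>W. {x, y, z} \<in> F})"
proof -
  define D where "D = (SIGMA x:U. SIGMA y:V. {z\<in>W. {x, y, z} \<in> F})"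
  have "F \<inter> K3 U V W = (\<lambda>(x, y, z). {x, y, z}) ` D"
    unfolding K3_disjoint[OF disj] D_def by (auto simp: image_iff)
  moreover have "inj_on (\<lambda>(x, y, z). {x, y, z}) D"
  proof (rule inj_onI)
    fix p q assume p: "p \<in> D" and q: "q \<in> D" and eq: "(case p of (x, y, z) \<Rightarrow> {x, y, z}) = (case q of (x, y, z) \<Rightarrow> {x, y, z})"
    obtain x y z x' y' z' where "p = (x, y, z)" "q = (x', y', z')" by (metis prod_cases3)
    then show "p = q" using p q eq triple_eq_iff[OF disj, of x y z x' y' z'] by (simp add: D_def)
  qed
  ultimately have "card (F \<inter> K3 U V W) = card D" by (simp add: card_image)
  also have "\<dots> = (\<Sum>x\<in>U. card (SIGMA y:V. {z\<in>W. {x, y, z} \<in> F}))"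
    unfolding D_def by (rule card_SigmaI) (use fin in auto)
  also have "\<dots> = (\<Sum>x\<in>U. \<Sum>y\<in>V. card {z\<in>W. {x, y, z} \<in> F})"
    by (intro sum.cong refl card_SigmaI) (use fin in auto)
  finally show ?thesis .
qed

lemma card_K3:
  assumes "U \<inter> V = {}" "U \<inter> W = {}" "V \<inter> W = {}" "finite U" "finite V" "finite W"
  shows "card (K3 U V W) = card U * card V * card W"
  using card_Int_K3[OF assms, of UNIV] by simp

lemma finite_K3: "finite U \<Longrightarrow> finite V \<Longrightarrow> finite W \<Longrightarrow> finite (K3 U V W)"
  by (rule finite_subset[of _ "Pow (U \<union> V \<union> W)"]) (auto simp: K3_def)

lemma K3_mono: "U' \<subseteq> U \<Longrightarrow> V' \<subseteq> V \<Longrightarrow> W' \<subseteq> W \<Longrightarrow> K3 U' V' W' \<subseteq> K3 U V W"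
  unfolding K3_def by blast

text \<open>If the density of the triple is at most 1/2, the full box deviates from it by at least
  half its volume; otherwise the empty box does. Both have relative volume at least
  \<open>c ^ 3\<close>.\<close>

lemma vdisc3_opposite_boxes:
  fixes \<epsilon> c :: real
  assumes vd: "vdisc3 X Y Z E \<epsilon>" and fin: "finite X" "finite Y" "finite Z"
    and disj: "X \<inter> Y = {}" "X \<inter> Z = {}" "Y \<inter> Z = {}"
    and ne: "X \<noteq> {}" "Y \<noteq> {}" "Z \<noteq> {}"
    and sub: "X1 \<subseteq> X" "X2 \<subseteq> X" "Y1 \<subseteq> Y" "Y2 \<subseteq> Y" "Z1 \<subseteq> Z"
    and size: "c * card X \<le> card X1" "c * card X \<le> card X2" "c * card Y \<le> card Y1" "c * card Y \<le> card Y2"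
      "c * card Z \<le> card Z1"
    and full: "K3 X1 Y1 Z1 \<subseteq> E" and empty: "K3 X2 Y2 Z1 \<inter> E = {}" and c: "0 < c" "2 * \<epsilon> < c ^ 3"
  shows False
proof -
  define d where "d = real (card E) / (real (card X) * real (card Y) * real (card Z))"
  have V: "\<bar>real (card (E \<inter> K3 U' V' W')) - d * real (card U') * real (card V') * real (card W')\<bar>
          \<le> \<epsilon> * real (card X) * real (card Y) * real (card Z)" if "U' \<subseteq> X" "V' \<subseteq> Y" "W' \<subseteq> Z" for U' V' W'
    using vd that unfolding vdisc3_def d_def[symmetric] Let_def by blast
  have fin': "finite X1" "finite Y1" "finite Z1" "finite X2" "finite Y2" using sub fin by (auto intro: finite_subset)
  have "card (E \<inter> K3 X1 Y1 Z1) = card X1 * card Y1 * card Z1"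
  proof -
    have "E \<inter> K3 X1 Y1 Z1 = K3 X1 Y1 Z1" using full by blast
    moreover have "card (K3 X1 Y1 Z1) = card X1 * card Y1 * card Z1"
      by (rule card_K3) (use disj sub fin' in auto)
    ultimately show ?thesis by simp
  qed
  then have 1: "(1 - d) * (real (card X1) * card Y1 * card Z1) \<le> \<epsilon> * (real (card X) * card Y * card Z)"
    using V[of X1 Y1 Z1] sub by (simp add: algebra_simps abs_le_iff)
  have "E \<inter> K3 X2 Y2 Z1 = {}" using empty by blast
  then have 2: "d * (real (card X2) * card Y2 * card Z1) \<le> \<epsilon> * (real (card X) * card Y * card Z)"
    using V[of X2 Y2 Z1] sub by (simp add: algebra_simps abs_le_iff)
  have pos: "0 < real (card X) * card Y * card Z" using fin ne by (simp add: card_gt_0_iff)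
  have "c * card X * (c * card Y) * (c * card Z) \<le> real (card X1) * card Y1 * card Z1"
    using size c by (intro mult_mono) auto
  then have s1: "c ^ 3 * (real (card X) * card Y * card Z) \<le> real (card X1) * card Y1 * card Z1"
    by (simp add: power3_eq_cube mult_ac)
  have "c * card X * (c * card Y) * (c * card Z) \<le> real (card X2) * card Y2 * card Z1"
    using size c by (intro mult_mono) auto
  then have s2: "c ^ 3 * (real (card X) * card Y * card Z) \<le> real (card X2) * card Y2 * card Z1"
    by (simp add: power3_eq_cube mult_ac)
  have strict: "\<epsilon> * (real (card X) * card Y * card Z) < c ^ 3 / 2 * (real (card X) * card Y * card Z)"
    by (rule mult_strict_right_mono[OF _ pos]) (use c in simp)
  show False
  proof (cases "d \<le> 1 / 2")
    case True
    have "1 / 2 * (c ^ 3 * (real (card X) * card Y * card Z)) \<le> (1 - d) * (real (card X1) * card Y1 * card Z1)"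
      by (rule mult_mono) (use True s1 c pos in auto)
    then have "c ^ 3 / 2 * (real (card X) * card Y * card Z) \<le> \<epsilon> * (real (card X) * card Y * card Z)"
      using 1 by simp
    then show False using strict by linarith
  next
    case False
    have "1 / 2 * (c ^ 3 * (real (card X) * card Y * card Z)) \<le> d * (real (card X2) * card Y2 * card Z1)"
      by (rule mult_mono) (use False s2 c pos in auto)
    then have "c ^ 3 / 2 * (real (card X) * card Y * card Z) \<le> \<epsilon> * (real (card X) * card Y * card Z)"
      using 2 by simp
    then show False using strict by linarith
  qed
qed

section \<open>Blown-up half-graphs\<close>

text \<open>Triples that do not meet all three classes are left free: a copy arises from
  \<open>k\<close> vertices whose links share a half-graph, which says nothing about the other
  triples.\<close>

definition blown_up_half_graph :: "nat \<Rightarrow> 'a three_graph \<Rightarrow> bool" where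
  "blown_up_half_graph k H \<longleftrightarrow> (\<exists>f g h.
     inj_on f {..<k} \<and> inj_on g {..<k} \<and> inj_on h {..<k} \<and>
     f ` {..<k} \<subseteq> fst H \<and> g ` {..<k} \<subseteq> fst H \<and> h ` {..<k} \<subseteq> fst H \<and>
     f ` {..<k} \<inter> g ` {..<k} = {} \<and> f ` {..<k} \<inter> h ` {..<k} = {} \<and> g ` {..<k} \<inter> h ` {..<k} = {} \<and>
     (\<forall>i<k. \<forall>j<k. \<forall>l<k. {f i, g j, h l} \<in> snd H \<longleftrightarrow> i < j))"

text \<open>All members of this set except its maximum lie below the maximum, which by membership
  has fewer than \<open>r\<close> elements of \<open>I\<close> below it.\<close>

lemma card_few_below:
  fixes I :: "nat set" and r :: real
  assumes "finite I" "0 \<le> r"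
  shows "card {p\<in>I. card {i\<in>I. i < p} < r} \<le> r + 1"
proof (cases "{p\<in>I. card {i\<in>I. i < p} < r} = {}")
  case True
  then show ?thesis using assms by (simp only: card.empty)
next
  case False
  define J where "J = {p\<in>I. card {i\<in>I. i < p} < r}"
  have finJ: "finite J" and neJ: "J \<noteq> {}" using assms False by (auto simp: J_def)
  have "Max J \<in> J" using finJ neJ by simp
  have "J - {Max J} \<subseteq> {i\<in>I. i < Max J}"
    using Max_ge[OF finJ] by (auto simp: J_def order_less_le)
  then have "card (J - {Max J}) \<le> card {i\<in>I. i < Max J}" using assms by (intro card_mono) auto
  moreover have "card {i\<in>I. i < Max J} < r" using \<open>Max J \<in> J\<close> by (simp add: J_def)
  moreover have "card (J - {Max J}) = card J - 1" using \<open>Max J \<in> J\<close> by simp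
  ultimately show ?thesis unfolding J_def[symmetric] by linarith
qed

lemma card_few_above:
  fixes I :: "nat set" and r :: real
  assumes "finite I" "0 \<le> r"
  shows "card {p\<in>I. card {i\<in>I. p \<le> i} < r} \<le> r + 1"
proof (cases "{p\<in>I. card {i\<in>I. p \<le> i} < r} = {}")
  case True
  then show ?thesis using assms by (simp only: card.empty)
next
  case False
  define J where "J = {p\<in>I. card {i\<in>I. p \<le> i} < r}"
  have finJ: "finite J" and neJ: "J \<noteq> {}" using assms False by (auto simp: J_def)
  have "Min J \<in> J" using finJ neJ by simp
  have "J \<subseteq> {i\<in>I. Min J \<le> i}"
    using Min_le[OF finJ] by (auto simp: J_def)
  then have "card J \<le> card {i\<in>I. Min J \<le> i}" using assms by (intro card_mono) auto
  moreover have "card {i\<in>I. Min J \<le> i} < r" using \<open>Min J \<in> J\<close> by (simp add: J_def)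
  ultimately show ?thesis unfolding J_def[symmetric] by linarith
qed

section \<open>Part sizes in equipartitions\<close>

lemma sum_card_partition_on:
  assumes "partition_on V \<P>" "finite V"
  shows "(\<Sum>Y\<in>\<P>. card Y) = card V"
proof -
  have "card (\<Union>\<P>) = sum card \<P>"
  proof (rule card_Union_disjoint)
    show "pairwise disjnt \<P>" using partition_onD2[OF assms(1)] by (auto simp: disjoint_def pairwise_def disjnt_def)
    show "finite Y" if "Y \<in> \<P>" for Y
      using that partition_onD1[OF assms(1)] assms(2) by (auto intro: finite_subset)
  qed
  then show ?thesis using partition_onD1[OF assms(1)] by simp
qed

lemma equipartition_card_le:
  assumes "equipartition V \<P>" "finite V" "X \<in> \<P>"
  shows "card \<P> * card X \<le> card V + card \<P>"
proof -
  have part: "partition_on V \<P>" using assms by (simp add: equipartition_def)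
  have "card \<P> * card X = (\<Sum>Y\<in>\<P>. card X)" by simp
  also have "\<dots> \<le> (\<Sum>Y\<in>\<P>. card Y + 1)"
    by (rule sum_mono) (use assms in \<open>auto simp: equipartition_def\<close>)
  also have "\<dots> = (\<Sum>Y\<in>\<P>. card Y) + card \<P>" unfolding sum.distrib by simp
  also have "(\<Sum>Y\<in>\<P>. card Y) = card V" by (rule sum_card_partition_on[OF part assms(2)])
  finally show ?thesis .
qed

lemma equipartition_card_ge:
  assumes "equipartition V \<P>" "finite V" "X \<in> \<P>"
  shows "card V \<le> card \<P> * card X + card \<P>"
proof -
  have part: "partition_on V \<P>" using assms by (simp add: equipartition_def)
  have "card V = (\<Sum>Y\<in>\<P>. card Y)"
    by (rule sum_card_partition_on[OF part assms(2), symmetric])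
  also have "\<dots> \<le> (\<Sum>Y\<in>\<P>. card X + 1)"
    by (rule sum_mono) (use assms in \<open>auto simp: equipartition_def\<close>)
  also have "\<dots> = card \<P> * card X + card \<P>" unfolding sum.distrib by simp
  finally show ?thesis .
qed

text \<open>Call an index \<open>p\<close> good if the part containing \<open>f p\<close> contains many \<open>f i\<close> with \<open>i < p\<close> and many
  with \<open>p \<le> i\<close>, and likewise for \<open>g\<close>; most indices are good.  If \<open>f p\<close> and \<open>g p\<close> lie in different parts
  for some good \<open>p\<close>, these two parts see a full and an empty box.  Otherwise there are good \<open>p < q\<close>
  whose parts \<open>X\<close> and \<open>Y\<close> differ, and the boxes are given by the \<open>f i \<in> X\<close> and \<open>g j \<in> Y\<close> with
  \<open>i < p \<le> q \<le> j\<close> and by the \<open>g j \<in> X\<close> and \<open>f i \<in> Y\<close> with \<open>j < p \<le> q \<le> i\<close>.\<close>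

lemma blown_up_half_graph_not_regular:
  fixes f g h :: "nat \<Rightarrow> 'a"
  assumes inj: "inj_on f {..<k}" "inj_on g {..<k}" "inj_on h {..<k}"
    and disj: "f ` {..<k} \<inter> g ` {..<k} = {}" "f ` {..<k} \<inter> h ` {..<k} = {}" "g ` {..<k} \<inter> h ` {..<k} = {}"
    and F: "\<And>i j l. i < k \<Longrightarrow> j < k \<Longrightarrow> l < k \<Longrightarrow> {f i, g j, h l} \<in> F \<longleftrightarrow> i < j"
    and W: "W = f ` {..<k} \<union> g ` {..<k} \<union> h ` {..<k}"
    and P: "equipartition W \<P>" and t: "16 \<le> card \<P>" "16 * card \<P> \<le> k"
    and reg: "\<And>X Y Z. X \<in> \<P> \<Longrightarrow> Y \<in> \<P> \<Longrightarrow> Z \<in> \<P> \<Longrightarrow> X \<noteq> Y \<Longrightarrow> X \<noteq> Z \<Longrightarrow> Y \<noteq> Z \<Longrightarrow>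
       vdisc3 X Y Z (F \<inter> K3 X Y Z) ((1 / 48) ^ 3 / 3)"
  shows False
proof -
  \<comment> \<open>As \<open>W\<close> has \<open>3 * k\<close> vertices, losing
    \<open>c * card X\<close> in every part \<open>X\<close> costs \<open>k / 16\<close> in total.
    One such loss and two parts of size about \<open>3 * k / 16\<close> stay below \<open>k\<close>
    in \<open>heavy\<close>; four such losses occur in the count of good indices.\<close>
  define c :: real where "c = 1 / 48"
  have finW: "finite W" using W by simp
  have cardW: "card W = 3 * k"
    unfolding W using disj inj by (simp add: card_Un_disjoint Int_Un_distrib2 card_image)
  have part: "partition_on W \<P>" using P by (simp add: equipartition_def)
  have finP: "finite \<P>" using finite_elements[OF finW part] .
  have PW: "X \<subseteq> W" if "X \<in> \<P>" for X using partition_onD1[OF part] that by auto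
  have finX: "finite X" if "X \<in> \<P>" for X using PW[OF that] finW by (rule finite_subset)
  have neX: "X \<noteq> {}" if "X \<in> \<P>" for X using partition_onD3[OF part] that by auto
  have PD: "X \<inter> Y = {}" if "X \<in> \<P>" "Y \<in> \<P>" "X \<noteq> Y" for X Y
    using partition_onD2[OF part] that by (auto simp: disjoint_def)
  have cover: "\<exists>X\<in>\<P>. w \<in> X" if "w \<in> W" for w using partition_onD1[OF part] that by auto
  have k: "256 \<le> k" using t by linarith
  have size: "card X \<le> 3 * real k / 16 + 1" if "X \<in> \<P>" for X
  proof -
    have "card \<P> * card X \<le> 3 * k + card \<P>"
      using equipartition_card_le[OF P finW that] by (simp add: cardW)
    then have 1: "real (card \<P>) * card X \<le> 3 * real k + card \<P>"
      by (metis of_nat_add of_nat_le_iff of_nat_mult of_nat_numeral)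
    have "16 * (real (card X) - 1) \<le> card \<P> * (real (card X) - 1)"
      using t neX[OF that] finX[OF that] by (intro mult_right_mono) (auto simp: card_gt_0_iff Suc_le_eq)
    then show ?thesis using 1 by (simp add: algebra_simps)
  qed
  define I where "I u X = {i\<in>{..<k}. u i \<in> X}" for u :: "nat \<Rightarrow> 'a" and X
  have finI: "finite (I u X)" for u X by (simp add: I_def)
  have cardI: "card (I u X) \<le> card X" if "X \<in> \<P>" "inj_on u {..<k}" for u X
    by (rule card_inj_on_le[of u]) (use that finX in \<open>auto simp: I_def intro: inj_on_subset\<close>)
  \<comment> \<open>The parts poor in vertices \<open>h l\<close> contain at most
    \<open>k / 16\<close> of them, and \<open>X\<close> and \<open>Y\<close> together have fewer
    than \<open>k / 2\<close> vertices; so some third part is rich in them and can supply the third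
    side of both boxes.\<close>
  have heavy: "\<exists>Z\<in>\<P>. Z \<noteq> X \<and> Z \<noteq> Y \<and> c * card Z \<le> card (I h Z)" if XY: "X \<in> \<P>" "Y \<in> \<P>" for X Y
  proof (rule ccontr)
    assume no: "\<not> ?thesis"
    have "k = card (\<Union>Z\<in>\<P>. I h Z)"
    proof -
      have "(\<Union>Z\<in>\<P>. I h Z) = {..<k}" using cover W by (fastforce simp: I_def)
      then show ?thesis by simp
    qed
    also have "\<dots> \<le> (\<Sum>Z\<in>\<P>. card (I h Z))" by (rule card_UN_le) (rule finP)
    finally have "real k \<le> (\<Sum>Z\<in>\<P>. real (card (I h Z)))" by (simp only: of_nat_sum[symmetric] of_nat_le_iff)
    also have "\<dots> \<le> (\<Sum>Z\<in>\<P>. c * card Z + (if Z = X then real (card X) else 0) + (if Z = Y then real (card Y) else 0))"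
    proof (rule sum_mono)
      fix Z assume Z: "Z \<in> \<P>"
      have "0 \<le> c * card Z" by (simp add: c_def)
      moreover have "real (card (I h Z)) \<le> card Z" using cardI[OF Z inj(3)] by simp
      moreover have "card (I h Z) < c * card Z" if "Z \<noteq> X" "Z \<noteq> Y" using no Z that not_le by blast
      ultimately show "real (card (I h Z)) \<le> c * card Z + (if Z = X then real (card X) else 0) + (if Z = Y then real (card Y) else 0)"
        by (cases "Z = X"; cases "Z = Y") auto
    qed
    also have "\<dots> = c * real (\<Sum>Z\<in>\<P>. card Z) + card X + card Y"
      using XY finP by (simp add: sum.distrib sum_distrib_left)
    also have "\<dots> = k / 16 + card X + card Y"
      unfolding sum_card_partition_on[OF part finW] by (simp add: cardW c_def)
    finally show False using size[OF XY(1)] size[OF XY(2)] k by simp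
  qed
  have conflict: False if XY: "X \<in> \<P>" "Y \<in> \<P>" "X \<noteq> Y"
    and sub: "U1 \<subseteq> X" "U2 \<subseteq> X" "Y1 \<subseteq> Y" "Y2 \<subseteq> Y"
    and sz: "c * card X \<le> card U1" "c * card X \<le> card U2" "c * card Y \<le> card Y1" "c * card Y \<le> card Y2"
    and full: "\<And>x y l. x \<in> U1 \<Longrightarrow> y \<in> Y1 \<Longrightarrow> l < k \<Longrightarrow> {x, y, h l} \<in> F"
    and empty: "\<And>x y l. x \<in> U2 \<Longrightarrow> y \<in> Y2 \<Longrightarrow> l < k \<Longrightarrow> {x, y, h l} \<notin> F"
    for X Y U1 U2 Y1 Y2
  proof -
    obtain Z where Z: "Z \<in> \<P>" "Z \<noteq> X" "Z \<noteq> Y" "c * card Z \<le> card (I h Z)"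
      using heavy[OF XY(1,2)] by blast
    define Z1 where "Z1 = h ` I h Z"
    have Z1: "Z1 \<subseteq> Z" by (auto simp: Z1_def I_def)
    have "card Z1 = card (I h Z)"
      unfolding Z1_def by (rule card_image, rule inj_on_subset[OF inj(3)]) (auto simp: I_def)
    then have Z1c: "c * card Z \<le> card Z1" using Z by simp
    show False
    proof (rule vdisc3_opposite_boxes[OF reg[OF XY(1,2) Z(1) XY(3)] finX finX finX PD PD PD neX neX neX sub Z1 sz Z1c])
      show "K3 U1 Y1 Z1 \<subseteq> F \<inter> K3 X Y Z"
      proof (rule Int_greatest)
        show "K3 U1 Y1 Z1 \<subseteq> F" using full unfolding K3_def Z1_def I_def by blast
      qed (rule K3_mono[OF sub(1,3) Z1])
      have "K3 U2 Y2 Z1 \<inter> F = {}" using empty unfolding K3_def Z1_def I_def by blast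
      then show "K3 U2 Y2 Z1 \<inter> (F \<inter> K3 X Y Z) = {}" by blast
    qed (use XY Z in \<open>auto simp: c_def\<close>)
  qed
  define low where "low u X p = {i\<in>I u X. i < p}" for u X and p :: nat
  define high where "high u X p = {i\<in>I u X. p \<le> i}" for u X and p :: nat
  define good where "good u p \<longleftrightarrow> (\<exists>X\<in>\<P>. u p \<in> X \<and> c * card X \<le> card (low u X p) \<and> c * card X \<le> card (high u X p))" for u p
  have bad: "real (card {p\<in>{..<k}. \<not> good u p}) \<le> k / 8 + 2 * card \<P>" if "u ` {..<k} \<subseteq> W" for u
  proof -
    define B1 where "B1 X = {p\<in>I u X. card {i\<in>I u X. i < p} < c * card X}" for X
    define B2 where "B2 X = {p\<in>I u X. card {i\<in>I u X. p \<le> i} < c * card X}" for X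
    have "{p\<in>{..<k}. \<not> good u p} \<subseteq> (\<Union>X\<in>\<P>. B1 X \<union> B2 X)"
    proof
      fix p assume p: "p \<in> {p\<in>{..<k}. \<not> good u p}"
      then obtain X where X: "X \<in> \<P>" "u p \<in> X" using cover \<open>u ` {..<k} \<subseteq> W\<close> by blast
      then have "p \<in> I u X" using p by (simp add: I_def)
      then show "p \<in> (\<Union>X\<in>\<P>. B1 X \<union> B2 X)"
        using p X unfolding good_def low_def high_def B1_def B2_def by (auto simp: not_le)
    qed
    then have "card {p\<in>{..<k}. \<not> good u p} \<le> card (\<Union>X\<in>\<P>. B1 X \<union> B2 X)"
      by (rule card_mono[rotated]) (auto simp: finP finI B1_def B2_def)
    also have "\<dots> \<le> (\<Sum>X\<in>\<P>. card (B1 X \<union> B2 X))" by (rule card_UN_le) (rule finP)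
    also have "\<dots> \<le> (\<Sum>X\<in>\<P>. card (B1 X) + card (B2 X))" by (rule sum_mono) (rule card_Un_le)
    finally have "real (card {p\<in>{..<k}. \<not> good u p}) \<le> (\<Sum>X\<in>\<P>. real (card (B1 X)) + real (card (B2 X)))"
      by (simp only: of_nat_sum[symmetric] of_nat_add[symmetric] of_nat_le_iff)
    also have "\<dots> \<le> (\<Sum>X\<in>\<P>. 2 * c * card X + 2)"
    proof (rule sum_mono)
      fix X
      have "card (B1 X) \<le> c * card X + 1" "card (B2 X) \<le> c * card X + 1"
        unfolding B1_def B2_def by (rule card_few_below card_few_above; simp add: finI c_def)+
      then show "real (card (B1 X)) + real (card (B2 X)) \<le> 2 * c * card X + 2" by simp
    qed
    also have "\<dots> = 2 * c * real (\<Sum>X\<in>\<P>. card X) + 2 * card \<P>"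
      by (simp add: sum.distrib sum_distrib_left)
    also have "\<dots> = k / 8 + 2 * card \<P>"
      unfolding sum_card_partition_on[OF part finW] by (simp add: cardW c_def)
    finally show ?thesis .
  qed
  \<comment> \<open>Each of \<open>f\<close> and \<open>g\<close> spoils at most
    \<open>k / 8 + 2 * card \<P>\<close> indices; as \<open>16 * card \<P> \<le> k\<close>, half of
    the indices remain.\<close>
  define G where "G = {p\<in>{..<k}. good f p \<and> good g p}"
  have "{..<k} \<subseteq> G \<union> {p\<in>{..<k}. \<not> good f p} \<union> {p\<in>{..<k}. \<not> good g p}" by (auto simp: G_def)
  then have "card {..<k} \<le> card (G \<union> {p\<in>{..<k}. \<not> good f p} \<union> {p\<in>{..<k}. \<not> good g p})"
    by (intro card_mono) (auto simp: G_def)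
  also have "\<dots> \<le> card G + card {p\<in>{..<k}. \<not> good f p} + card {p\<in>{..<k}. \<not> good g p}"
    by (meson add_le_mono1 card_Un_le order_trans)
  finally have "real k \<le> real (card G) + card {p\<in>{..<k}. \<not> good f p} + card {p\<in>{..<k}. \<not> good g p}"
    by (simp only: card_lessThan of_nat_add[symmetric] of_nat_le_iff)
  moreover have "real (card {p\<in>{..<k}. \<not> good f p}) \<le> k / 8 + 2 * card \<P>" by (rule bad) (use W in auto)
  moreover have "real (card {p\<in>{..<k}. \<not> good g p}) \<le> k / 8 + 2 * card \<P>" by (rule bad) (use W in auto)
  moreover have "16 * real (card \<P>) \<le> k" using t(2) by (metis of_nat_le_iff of_nat_mult of_nat_numeral)
  ultimately have G: "k / 2 \<le> card G" by linarith
  have low_sub: "u ` low u X p \<subseteq> X" and high_sub: "u ` high u X p \<subseteq> X" for u X p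
    by (auto simp: low_def high_def I_def)
  have card_low: "card (u ` low u X p) = card (low u X p)" and card_high: "card (u ` high u X p) = card (high u X p)"
    if "inj_on u {..<k}" for u X p
    by (rule card_image, rule inj_on_subset[OF that], auto simp: low_def high_def I_def)+
  have ub: "i < k \<and> i < p" if "i \<in> low u X p" for i u X p using that by (auto simp: low_def I_def)
  have lb: "i < k \<and> p \<le> i" if "i \<in> high u X p" for i u X p using that by (auto simp: high_def I_def)
  have same: "X = Y" if p: "p < k" and X: "X \<in> \<P>" "c * card X \<le> card (low f X p)" "c * card X \<le> card (high f X p)"
      and Y: "Y \<in> \<P>" "c * card Y \<le> card (low g Y p)" "c * card Y \<le> card (high g Y p)" for p X Y
  proof (rule ccontr)
    assume "X \<noteq> Y"
    show False
    proof (rule conflict[OF X(1) Y(1) \<open>X \<noteq> Y\<close> low_sub[of f X p] high_sub[of f X p] high_sub[of g Y p] low_sub[of g Y p]])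
      show "{x, y, h l} \<in> F" if "x \<in> f ` low f X p" "y \<in> g ` high g Y p" "l < k" for x y l
      proof -
        obtain i j where "x = f i" "y = g j" "i < k" "j < k" "i < p" "p \<le> j" using \<open>x \<in> _\<close> \<open>y \<in> _\<close> ub lb by blast
        then show ?thesis using F[of i j l] \<open>l < k\<close> by simp
      qed
      show "{x, y, h l} \<notin> F" if "x \<in> f ` high f X p" "y \<in> g ` low g Y p" "l < k" for x y l
      proof -
        obtain i j where "x = f i" "y = g j" "i < k" "j < k" "p \<le> i" "j < p" using \<open>x \<in> _\<close> \<open>y \<in> _\<close> ub lb by blast
        then show ?thesis using F[of i j l] \<open>l < k\<close> by simp
      qed
    qed (use X Y inj in \<open>simp_all add: card_low card_high\<close>)
  qed
  have both: "\<exists>X\<in>\<P>. f p \<in> X \<and> c * card X \<le> card (low f X p) \<and> c * card X \<le> card (high f X p) \<and>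
      c * card X \<le> card (low g X p) \<and> c * card X \<le> card (high g X p)" if "p \<in> G" for p
    using that same unfolding G_def good_def by blast
  then obtain Pt where Pt: "\<And>p. p \<in> G \<Longrightarrow> Pt p \<in> \<P> \<and> f p \<in> Pt p \<and> c * card (Pt p) \<le> card (low f (Pt p) p) \<and>
      c * card (Pt p) \<le> card (high f (Pt p) p) \<and>
      c * card (Pt p) \<le> card (low g (Pt p) p) \<and> c * card (Pt p) \<le> card (high g (Pt p) p)" by metis
  have "G \<noteq> {}" using G k by auto
  then obtain p0 where p0: "p0 \<in> G" by blast
  \<comment> \<open>One part is too small to contain \<open>f p\<close> for all
    \<open>p \<in> G\<close>.\<close>
  have "\<exists>q\<in>G. Pt q \<noteq> Pt p0"
  proof (rule ccontr)
    assume "\<not> ?thesis"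
    then have "G \<subseteq> I f (Pt p0)" using Pt by (fastforce simp: I_def G_def)
    then have "card G \<le> card (I f (Pt p0))" by (intro card_mono finI)
    also have "\<dots> \<le> card (Pt p0)" by (rule cardI) (use Pt p0 inj in auto)
    finally have "card G \<le> 3 * real k / 16 + 1" using size[of "Pt p0"] Pt p0 by fastforce
    then show False using G k by linarith
  qed
  then obtain q0 where q0: "q0 \<in> G" "Pt q0 \<noteq> Pt p0" by blast
  define p q where "p = min p0 q0" and "q = max p0 q0"
  have pq: "p \<in> G" "q \<in> G" "Pt p \<noteq> Pt q" "p \<le> q"
    using p0 q0 by (auto simp: p_def q_def min_def max_def)
  let ?X = "Pt p" and ?Y = "Pt q"
  show False
  proof (rule conflict[of ?X ?Y "f ` low f ?X p" "g ` low g ?X p" "g ` high g ?Y q" "f ` high f ?Y q"])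
    show "{x, y, h l} \<in> F" if "x \<in> f ` low f ?X p" "y \<in> g ` high g ?Y q" "l < k" for x y l
    proof -
      obtain i j where ij: "x = f i" "y = g j" "i < k" "j < k" "i < p" "q \<le> j" using \<open>x \<in> _\<close> \<open>y \<in> _\<close> ub lb by blast
      then show ?thesis using F[of i j l] \<open>l < k\<close> pq by simp
    qed
    show "{x, y, h l} \<notin> F" if "x \<in> g ` low g ?X p" "y \<in> f ` high f ?Y q" "l < k" for x y l
    proof -
      obtain i j where ij: "x = g j" "y = f i" "i < k" "j < k" "j < p" "q \<le> i" using \<open>x \<in> _\<close> \<open>y \<in> _\<close> ub lb by blast
      then have "{f i, g j, h l} \<notin> F" using F[of i j l] \<open>l < k\<close> pq by simp
      then show ?thesis using ij by (simp add: insert_commute)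
    qed
  qed (use pq Pt inj low_sub high_sub in \<open>simp_all add: card_low card_high\<close>)
qed

text \<open>By heredity the 3-graph induced on the \<open>3 * k\<close> vertices of a copy belongs
  to the property as well, so the regular equipartition has to cut up the copy itself, into a number
  of parts bounded independently of \<open>k\<close>.\<close>

lemma zero_vdisc3_error_no_blown_up_half_graph:
  assumes her: "hereditary_property \<H>" and zero: "zero_vdisc3_error \<H>"
  shows "\<exists>k>0. \<forall>H\<in>\<H>. \<not> blown_up_half_graph k H"
proof (rule ccontr)
  assume "\<not> ?thesis"
  then have ex: "\<exists>H\<in>\<H>. blown_up_half_graph k H" if "0 < k" for k using that by blast
  obtain T N where TN: "\<forall>(V, F)\<in>\<H>. N \<le> card V \<longrightarrow>
        (\<exists>\<P>. equipartition V \<P> \<and> 16 \<le> card \<P> \<and> card \<P> \<le> T \<and>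
             (\<forall>X\<in>\<P>. \<forall>Y\<in>\<P>. \<forall>Z\<in>\<P>. X \<noteq> Y \<longrightarrow> X \<noteq> Z \<longrightarrow> Y \<noteq> Z \<longrightarrow>
                vdisc3 X Y Z (F \<inter> K3 X Y Z) ((1 / 48) ^ 3 / 3)))"
  proof -
    have "0 < (1 / 48) ^ 3 / (3 :: real)" "1 \<le> (16 :: nat)" by simp_all
    from zero[unfolded zero_vdisc3_error_def, THEN spec, THEN mp, OF this(1), THEN spec, THEN mp, OF this(2)]
    show ?thesis using that by (elim exE)
  qed
  \<comment> \<open>Large enough for \<open>16 * card \<P> \<le> k\<close> and for
    \<open>N \<le> card W\<close>, and positive.\<close>
  define k where "k = 16 * T + N + 1"
  obtain H where H: "H \<in> \<H>" "blown_up_half_graph k H" using ex[of k] by (auto simp: k_def)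
  then obtain f g h where inj: "inj_on f {..<k}" "inj_on g {..<k}" "inj_on h {..<k}"
    and sub: "f ` {..<k} \<subseteq> fst H" "g ` {..<k} \<subseteq> fst H" "h ` {..<k} \<subseteq> fst H"
    and disj: "f ` {..<k} \<inter> g ` {..<k} = {}" "f ` {..<k} \<inter> h ` {..<k} = {}" "g ` {..<k} \<inter> h ` {..<k} = {}"
    and F: "\<forall>i<k. \<forall>j<k. \<forall>l<k. {f i, g j, h l} \<in> snd H \<longleftrightarrow> i < j"
    unfolding blown_up_half_graph_def by auto
  define W where "W = f ` {..<k} \<union> g ` {..<k} \<union> h ` {..<k}"
  have "W \<subseteq> fst H" using sub by (simp add: W_def)
  then have "(W, snd H \<inter> nsets W 3) \<in> \<H>"
    using her H(1) unfolding hereditary_property_def induced_three_graph_def by blast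
  moreover have "k \<le> card W"
  proof -
    have "k = card (f ` {..<k})" using inj by (simp add: card_image)
    also have "\<dots> \<le> card W" by (rule card_mono) (auto simp: W_def)
    finally show ?thesis .
  qed
  then have "N \<le> card W" by (simp add: k_def)
  ultimately obtain \<P> where P: "equipartition W \<P>" "16 \<le> card \<P>" "card \<P> \<le> T"
    and reg: "\<forall>X\<in>\<P>. \<forall>Y\<in>\<P>. \<forall>Z\<in>\<P>. X \<noteq> Y \<longrightarrow> X \<noteq> Z \<longrightarrow> Y \<noteq> Z \<longrightarrow>
                vdisc3 X Y Z (snd H \<inter> nsets W 3 \<inter> K3 X Y Z) ((1 / 48) ^ 3 / 3)"
    using TN by fastforce
  have "{f i, g j, h l} \<in> snd H \<inter> nsets W 3 \<longleftrightarrow> i < j" if "i < k" "j < k" "l < k" for i j l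
  proof -
    have "f i \<noteq> g j" "f i \<noteq> h l" "g j \<noteq> h l" using disj that by auto
    then have "{f i, g j, h l} \<in> nsets W 3" using that by (auto simp: nsets_def W_def)
    then show ?thesis using F that by blast
  qed
  then show False
    by (rule blown_up_half_graph_not_regular[OF inj disj _ W_def P(1,2)])
       (use P reg in \<open>auto simp: k_def\<close>)
qed

section \<open>Homogeneous equipartitions\<close>

text \<open>For \<open>i < j\<close> the relation holds at \<open>(f i, g j)\<close> but fails at
  \<open>(f j, g j)\<close> and at \<open>(f i, g i)\<close>.\<close>

lemma half_graph_imp_inj_on:
  assumes "half_graph k R f g"
  shows "inj_on f {..<k}" "inj_on g {..<k}"
proof -
  have "f i \<noteq> f j \<and> g i \<noteq> g j" if "i < j" "j < k" for i j
    using assms that unfolding half_graph_def by (metis less_trans less_irrefl)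
  then show "inj_on f {..<k}" "inj_on g {..<k}"
    by (auto intro!: inj_onI) (metis linorder_neqE_nat)+
qed

text \<open>Any \<open>k\<close> of the vertices \<open>c\<close> can serve as the third class,
  since the pattern does not involve the third index.\<close>

lemma blown_up_half_graphI:
  assumes fg: "f \<in> tuples k A" "g \<in> tuples k B" and k: "0 < k"
    and disj: "A \<inter> B = {}" "A \<inter> C = {}" "B \<inter> C = {}" and sub: "A \<subseteq> V" "B \<subseteq> V" "C \<subseteq> V"
    and many: "k < card {c\<in>C. half_graph k (\<lambda>x y. {x, y, c} \<in> F) f g}"
  shows "blown_up_half_graph k (V, F)"
proof -
  define D where "D = {c\<in>C. half_graph k (\<lambda>x y. {x, y, c} \<in> F) f g}"
  have "k \<le> card D" using many by (simp add: D_def)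
  then obtain D' where "D' \<subseteq> D" "card D' = k" "finite D'" by (rule obtain_subset_with_card_n)
  then obtain h where h: "bij_betw h {..<k} D'"
    using finite_same_card_bij[of "{..<k}" D'] by auto
  then have hD: "h l \<in> D" if "l < k" for l using that \<open>D' \<subseteq> D\<close> by (auto simp: bij_betw_def)
  have hg: "half_graph k (\<lambda>x y. {x, y, h l} \<in> F) f g" if "l < k" for l using hD[OF that] by (simp add: D_def)
  have im: "f ` {..<k} \<subseteq> A" "g ` {..<k} \<subseteq> B" "h ` {..<k} \<subseteq> C"
    using fg hD by (auto simp: D_def)
  show ?thesis
    unfolding blown_up_half_graph_def fst_conv snd_conv
  proof (rule exI[of _ f], rule exI[of _ g], rule exI[of _ h], intro conjI)
    show "inj_on f {..<k}" "inj_on g {..<k}" using half_graph_imp_inj_on[OF hg[OF k]] by auto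
    show "inj_on h {..<k}" using h by (simp add: bij_betw_def)
    show "\<forall>i<k. \<forall>j<k. \<forall>l<k. {f i, g j, h l} \<in> F \<longleftrightarrow> i < j"
      using hg unfolding half_graph_def by blast
    show "f ` {..<k} \<subseteq> V" "g ` {..<k} \<subseteq> V" "h ` {..<k} \<subseteq> V"
      using im sub by (auto intro: order_trans)
    show "f ` {..<k} \<inter> g ` {..<k} = {}" using im(1,2) disj(1) by blast
    show "f ` {..<k} \<inter> h ` {..<k} = {}" using im(1,3) disj(2) by blast
    show "g ` {..<k} \<inter> h ` {..<k} = {}" using im(2,3) disj(3) by blast
  qed
qed

text \<open>The box of \<open>homogeneous_box\<close> fills at least a share
  \<open>\<rho> ^ 3\<close> of the triple and is homogeneous up to \<open>\<delta> / 2\<close>.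
  Regularity with error \<open>\<rho> ^ 3 * \<delta> / 2\<close> carries its density over to the
  whole triple at the cost of another \<open>\<delta> / 2\<close>.\<close>

lemma regular_triple_homogeneous:
  fixes \<delta> :: real
  assumes \<delta>: "0 < \<delta>" "\<delta> < 1" and k: "0 < k"
  shows "\<exists>\<epsilon>::real>0. \<exists>n0>0. \<forall>(X::'a set) Y Z F V.
    finite X \<longrightarrow> finite Y \<longrightarrow> finite Z \<longrightarrow> X \<inter> Y = {} \<longrightarrow> X \<inter> Z = {} \<longrightarrow> Y \<inter> Z = {} \<longrightarrow>
    n0 \<le> card X \<longrightarrow> n0 \<le> card Y \<longrightarrow> n0 \<le> card Z \<longrightarrow> X \<subseteq> V \<longrightarrow> Y \<subseteq> V \<longrightarrow> Z \<subseteq> V \<longrightarrow>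
    \<not> blown_up_half_graph k (V, F) \<longrightarrow> vdisc3 X Y Z (F \<inter> K3 X Y Z) \<epsilon> \<longrightarrow>
    card (F \<inter> K3 X Y Z) \<le> \<delta> * (real (card X) * card Y * card Z) \<or>
    (1 - \<delta>) * (real (card X) * card Y * card Z) \<le> card (F \<inter> K3 X Y Z)"
proof -
  have "0 < \<delta> / 2" "\<delta> / 2 < 1" using \<delta> by auto
  from homogeneous_box[OF this k, where ?'b = 'a and ?'c = 'a and ?'d = 'a]
  obtain \<rho> :: real and n0 :: nat where \<rho>: "0 < \<rho>" and n0: "0 < n0" and box: "\<forall>(X::'a set) (Y::'a set) (Z::'a set) v.
    finite X \<longrightarrow> finite Y \<longrightarrow> finite Z \<longrightarrow> n0 \<le> card X \<longrightarrow> n0 \<le> card Y \<longrightarrow> n0 \<le> card Z \<longrightarrow>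
    (\<forall>f\<in>tuples k Y. \<forall>g\<in>tuples k Z. card {x\<in>X. half_graph k (\<lambda>y z. v x y z) f g} \<le> k) \<longrightarrow>
    (\<forall>f\<in>tuples k X. \<forall>g\<in>tuples k Z. card {y\<in>Y. half_graph k (\<lambda>x z. v x y z) f g} \<le> k) \<longrightarrow>
    (\<forall>f\<in>tuples k X. \<forall>g\<in>tuples k Y. card {z\<in>Z. half_graph k (\<lambda>x y. v x y z) f g} \<le> k) \<longrightarrow>
    (\<exists>X' Y' Z'. X' \<subseteq> X \<and> Y' \<subseteq> Y \<and> Z' \<subseteq> Z \<and> X' \<noteq> {} \<and> Y' \<noteq> {} \<and> Z' \<noteq> {} \<and>
       \<rho> * card X \<le> card X' \<and> \<rho> * card Y \<le> card Y' \<and> \<rho> * card Z \<le> card Z' \<and>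
       ((\<Sum>x\<in>X'. \<Sum>y\<in>Y'. card {z\<in>Z'. v x y z}) \<le> \<delta> / 2 * card X' * card Y' * card Z' \<or>
        (\<Sum>x\<in>X'. \<Sum>y\<in>Y'. card {z\<in>Z'. \<not> v x y z}) \<le> \<delta> / 2 * card X' * card Y' * card Z'))"
    by (elim exE conjE) rule
  define \<epsilon> where "\<epsilon> = \<rho> ^ 3 * \<delta> / 2"
  have \<epsilon>: "0 < \<epsilon>" using \<rho> \<delta> by (simp add: \<epsilon>_def)
  have main: "card (F \<inter> K3 X Y Z) \<le> \<delta> * (real (card X) * card Y * card Z) \<or>
    (1 - \<delta>) * (real (card X) * card Y * card Z) \<le> card (F \<inter> K3 X Y Z)"
    if fin: "finite X" "finite Y" "finite Z" and disj: "X \<inter> Y = {}" "X \<inter> Z = {}" "Y \<inter> Z = {}"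
    and large: "n0 \<le> card X" "n0 \<le> card Y" "n0 \<le> card Z" and sub: "X \<subseteq> V" "Y \<subseteq> V" "Z \<subseteq> V"
    and no: "\<not> blown_up_half_graph k (V, F)" and vd: "vdisc3 X Y Z (F \<inter> K3 X Y Z) \<epsilon>"
    for X Y Z V :: "'a set" and F
  proof -
    have disj': "Y \<inter> X = {}" "Z \<inter> X = {}" "Z \<inter> Y = {}" using disj by auto
    \<comment> \<open>The vertex whose link is taken is moved to the last place, where
      \<open>blown_up_half_graphI\<close> expects it.\<close>
    have perm: "(\<lambda>y z. {x, y, z} \<in> F) = (\<lambda>y z. {y, z, x} \<in> F)"
      "(\<lambda>y z. {y, x, z} \<in> F) = (\<lambda>y z. {y, z, x} \<in> F)" for x :: 'a
      by (auto simp: insert_commute)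
    have "card {x\<in>X. half_graph k (\<lambda>y z. {x, y, z} \<in> F) f g} \<le> k" if "f \<in> tuples k Y" "g \<in> tuples k Z" for f g
      using blown_up_half_graphI[OF that k disj(3) disj'(1,2) sub(2,3,1)] no unfolding perm by (auto simp: not_le[symmetric])
    moreover have "card {y\<in>Y. half_graph k (\<lambda>x z. {x, y, z} \<in> F) f g} \<le> k" if "f \<in> tuples k X" "g \<in> tuples k Z" for f g
      using blown_up_half_graphI[OF that k disj(2) disj(1) disj'(3) sub(1,3,2)] no unfolding perm by (auto simp: not_le[symmetric])
    moreover have "card {z\<in>Z. half_graph k (\<lambda>x y. {x, y, z} \<in> F) f g} \<le> k" if "f \<in> tuples k X" "g \<in> tuples k Y" for f g
      using blown_up_half_graphI[OF that k disj sub] no not_le by blast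
    ultimately have "\<exists>X' Y' Z'. X' \<subseteq> X \<and> Y' \<subseteq> Y \<and> Z' \<subseteq> Z \<and> X' \<noteq> {} \<and> Y' \<noteq> {} \<and> Z' \<noteq> {} \<and>
       \<rho> * card X \<le> card X' \<and> \<rho> * card Y \<le> card Y' \<and> \<rho> * card Z \<le> card Z' \<and>
       ((\<Sum>x\<in>X'. \<Sum>y\<in>Y'. card {z\<in>Z'. {x, y, z} \<in> F}) \<le> \<delta> / 2 * card X' * card Y' * card Z' \<or>
        (\<Sum>x\<in>X'. \<Sum>y\<in>Y'. card {z\<in>Z'. {x, y, z} \<notin> F}) \<le> \<delta> / 2 * card X' * card Y' * card Z')"
      by (intro box[THEN spec, THEN spec, THEN spec, THEN spec, of X Y Z "\<lambda>x y z. {x, y, z} \<in> F",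
            THEN mp, THEN mp, THEN mp, THEN mp, THEN mp, THEN mp, THEN mp, THEN mp, THEN mp] fin large ballI)
    then obtain X' Y' Z' where sub': "X' \<subseteq> X" "Y' \<subseteq> Y" "Z' \<subseteq> Z" and ne': "X' \<noteq> {}" "Y' \<noteq> {}" "Z' \<noteq> {}"
      and size: "\<rho> * card X \<le> card X'" "\<rho> * card Y \<le> card Y'" "\<rho> * card Z \<le> card Z'"
      and hom: "(\<Sum>x\<in>X'. \<Sum>y\<in>Y'. card {z\<in>Z'. {x, y, z} \<in> F}) \<le> \<delta> / 2 * card X' * card Y' * card Z' \<or>
        (\<Sum>x\<in>X'. \<Sum>y\<in>Y'. card {z\<in>Z'. {x, y, z} \<notin> F}) \<le> \<delta> / 2 * card X' * card Y' * card Z'"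
      by blast
    have fin': "finite X'" "finite Y'" "finite Z'" using sub' fin by (auto intro: finite_subset)
    define P where "P = real (card X) * card Y * card Z"
    define P' where "P' = real (card X') * card Y' * card Z'"
    have P: "0 < P" using large n0 by (simp add: P_def)
    have P': "0 < P'" using ne' fin' by (simp add: P'_def card_gt_0_iff)
    define d where "d = card (F \<inter> K3 X Y Z) / P"
    have dP: "card (F \<inter> K3 X Y Z) = d * P" using P by (simp add: d_def)
    define n where "n = card (F \<inter> K3 X' Y' Z')"
    have n1: "n = (\<Sum>x\<in>X'. \<Sum>y\<in>Y'. card {z\<in>Z'. {x, y, z} \<in> F})"
      unfolding n_def by (rule card_Int_K3) (use disj sub' fin' in auto)
    have "(\<Sum>x\<in>X'. \<Sum>y\<in>Y'. card {z\<in>Z'. {x, y, z} \<in> F}) + (\<Sum>x\<in>X'. \<Sum>y\<in>Y'. card {z\<in>Z'. {x, y, z} \<notin> F})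
        = (\<Sum>x\<in>X'. \<Sum>y\<in>Y'. card {z\<in>Z'. {x, y, z} \<in> F} + card {z\<in>Z'. {x, y, z} \<notin> F})"
      by (simp add: sum.distrib)
    also have "\<dots> = (\<Sum>x\<in>X'. \<Sum>y\<in>Y'. card Z')"
    proof (intro sum.cong refl)
      fix x y
      have "card {z\<in>Z'. {x, y, z} \<in> F} + card {z\<in>Z'. {x, y, z} \<notin> F}
          = card ({z\<in>Z'. {x, y, z} \<in> F} \<union> {z\<in>Z'. {x, y, z} \<notin> F})"
        by (rule card_Un_disjoint[symmetric]) (use fin' in auto)
      also have "{z\<in>Z'. {x, y, z} \<in> F} \<union> {z\<in>Z'. {x, y, z} \<notin> F} = Z'" by blast
      finally show "card {z\<in>Z'. {x, y, z} \<in> F} + card {z\<in>Z'. {x, y, z} \<notin> F} = card Z'" .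
    qed
    also have "real \<dots> = P'" by (simp add: P'_def)
    finally have n2: "n + real (\<Sum>x\<in>X'. \<Sum>y\<in>Y'. card {z\<in>Z'. {x, y, z} \<notin> F}) = P'"
      by (simp only: n1 of_nat_add)
    have hom': "n \<le> \<delta> / 2 * P' \<or> P' - n \<le> \<delta> / 2 * P'"
      using hom n2 unfolding n1[symmetric] P'_def by (auto simp: mult.assoc)
    have "F \<inter> K3 X Y Z \<inter> K3 X' Y' Z' = F \<inter> K3 X' Y' Z'" using K3_mono[OF sub'] by blast
    then have "\<bar>n - d * P'\<bar> \<le> \<epsilon> * P"
      using vd[unfolded vdisc3_def Let_def, rule_format, OF sub']
      by (simp only: n_def d_def P_def P'_def mult.assoc)
    moreover have "\<rho> * card X * (\<rho> * card Y) * (\<rho> * card Z) \<le> P'"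
      unfolding P'_def using size \<rho> by (intro mult_mono) auto
    then have "\<rho> ^ 3 * P \<le> P'" by (simp add: P_def power3_eq_cube mult_ac)
    then have "\<delta> / 2 * (\<rho> ^ 3 * P) \<le> \<delta> / 2 * P'" using \<delta> by (intro mult_left_mono) auto
    then have "\<epsilon> * P \<le> \<delta> * P' / 2" by (simp add: \<epsilon>_def mult_ac)
    moreover have "(1 - \<delta>) * P' = P' - \<delta> * P'" "\<delta> / 2 * P' = \<delta> * P' / 2" by (simp_all add: algebra_simps)
    ultimately have "d * P' \<le> \<delta> * P' \<or> (1 - \<delta>) * P' \<le> d * P'"
      using hom' unfolding abs_le_iff by linarith
    then have "d \<le> \<delta> \<or> 1 - \<delta> \<le> d" using P' by simp
    then have "d * P \<le> \<delta> * P \<or> (1 - \<delta>) * P \<le> d * P" using P by simp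
    then show ?thesis by (simp add: dP flip: P_def)
  qed
  show ?thesis
    by (rule exI[of _ \<epsilon>], rule conjI[OF \<epsilon>], rule exI[of _ n0], rule conjI[OF n0],
        intro allI impI, rule main; assumption)
qed

definition homogeneous_triple :: "'a set set \<Rightarrow> real \<Rightarrow> 'a set \<Rightarrow> 'a set \<Rightarrow> 'a set \<Rightarrow> bool" where
  "homogeneous_triple F \<delta> X Y Z \<longleftrightarrow>
    card (F \<inter> K3 X Y Z) \<le> \<delta> * (real (card X) * card Y * card Z) \<or>
    (1 - \<delta>) * (real (card X) * card Y * card Z) \<le> card (F \<inter> K3 X Y Z)"

lemma zero_vdisc3_error_homogeneous:
  fixes \<delta> :: real
  assumes her: "hereditary_property \<H>" and zero: "zero_vdisc3_error \<H>" and \<delta>: "0 < \<delta>" "\<delta> < 1" and t0: "1 \<le> t0"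
  shows "\<exists>T N. \<forall>(V, F)\<in>\<H>. N \<le> card V \<longrightarrow>
    (\<exists>\<P>. equipartition V \<P> \<and> t0 \<le> card \<P> \<and> card \<P> \<le> T \<and>
      (\<forall>X\<in>\<P>. \<forall>Y\<in>\<P>. \<forall>Z\<in>\<P>. X \<noteq> Y \<longrightarrow> X \<noteq> Z \<longrightarrow> Y \<noteq> Z \<longrightarrow> homogeneous_triple F \<delta> X Y Z))"
proof -
  obtain k where k: "0 < k" and no: "\<And>H. H \<in> \<H> \<Longrightarrow> \<not> blown_up_half_graph k H"
    using zero_vdisc3_error_no_blown_up_half_graph[OF her zero] by blast
  from regular_triple_homogeneous[OF \<delta> k, where ?'a = 'a]
  obtain \<epsilon> :: real and n0 :: nat where \<epsilon>: "0 < \<epsilon>" and n0: "0 < n0" and reg: "\<forall>(X::'a set) Y Z F V.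
    finite X \<longrightarrow> finite Y \<longrightarrow> finite Z \<longrightarrow> X \<inter> Y = {} \<longrightarrow> X \<inter> Z = {} \<longrightarrow> Y \<inter> Z = {} \<longrightarrow>
    n0 \<le> card X \<longrightarrow> n0 \<le> card Y \<longrightarrow> n0 \<le> card Z \<longrightarrow> X \<subseteq> V \<longrightarrow> Y \<subseteq> V \<longrightarrow> Z \<subseteq> V \<longrightarrow>
    \<not> blown_up_half_graph k (V, F) \<longrightarrow> vdisc3 X Y Z (F \<inter> K3 X Y Z) \<epsilon> \<longrightarrow>
    card (F \<inter> K3 X Y Z) \<le> \<delta> * (real (card X) * card Y * card Z) \<or>
    (1 - \<delta>) * (real (card X) * card Y * card Z) \<le> card (F \<inter> K3 X Y Z)"
    by (elim exE conjE) rule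
  obtain T N where TN: "\<forall>(V, F)\<in>\<H>. N \<le> card V \<longrightarrow>
        (\<exists>\<P>. equipartition V \<P> \<and> t0 \<le> card \<P> \<and> card \<P> \<le> T \<and>
             (\<forall>X\<in>\<P>. \<forall>Y\<in>\<P>. \<forall>Z\<in>\<P>. X \<noteq> Y \<longrightarrow> X \<noteq> Z \<longrightarrow> Y \<noteq> Z \<longrightarrow>
                vdisc3 X Y Z (F \<inter> K3 X Y Z) \<epsilon>))"
    using zero \<epsilon> t0 unfolding zero_vdisc3_error_def by blast
  show ?thesis
  \<comment> \<open>The summand \<open>T * (n0 + 1)\<close> forces every part to have at least
    \<open>n0\<close> vertices, as \<open>card V \<le> card \<P> * (card X + 1)\<close>.\<close>
  proof (rule exI[of _ T], rule exI[of _ "N + T * (n0 + 1)"], clarify)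
    fix V F assume H: "(V, F) \<in> \<H>" and large: "N + T * (n0 + 1) \<le> card V"
    have finV: "finite V" using her H by (auto simp: hereditary_property_def finite_three_graph_def)
    have "N \<le> card V" using large by simp
    then obtain \<P> where P: "equipartition V \<P>" "t0 \<le> card \<P>" "card \<P> \<le> T"
      and vd: "\<forall>X\<in>\<P>. \<forall>Y\<in>\<P>. \<forall>Z\<in>\<P>. X \<noteq> Y \<longrightarrow> X \<noteq> Z \<longrightarrow> Y \<noteq> Z \<longrightarrow>
                vdisc3 X Y Z (F \<inter> K3 X Y Z) \<epsilon>"
      using TN H by fast
    have part: "partition_on V \<P>" using P by (simp add: equipartition_def)
    have sub: "X \<subseteq> V" if "X \<in> \<P>" for X using partition_onD1[OF part] that by auto
    have size: "n0 \<le> card X" if "X \<in> \<P>" for X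
    proof -
      have "T * (n0 + 1) \<le> card \<P> * (card X + 1)" using equipartition_card_ge[OF P(1) finV that] large by simp
      also have "\<dots> \<le> T * (card X + 1)" using P by (intro mult_right_mono) auto
      finally have "n0 + 1 \<le> card X + 1" using P t0 by (simp only: mult_le_cancel1)
      then show ?thesis by simp
    qed
    have "homogeneous_triple F \<delta> X Y Z" if "X \<in> \<P>" "Y \<in> \<P>" "Z \<in> \<P>" "X \<noteq> Y" "X \<noteq> Z" "Y \<noteq> Z" for X Y Z
    proof -
      have disj: "X \<inter> Y = {}" "X \<inter> Z = {}" "Y \<inter> Z = {}"
        using partition_onD2[OF part] that by (auto simp: disjoint_def)
      have fin: "finite X" "finite Y" "finite Z"
        using finite_subset[OF sub finV] that by blast+
      have "vdisc3 X Y Z (F \<inter> K3 X Y Z) \<epsilon>" using vd that by blast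
      with that show ?thesis
        unfolding homogeneous_triple_def by (intro reg[rule_format, OF fin disj, of V] size sub no[OF H])
    qed
    then show "\<exists>\<P>. equipartition V \<P> \<and> t0 \<le> card \<P> \<and> card \<P> \<le> T \<and>
      (\<forall>X\<in>\<P>. \<forall>Y\<in>\<P>. \<forall>Z\<in>\<P>. X \<noteq> Y \<longrightarrow> X \<noteq> Z \<longrightarrow> Y \<noteq> Z \<longrightarrow> homogeneous_triple F \<delta> X Y Z)"
      using P by blast
  qed
qed

section \<open>Quasirandom colourings of complete bipartite graphs\<close>

lemma balanced_map:
  fixes D :: nat
  assumes "finite U" "0 < D"
  shows "\<exists>c. (\<forall>u\<in>U. c u < D) \<and> (\<forall>i. real (card {u\<in>U. c u = i}) \<le> card U / D + 1)"
proof -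
  obtain h where h: "bij_betw h U {0..<card U}" using ex_bij_betw_finite_nat[OF assms(1)] by blast
  define c where "c u = h u mod D" for u
  have "real (card {u\<in>U. c u = i}) \<le> card U / D + 1" for i
  proof -
    have "inj_on (\<lambda>u. h u div D) {u\<in>U. c u = i}"
    proof (rule inj_onI)
      fix u u' assume u: "u \<in> {u\<in>U. c u = i}" "u' \<in> {u\<in>U. c u = i}" and "h u div D = h u' div D"
      have "u \<in> U" "u' \<in> U" using u by simp_all
      have md: "h u mod D = h u' mod D" using u by (simp add: c_def)
      have "h u = h u div D * D + h u mod D" by simp
      also have "\<dots> = h u' div D * D + h u' mod D" by (simp only: md \<open>h u div D = h u' div D\<close>)
      also have "\<dots> = h u'" by simp
      finally have "h u = h u'" .
      then show "u = u'" using inj_onD[OF bij_betw_imp_inj_on[OF h]] \<open>u \<in> U\<close> \<open>u' \<in> U\<close> by blast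
    qed
    moreover have "(\<lambda>u. h u div D) ` {u\<in>U. c u = i} \<subseteq> {..card U div D}"
    proof (rule image_subsetI)
      fix u assume "u \<in> {u\<in>U. c u = i}"
      then have "h u \<in> {0..<card U}" using bij_betwE[OF h] by simp
      then have "h u div D \<le> card U div D" by (intro div_le_mono) simp
      then show "h u div D \<in> {..card U div D}" by simp
    qed
    ultimately have "card {u\<in>U. c u = i} \<le> card {..card U div D}"
      by (intro card_inj_on_le) auto
    then have "card {u\<in>U. c u = i} \<le> card U div D + 1" by simp
    moreover have "real (card U div D) \<le> card U / D" by (rule of_nat_div_le_of_nat)
    ultimately show ?thesis by linarith
  qed
  then show ?thesis using assms by (intro exI[of _ c]) (simp add: c_def)
qed

text \<open>Two coordinates of a uniformly random function are independent: the sum factors over the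
  coordinates, and the factor at \<open>i\<close> vanishes.\<close>

lemma sum_PiE_mult_eq_0:
  fixes \<mu> :: "'b \<Rightarrow> real"
  assumes "finite I" "finite B" "i \<in> I" "j \<in> I" "i \<noteq> j" and 0: "(\<Sum>a\<in>B. \<mu> a) = 0"
  shows "(\<Sum>w\<in>I \<rightarrow>\<^sub>E B. \<mu> (w i) * \<mu> (w j)) = 0"
proof -
  define g where "g t a = (if t = i \<or> t = j then \<mu> a else 1)" for t a
  have "(\<Prod>t\<in>I. g t (w t)) = \<mu> (w i) * \<mu> (w j)" for w
  proof -
    have "(\<Prod>t\<in>I. g t (w t)) = (\<Prod>t\<in>{i, j}. g t (w t))"
      by (rule prod.mono_neutral_right) (use assms in \<open>auto simp: g_def\<close>)
    then show ?thesis using assms by (simp add: g_def)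
  qed
  then have "(\<Sum>w\<in>I \<rightarrow>\<^sub>E B. \<mu> (w i) * \<mu> (w j)) = (\<Sum>w\<in>I \<rightarrow>\<^sub>E B. \<Prod>t\<in>I. g t (w t))" by simp
  also have "\<dots> = (\<Prod>t\<in>I. \<Sum>a\<in>B. g t a)"
    using assms by (subst prod_sum_PiE) auto
  also have "\<dots> = 0"
    using assms by (intro prod_zero) (auto simp: g_def intro!: bexI[of _ i])
  finally show ?thesis .
qed

definition quasirandom_colouring :: "nat \<Rightarrow> real \<Rightarrow> 'b set \<Rightarrow> 'c set \<Rightarrow> ('b \<Rightarrow> 'c \<Rightarrow> nat) \<Rightarrow> bool" where
  "quasirandom_colouring l \<epsilon> U W col \<longleftrightarrow> (\<forall>x\<in>U. \<forall>y\<in>W. col x y \<in> {1..l}) \<and>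
     (\<forall>\<alpha>\<in>{1..l}. \<forall>U' W'. U' \<subseteq> U \<longrightarrow> W' \<subseteq> W \<longrightarrow>
        \<bar>(\<Sum>x\<in>U'. \<Sum>y\<in>W'. of_bool (col x y = \<alpha>)) - real (card U') * card W' / l\<bar> \<le> \<epsilon> * card U * card W)"

text \<open>Blow up the \<open>l\<close>-colouring of \<open>{..<D} \<times> ({..<D} \<rightarrow>\<^sub>E {1..l})\<close> that gives \<open>(i, w)\<close> the colour \<open>w i\<close>;
  its rows are pairwise independent.\<close>

lemma exists_quasirandom_colouring:
  fixes \<epsilon> :: real
  assumes l: "0 < l" and \<epsilon>: "0 < \<epsilon>"
  shows "\<exists>m0>0. \<forall>(U::'b set) (W::'c set). finite U \<longrightarrow> finite W \<longrightarrow> m0 \<le> card U \<longrightarrow> m0 \<le> card W \<longrightarrow>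
    (\<exists>col. quasirandom_colouring l \<epsilon> U W col)"
proof -
  \<comment> \<open>The deviation will be \<open>4 / sqrt D\<close> relative to
    \<open>card U * card W\<close>: a factor 2 for the uneven classes of each of the two balanced
    maps, and \<open>1 / sqrt D\<close> from pairwise independence.\<close>
  obtain D :: nat where D: "16 / \<epsilon>\<^sup>2 < D" using reals_Archimedean2 by blast
  have "0 < real D" using D \<epsilon> by (smt (verit) divide_pos_pos zero_less_power)
  then have D0: "0 < D" by simp
  have D4: "4 / sqrt D \<le> \<epsilon>"
  proof -
    have "(4 / \<epsilon>)\<^sup>2 \<le> D" using D by (simp add: power_divide)
    then have "4 / \<epsilon> \<le> sqrt D" by (rule real_le_rsqrt)
    then show ?thesis using \<epsilon> D0 by (simp add: field_simps)
  qed
  define \<Omega> where "\<Omega> = tuples D {1..l}"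
  have fin\<Omega>: "finite \<Omega>" by (simp add: \<Omega>_def finite_tuples)
  define N where "N = card \<Omega>"
  have N: "0 < N" using l by (simp add: N_def \<Omega>_def card_tuples)
  obtain e where e: "bij_betw e {..<N} \<Omega>"
    using finite_same_card_bij[of "{..<N}" \<Omega>] fin\<Omega> by (auto simp: N_def)
  have main: "\<exists>col. quasirandom_colouring l \<epsilon> U W col"
    if fin: "finite U" "finite W" and large: "max D N \<le> card U" "max D N \<le> card W" for U :: "'b set" and W :: "'c set"
  proof -
    obtain cU where cU: "\<And>u. u \<in> U \<Longrightarrow> cU u < D" "\<And>i. real (card {u\<in>U. cU u = i}) \<le> card U / D + 1"
      using balanced_map[OF fin(1) D0] by blast
    obtain cW where cW: "\<And>u. u \<in> W \<Longrightarrow> cW u < N" "\<And>i. real (card {u\<in>W. cW u = i}) \<le> card W / N + 1"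
      using balanced_map[OF fin(2) N] by blast
    define col where "col x y = e (cW y) (cU x)" for x y
    have "e j \<in> \<Omega>" if "j < N" for j using e that by (auto simp: bij_betw_def)
    then have "col x y \<in> {1..l}" if "x \<in> U" "y \<in> W" for x y
      using cU cW that by (fastforce simp: col_def \<Omega>_def PiE_def Pi_def)
    moreover have "\<bar>(\<Sum>x\<in>U'. \<Sum>y\<in>W'. of_bool (col x y = \<alpha>)) - real (card U') * card W' / l\<bar> \<le> \<epsilon> * card U * card W"
      if \<alpha>: "\<alpha> \<in> {1..l}" and sub: "U' \<subseteq> U" "W' \<subseteq> W" for \<alpha> U' W'
    proof -
      have fin': "finite U'" "finite W'" using sub fin by (auto intro: finite_subset)
      define \<mu> where "\<mu> a = of_bool (a = \<alpha>) - 1 / real l" for a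
      have \<mu>0: "(\<Sum>a\<in>{1..l}. \<mu> a) = 0"
        using \<alpha> l by (simp add: \<mu>_def sum_subtractf of_bool_def)
      have l1: "1 / real l \<le> 1" "0 \<le> 1 / real l" using l by auto
      have \<mu>1: "\<bar>\<mu> a\<bar> \<le> 1" for a
      proof -
        have "\<mu> a = 1 - 1 / real l \<or> \<mu> a = 0 - 1 / real l" by (simp add: \<mu>_def)
        then show ?thesis unfolding abs_le_iff using l1 by linarith
      qed
      define u where "u i = real (card {x\<in>U'. cU x = i})" for i
      \<comment> \<open>For a vertex \<open>y\<close> with \<open>cW y = j\<close>, this is the
        deviation of its number of \<open>\<alpha>\<close>-coloured pairs into \<open>U'\<close>
        from \<open>card U' / l\<close>.\<close>
      define s where "s j = (\<Sum>i<D. u i * \<mu> (e j i))" for j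
      define umax where "umax = 2 * card U / D"
      have "1 \<le> card U / D" using large D0 by (simp add: field_simps)
      then have u: "0 \<le> u i" "u i \<le> umax" for i
      proof -
        have "card {x\<in>U'. cU x = i} \<le> card {x\<in>U. cU x = i}" using sub fin by (intro card_mono) auto
        then have "u i \<le> card U / D + 1" using cU(2)[of i] unfolding u_def by linarith
        then show "u i \<le> umax" using \<open>1 \<le> card U / D\<close> unfolding umax_def by linarith
      qed (simp add: u_def)
      have umax: "0 < umax" using \<open>1 \<le> card U / D\<close> unfolding umax_def by linarith
      have "1 \<le> card W / N" using large N by (simp add: field_simps)
      then have w: "real (card {y\<in>W'. cW y = j}) \<le> 2 * card W / N" for j
      proof -
        have "card {x\<in>W'. cW x = j} \<le> card {x\<in>W. cW x = j}" using sub fin by (intro card_mono) auto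
        then show ?thesis using cW(2)[of j] \<open>1 \<le> card W / N\<close> by linarith
      qed
      have S: "(\<Sum>j<N. \<bar>s j\<bar>) \<le> N * (umax * sqrt D)"
      proof -
        define K where "K = umax * sqrt D"
        have K: "0 < K" using umax D0 by (simp add: K_def)
        \<comment> \<open>Second moment: the mixed terms vanish by independence, which leaves
          \<open>D\<close> diagonal terms of size at most \<open>umax\<^sup>2 * N\<close>.\<close>
        have S2: "(\<Sum>j<N. (s j)\<^sup>2) \<le> N * K\<^sup>2"
        proof -
          have "(\<Sum>j<N. (s j)\<^sup>2) = (\<Sum>w\<in>\<Omega>. (\<Sum>i<D. u i * \<mu> (w i))\<^sup>2)"
            unfolding s_def by (rule sum.reindex_bij_betw[OF e])
          also have "\<dots> = (\<Sum>w\<in>\<Omega>. \<Sum>i<D. \<Sum>i'<D. u i * u i' * (\<mu> (w i) * \<mu> (w i')))"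
            by (simp add: power2_eq_square sum_product mult_ac)
          also have "\<dots> = (\<Sum>i<D. \<Sum>i'<D. u i * u i' * (\<Sum>w\<in>\<Omega>. \<mu> (w i) * \<mu> (w i')))"
            unfolding sum_distrib_left by (subst sum.swap, rule sum.cong[OF refl], subst sum.swap) simp
          also have "\<dots> \<le> (\<Sum>i<D. \<Sum>i'<D. if i' = i then umax\<^sup>2 * N else 0)"
          proof (intro sum_mono)
            fix i i' assume ii: "i \<in> {..<D}" "i' \<in> {..<D}"
            show "u i * u i' * (\<Sum>w\<in>\<Omega>. \<mu> (w i) * \<mu> (w i')) \<le> (if i' = i then umax\<^sup>2 * N else 0)"
            proof (cases "i' = i")
              case True
              have "(\<Sum>w\<in>\<Omega>. \<mu> (w i) * \<mu> (w i)) \<le> (\<Sum>w\<in>\<Omega>. 1)"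
              proof (rule sum_mono)
                fix w
                have "\<bar>\<mu> (w i)\<bar> * \<bar>\<mu> (w i)\<bar> \<le> 1 * 1" by (intro mult_mono \<mu>1) auto
                then show "\<mu> (w i) * \<mu> (w i) \<le> 1" by simp
              qed
              then have le: "(\<Sum>w\<in>\<Omega>. \<mu> (w i) * \<mu> (w i)) \<le> N" by (simp add: N_def)
              have nn: "0 \<le> (\<Sum>w\<in>\<Omega>. \<mu> (w i) * \<mu> (w i))" by (rule sum_nonneg) simp
              have "u i * u i * (\<Sum>w\<in>\<Omega>. \<mu> (w i) * \<mu> (w i)) \<le> umax * umax * N"
                by (intro mult_mono u le nn) (use u umax in auto)
              then show ?thesis using True by (simp add: power2_eq_square)
            next
              case False
              have "(\<Sum>w\<in>\<Omega>. \<mu> (w i) * \<mu> (w i')) = 0"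
                unfolding \<Omega>_def by (rule sum_PiE_mult_eq_0) (use ii False \<mu>0 in auto)
              then show ?thesis using False by simp
            qed
          qed
          also have "\<dots> = N * K\<^sup>2" using D0 by (simp add: K_def power_mult_distrib)
          finally show ?thesis .
        qed
        \<comment> \<open>Summing this over \<open>j\<close> replaces the Cauchy-Schwarz inequality:
          a mean square of at most \<open>K\<^sup>2\<close> bounds the mean of the absolute values
          by \<open>K\<close>.\<close>
        have "\<bar>s j\<bar> \<le> (s j)\<^sup>2 / (2 * K) + K / 2" for j
        proof -
          have "0 \<le> (\<bar>s j\<bar> - K)\<^sup>2" by simp
          then have "2 * K * \<bar>s j\<bar> \<le> (s j)\<^sup>2 + K\<^sup>2" by (simp add: power2_diff mult_ac)
          then show ?thesis using K by (simp add: field_simps power2_eq_square)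
        qed
        then have "(\<Sum>j<N. \<bar>s j\<bar>) \<le> (\<Sum>j<N. (s j)\<^sup>2 / (2 * K) + K / 2)" by (intro sum_mono)
        also have "\<dots> = (\<Sum>j<N. (s j)\<^sup>2) / (2 * K) + N * K / 2"
          by (simp add: sum.distrib sum_divide_distrib)
        also have "\<dots> \<le> N * K\<^sup>2 / (2 * K) + N * K / 2"
          using S2 K by (simp add: divide_right_mono)
        also have "\<dots> = N * K" using K by (simp add: power2_eq_square field_simps)
        finally show ?thesis by (simp add: K_def)
      qed
      have "(\<Sum>x\<in>U'. \<Sum>y\<in>W'. of_bool (col x y = \<alpha>)) - real (card U') * card W' / l
          = (\<Sum>x\<in>U'. \<Sum>y\<in>W'. \<mu> (e (cW y) (cU x)))"
        by (simp add: \<mu>_def col_def sum_subtractf)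
      also have "\<dots> = (\<Sum>y\<in>W'. \<Sum>x\<in>U'. \<mu> (e (cW y) (cU x)))" by (rule sum.swap)
      also have "\<dots> = (\<Sum>y\<in>W'. s (cW y))"
      proof (rule sum.cong[OF refl])
        fix y
        have "(\<Sum>x\<in>U'. \<mu> (e (cW y) (cU x))) = (\<Sum>i<D. \<Sum>x\<in>{x\<in>U'. cU x = i}. \<mu> (e (cW y) (cU x)))"
          by (rule sum.group[symmetric]) (use fin' sub cU in auto)
        also have "\<dots> = s (cW y)" unfolding s_def u_def by (intro sum.cong refl) simp
        finally show "(\<Sum>x\<in>U'. \<mu> (e (cW y) (cU x))) = s (cW y)" .
      qed
      also have "\<dots> = (\<Sum>j<N. \<Sum>y\<in>{y\<in>W'. cW y = j}. s (cW y))"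
        by (rule sum.group[symmetric]) (use fin' sub cW in auto)
      also have "\<dots> = (\<Sum>j<N. card {y\<in>W'. cW y = j} * s j)" by (intro sum.cong refl) simp
      finally have "\<bar>(\<Sum>x\<in>U'. \<Sum>y\<in>W'. of_bool (col x y = \<alpha>)) - real (card U') * card W' / l\<bar>
          \<le> (\<Sum>j<N. \<bar>card {y\<in>W'. cW y = j} * s j\<bar>)" by (simp only: sum_abs)
      also have "\<dots> \<le> (\<Sum>j<N. (2 * card W / N) * \<bar>s j\<bar>)"
        unfolding abs_mult by (intro sum_mono mult_right_mono) (use w in auto)
      also have "\<dots> = (2 * card W / N) * (\<Sum>j<N. \<bar>s j\<bar>)" by (simp add: sum_distrib_left)
      also have "\<dots> \<le> (2 * card W / N) * (N * (umax * sqrt D))"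
        by (rule mult_left_mono[OF S]) simp
      also have "\<dots> = (4 * (sqrt D / D)) * (real (card U) * card W)"
        using N by (simp add: umax_def)
      also have "sqrt D / D = 1 / sqrt D" using D0 by (simp add: real_div_sqrt field_simps)
      also have "4 * (1 / sqrt D) * (real (card U) * card W) \<le> \<epsilon> * (real (card U) * card W)"
        using D4 by (intro mult_right_mono) auto
      finally show ?thesis by (simp only: mult.assoc)
    qed
    ultimately show ?thesis unfolding quasirandom_colouring_def by blast
  qed
  show ?thesis
    by (rule exI[of _ "max D N"], intro conjI allI impI main) (use D0 in auto)
qed

section \<open>Triads\<close>

lemma K2_commute: "K2 X Y = K2 Y X"
  unfolding K2_def by (auto simp: insert_commute)

lemma disc2_commute: "disc2 U W E \<epsilon> \<longleftrightarrow> disc2 W U E \<epsilon>"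
proof -
  have "disc2 W U E \<epsilon>" if "disc2 U W E \<epsilon>" for U W :: "'a set"
  proof -
    define d where "d = real (card E) / (real (card U) * real (card W))"
    have d': "real (card E) / (real (card W) * real (card U)) = d" by (simp add: d_def mult.commute)
    have "\<bar>real (card (E \<inter> K2 W' U')) - d * real (card W') * real (card U')\<bar> \<le> \<epsilon> * real (card W) * real (card U)"
      if "U' \<subseteq> U" "W' \<subseteq> W" for U' W'
    proof -
      have "\<bar>real (card (E \<inter> K2 U' W')) - d * real (card U') * real (card W')\<bar> \<le> \<epsilon> * real (card U) * real (card W)"
        using \<open>disc2 U W E \<epsilon>\<close> that unfolding disc2_def Let_def d_def[symmetric] by blast
      then show ?thesis by (simp add: K2_commute[of U'] mult_ac)
    qed
    then show ?thesis unfolding disc2_def Let_def d' by blast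
  qed
  then show ?thesis by blast
qed

lemma disc2_density_commute: "disc2_density U W E \<epsilon> d \<longleftrightarrow> disc2_density W U E \<epsilon> d"
  unfolding disc2_density_def by (subst disc2_commute) (simp add: mult_ac)

lemma card_Int_K2:
  assumes disj: "U \<inter> W = {}" and fin: "finite U" "finite W"
  shows "card (E \<inter> K2 U W) = (\<Sum>x\<in>U. card {y\<in>W. {x, y} \<in> E})"
proof -
  define D where "D = (SIGMA x:U. {y\<in>W. {x, y} \<in> E})"
  have "K2 U W = {{x, y} | x y. x \<in> U \<and> y \<in> W}" unfolding K2_def using disj by blast
  then have "E \<inter> K2 U W = (\<lambda>(x, y). {x, y}) ` D" unfolding D_def by (auto simp: image_iff)
  moreover have "inj_on (\<lambda>(x, y). {x, y}) D"
  proof (rule inj_onI)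
    fix p q assume p: "p \<in> D" and q: "q \<in> D" and eq: "(case p of (x, y) \<Rightarrow> {x, y}) = (case q of (x, y) \<Rightarrow> {x, y})"
    obtain x y x' y' where pq: "p = (x, y)" "q = (x', y')" by (meson surj_pair)
    have "x \<in> U" "y \<in> W" "x' \<in> U" "y' \<in> W" using p q pq by (auto simp: D_def)
    moreover have "{x, y} = {x', y'}" using eq pq by simp
    ultimately show "p = q" using disj pq by (auto simp: doubleton_eq_iff)
  qed
  ultimately have "card (E \<inter> K2 U W) = card D" by (simp add: card_image)
  also have "\<dots> = (\<Sum>x\<in>U. card {y\<in>W. {x, y} \<in> E})"
    unfolding D_def by (rule card_SigmaI) (use fin in auto)
  finally show ?thesis .
qed

lemma card_K2:
  assumes "U \<inter> W = {}" "finite U" "finite W"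
  shows "card (K2 U W) = card U * card W"
  using card_Int_K2[OF assms, of UNIV] by simp

lemma finite_K2: "finite U \<Longrightarrow> finite W \<Longrightarrow> finite (K2 U W)"
  by (rule finite_subset[of _ "Pow (U \<union> W)"]) (auto simp: K2_def)

lemma K2_disjoint_cases:
  assumes "{x, y} \<in> K2 A B"
  shows "x \<in> A \<and> y \<in> B \<or> x \<in> B \<and> y \<in> A"
  using assms unfolding K2_def by (auto simp: doubleton_eq_iff)

text \<open>Edges join different classes, so three pairwise adjacent vertices occupy all three
  classes, in one of six orders.\<close>

lemma triangles_subset_K3:
  assumes disj: "A \<inter> B = {}" "A \<inter> C = {}" "B \<inter> C = {}"
    and E: "E \<subseteq> K2 A B \<union> K2 A C \<union> K2 B C"
  shows "triangles E \<subseteq> K3 A B C"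
proof
  fix e assume "e \<in> triangles E"
  then obtain x y z where e: "e = {x, y, z}" and ne: "x \<noteq> y" "x \<noteq> z" "y \<noteq> z"
    and E3: "{x, y} \<in> E" "{x, z} \<in> E" "{y, z} \<in> E"
    unfolding triangles_def by blast
  define cross where "cross u v \<longleftrightarrow> (u \<in> A \<and> v \<in> B \<or> u \<in> B \<and> v \<in> A) \<or> (u \<in> A \<and> v \<in> C \<or> u \<in> C \<and> v \<in> A) \<or>
    (u \<in> B \<and> v \<in> C \<or> u \<in> C \<and> v \<in> B)" for u v
  have "cross u v" if "{u, v} \<in> E" for u v
    using that E K2_disjoint_cases[of u v] unfolding cross_def by blast
  then have c: "cross x y" "cross x z" "cross y z" using E3 by blast+
  have I: "{a, b, c} \<in> K3 A B C" if "a \<in> A" "b \<in> B" "c \<in> C" for a b c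
    using that disj unfolding K3_def by blast
  have perm: "{x, y, z} = {x, z, y}" "{x, y, z} = {y, x, z}" "{x, y, z} = {y, z, x}" "{x, y, z} = {z, x, y}" "{x, y, z} = {z, y, x}"
    by auto
  consider "x \<in> A" "y \<in> B" "z \<in> C" | "x \<in> A" "z \<in> B" "y \<in> C" | "y \<in> A" "x \<in> B" "z \<in> C"
    | "y \<in> A" "z \<in> B" "x \<in> C" | "z \<in> A" "x \<in> B" "y \<in> C" | "z \<in> A" "y \<in> B" "x \<in> C"
    using c disj unfolding cross_def by blast
  then show "e \<in> K3 A B C"
    unfolding e by cases (use I perm in metis)+
qed

lemma mem_triangles_iff:
  assumes "x \<noteq> y" "x \<noteq> z" "y \<noteq> z"
  shows "{x, y, z} \<in> triangles E \<longleftrightarrow> {x, y} \<in> E \<and> {x, z} \<in> E \<and> {y, z} \<in> E"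
proof
  assume "{x, y, z} \<in> triangles E"
  then obtain a b c where "{x, y, z} = {a, b, c}" "a \<noteq> b" "a \<noteq> c" "b \<noteq> c"
    and E: "{a, b} \<in> E" "{a, c} \<in> E" "{b, c} \<in> E" unfolding triangles_def by blast
  have pairs: "{u, v} \<in> E" if "u \<in> {a, b, c}" "v \<in> {a, b, c}" "u \<noteq> v" for u v
    using that E by (auto simp: insert_commute)
  have "x \<in> {a, b, c}" "y \<in> {a, b, c}" "z \<in> {a, b, c}" using \<open>{x, y, z} = {a, b, c}\<close> by blast+
  then show "{x, y} \<in> E \<and> {x, z} \<in> E \<and> {y, z} \<in> E" using pairs assms by blast
next
  assume "{x, y} \<in> E \<and> {x, z} \<in> E \<and> {y, z} \<in> E"
  then show "{x, y, z} \<in> triangles E" unfolding triangles_def using assms by blast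
qed

lemma triangles_mono: "E' \<subseteq> E \<Longrightarrow> triangles E' \<subseteq> triangles E"
  unfolding triangles_def by blast

text \<open>In a nearly empty triple the two numbers to be compared both lie between 0 and
  \<open>f \<le> \<delta> * P\<close>; in a nearly full one the same argument applies to the
  non-edges. The permitted error is absolute, so a small \<delta> suffices however few triangles
  \<open>G\<close> has.\<close>

lemma disc23_of_homogeneous_triple:
  fixes \<delta> :: real
  assumes disj: "A \<inter> B = {}" "A \<inter> C = {}" "B \<inter> C = {}" and fin: "finite A" "finite B" "finite C"
    and G: "G \<subseteq> K2 A B \<union> K2 A C \<union> K2 B C"
    and hom: "homogeneous_triple F \<delta> A B C" and d2: "0 < d2" "d2 \<le> 1"
    and dd: "disc2_density A B (G \<inter> K2 A B) \<epsilon>2 d2" "disc2_density A C (G \<inter> K2 A C) \<epsilon>2 d2"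
      "disc2_density B C (G \<inter> K2 B C) \<epsilon>2 d2"
    and \<delta>: "\<delta> \<le> \<epsilon>1 * d2 ^ 3"
  shows "disc23 A B C (F \<inter> triangles G) G \<epsilon>1 \<epsilon>2"
proof -
  define P where "P = real (card A) * card B * card C"
  define d3 where "d3 = real (card (F \<inter> triangles G)) / real (card (triangles G))"
  have TK: "triangles G \<subseteq> K3 A B C" by (rule triangles_subset_K3[OF disj G])
  have finK: "finite (K3 A B C)" by (rule finite_K3[OF fin])
  have finT: "finite (triangles G)" using TK finK by (rule finite_subset)
  have "\<bar>real (card (F \<inter> triangles G \<inter> triangles E')) - d3 * real (card (triangles E'))\<bar>
            \<le> \<epsilon>1 * d2 ^ 3 * real (card A) * real (card B) * real (card C)" if "E' \<subseteq> G" for E'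
  proof -
    have TE: "triangles E' \<subseteq> triangles G" by (rule triangles_mono[OF that])
    define t t' f f' where "t = real (card (triangles G))" and "t' = real (card (triangles E'))"
      and "f = real (card (F \<inter> triangles G))" and "f' = real (card (F \<inter> triangles E'))"
    have tt: "0 \<le> t'" "t' \<le> t" unfolding t_def t'_def using TE finT by (auto intro: card_mono)
    have ff: "0 \<le> f'" "f' \<le> f" "0 \<le> f" "f \<le> t" unfolding f_def f'_def t_def
      using TE finT by (auto intro!: card_mono)
    define r where "r = t' / t"
    have q: "0 \<le> r" "r \<le> 1" using tt by (auto simp: r_def divide_le_eq_1)
    have eq: "d3 * t' = f * r" by (simp add: d3_def f_def t_def r_def)
    \<comment> \<open>For \<open>t = 0\<close> the quotient \<open>r\<close> is 0 by convention, and
      then \<open>t'\<close> is 0 as well.\<close>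
    have tr: "t * r = t'" using tt by (cases "t = 0") (auto simp: r_def)
    have "\<bar>f' - f * r\<bar> \<le> \<delta> * P"
      using hom unfolding homogeneous_triple_def P_def[symmetric]
    proof
      assume "card (F \<inter> K3 A B C) \<le> \<delta> * P"
      moreover have "card (F \<inter> triangles G) \<le> card (F \<inter> K3 A B C)"
        using TK finK by (intro card_mono) auto
      ultimately have "f \<le> \<delta> * P" unfolding f_def by linarith
      moreover have "0 \<le> f * r" "f * r \<le> f * 1"
        using ff(3) q by (auto intro: mult_left_le)
      ultimately show ?thesis using ff unfolding abs_le_iff by linarith
    next
      assume "(1 - \<delta>) * P \<le> card (F \<inter> K3 A B C)"
      moreover have cK: "real (card (K3 A B C)) = P" by (simp add: card_K3[OF disj fin] P_def)
      moreover have "card (K3 A B C - F) = card (K3 A B C) - card (F \<inter> K3 A B C)"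
        using finK by (metis Int_commute card_Diff_subset_Int finite_Int)
      moreover have "card (F \<inter> K3 A B C) \<le> card (K3 A B C)" using finK by (intro card_mono) auto
      ultimately have K: "real (card (K3 A B C - F)) \<le> \<delta> * P" by (simp add: of_nat_diff left_diff_distrib)
      have split: "real (card S) = card (F \<inter> S) + real (card (S - F))" if "finite S" for S
        using card_Int_Diff[OF that, of F] by (simp add: Int_commute)
      define m m' where "m = real (card (triangles G - F))" and "m' = real (card (triangles E' - F))"
      have "card (triangles G - F) \<le> card (K3 A B C - F)" using TK finK by (intro card_mono) auto
      then have m: "m \<le> \<delta> * P" using K unfolding m_def by linarith
      have mm: "0 \<le> m'" "m' \<le> m" "0 \<le> m" unfolding m_def m'_def using TE finT by (auto intro!: card_mono)
      have s1: "t = f + m" unfolding t_def f_def m_def by (rule split[OF finT])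
      have s2: "t' = f' + m'" unfolding t'_def f'_def m'_def by (rule split) (rule finite_subset[OF TE finT])
      have "f * r = (t - m) * r" using s1 by simp
      also have "\<dots> = t' - m * r" using tr by (simp add: algebra_simps)
      finally have "f' - f * r = m * r - m'" using s2 by simp
      moreover have "0 \<le> m * r" "m * r \<le> m * 1"
        using mm(3) q by (auto intro: mult_left_le)
      ultimately show ?thesis using m mm unfolding abs_le_iff by linarith
    qed
    also have "\<delta> * P \<le> \<epsilon>1 * d2 ^ 3 * P" by (rule mult_right_mono[OF \<delta>]) (simp add: P_def)
    moreover have "F \<inter> triangles G \<inter> triangles E' = F \<inter> triangles E'" using TE by blast
    ultimately show ?thesis unfolding t'_def[symmetric] eq f'_def by (simp add: f'_def P_def mult.assoc)
  qed
  then show ?thesis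
    unfolding disc23_def Let_def d3_def[symmetric] using d2 dd by blast
qed

text \<open>The colouring is compared with the ideal density \<open>d\<close>, but
  \<open>disc2\<close> refers to the actual density of the class. Testing the full box shows that
  the two differ by at most \<open>\<epsilon> / 2\<close>, whence the halved error in the
  hypothesis.\<close>

lemma disc2_density_of_colour_class:
  fixes \<epsilon> d :: real
  assumes disj: "U \<inter> W = {}" and fin: "finite U" "finite W" and ne: "U \<noteq> {}" "W \<noteq> {}"
    and col: "\<And>U' W'. U' \<subseteq> U \<Longrightarrow> W' \<subseteq> W \<Longrightarrow>
        \<bar>(\<Sum>x\<in>U'. \<Sum>y\<in>W'. of_bool (col x y = \<alpha>)) - real (card U') * card W' * d\<bar> \<le> \<epsilon> / 2 * card U * card W"
  shows "disc2_density U W {{x, y} | x y. x \<in> U \<and> y \<in> W \<and> col x y = \<alpha>} \<epsilon> d"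
proof -
  define E where "E = {{x, y} | x y. x \<in> U \<and> y \<in> W \<and> col x y = \<alpha>}"
  have mem: "{x, y} \<in> E \<longleftrightarrow> col x y = \<alpha>" if "x \<in> U" "y \<in> W" for x y
    using that disj unfolding E_def by (auto simp: doubleton_eq_iff)
  have cE: "real (card (E \<inter> K2 U' W')) = (\<Sum>x\<in>U'. \<Sum>y\<in>W'. of_bool (col x y = \<alpha>))" if "U' \<subseteq> U" "W' \<subseteq> W" for U' W'
  proof -
    have fin': "finite U'" "finite W'" using that fin by (auto intro: finite_subset)
    have "card (E \<inter> K2 U' W') = (\<Sum>x\<in>U'. card {y\<in>W'. {x, y} \<in> E})"
      by (rule card_Int_K2) (use disj that fin' in auto)
    also have "\<dots> = (\<Sum>x\<in>U'. card {y\<in>W'. col x y = \<alpha>})"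
      by (intro sum.cong refl arg_cong[of _ _ card] Collect_cong) (use mem that in blast)
    finally show ?thesis by (simp add: sum_of_bool_card[OF fin'(2)])
  qed
  have "E \<subseteq> K2 U W" unfolding E_def K2_def using disj by blast
  then have EK: "E \<inter> K2 U W = E" by blast
  have tot: "\<bar>real (card E) - real (card U) * card W * d\<bar> \<le> \<epsilon> / 2 * card U * card W"
    using col[of U W] cE[of U W] by (simp add: EK)
  define UW where "UW = real (card U) * card W"
  have UW: "0 < UW" using fin ne by (simp add: UW_def card_gt_0_iff)
  define D where "D = real (card E) / UW"
  have E_eq: "real (card E) = D * UW" using UW by (simp add: D_def)
  have "\<bar>D - d\<bar> * UW = \<bar>(D - d) * UW\<bar>" using UW by (simp add: abs_mult)
  also have "\<dots> \<le> \<epsilon> / 2 * UW" using tot by (simp add: E_eq UW_def algebra_simps)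
  finally have Dd: "\<bar>D - d\<bar> \<le> \<epsilon> / 2" using UW by simp
  then have e0: "0 \<le> \<epsilon>" by linarith
  have "disc2 U W E \<epsilon>"
    unfolding disc2_def Let_def
  proof (intro allI impI)
    fix U' W' assume sub: "U' \<subseteq> U" "W' \<subseteq> W"
    have "real (card U') * card W' \<le> UW" unfolding UW_def using sub fin by (intro mult_mono) (auto intro: card_mono)
    then have "\<bar>D - d\<bar> * (real (card U') * card W') \<le> \<epsilon> / 2 * UW"
      using Dd e0 by (intro mult_mono) auto
    then have "\<bar>(D - d) * (real (card U') * card W')\<bar> \<le> \<epsilon> / 2 * UW" by (simp add: abs_mult)
    moreover have "\<bar>real (card (E \<inter> K2 U' W')) - real (card U') * card W' * d\<bar> \<le> \<epsilon> / 2 * UW"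
      using col[OF sub] cE[OF sub] by (simp add: UW_def mult.assoc)
    ultimately have "\<bar>real (card (E \<inter> K2 U' W')) - D * (real (card U') * card W')\<bar> \<le> \<epsilon> * UW"
      unfolding abs_le_iff by (simp add: algebra_simps) 
    then show "\<bar>real (card (E \<inter> K2 U' W')) - real (card E) / (real (card U) * real (card W)) * real (card U') * real (card W')\<bar>
       \<le> \<epsilon> * real (card U) * real (card W)"
      by (simp add: D_def UW_def mult.assoc)
  qed
  moreover have "\<epsilon> / 2 * UW \<le> \<epsilon> * UW" using e0 UW by simp
  then have "\<bar>real (card E) - d * real (card U) * real (card W)\<bar> \<le> \<epsilon> * real (card U) * real (card W)"
    using tot by (simp add: UW_def mult_ac)
  ultimately show ?thesis unfolding disc2_density_def E_def by blast
qed

section \<open>From homogeneous equipartitions to decompositions\<close>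

lemma K2_Int_K2_empty:
  assumes "A \<inter> B = {}" "A \<inter> C = {}" "B \<inter> C = {}"
  shows "K2 A B \<inter> K2 A C = {}" "K2 A B \<inter> K2 B C = {}" "K2 A C \<inter> K2 B C = {}"
proof -
  have 1: "K2 A B \<inter> K2 A' B' = {}" if "A \<inter> A' = {} \<or> B \<inter> B' = {}" "A \<inter> B' = {} \<or> B \<inter> A' = {}" for A B A' B' :: "'a set"
  proof (rule ccontr)
    assume "K2 A B \<inter> K2 A' B' \<noteq> {}"
    then obtain x y where "x \<in> A" "y \<in> B" "{x, y} \<in> K2 A' B'" unfolding K2_def by blast
    then show False using K2_disjoint_cases[of x y A' B'] that by blast
  qed
  show "K2 A B \<inter> K2 A C = {}" "K2 A B \<inter> K2 B C = {}" "K2 A C \<inter> K2 B C = {}"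
    by (rule 1; use assms in blast)+
qed

lemma nsets_tripleton: "{i, j, k} \<in> nsets I 3 \<longleftrightarrow> i \<in> I \<and> j \<in> I \<and> k \<in> I \<and> i \<noteq> j \<and> i \<noteq> k \<and> j \<noteq> k"
  unfolding nsets_def by (auto simp: card_insert_if)

lemma exists_sorted_by_card:
  assumes "finite \<P>"
  shows "\<exists>xs. distinct xs \<and> set xs = \<P> \<and> sorted (map card xs)"
proof -
  obtain ys where "distinct ys" "set ys = \<P>" using finite_distinct_list[OF assms] by blast
  then show ?thesis by (intro exI[of _ "sort_key card ys"]) simp
qed

text \<open>Such a triple consists of two vertices of one part and a third vertex anywhere. A part
  has at most \<open>2 * card V / card \<P>\<close> vertices, which leaves at most
  \<open>2 * card V ^ 3 / card \<P>\<close> triples.\<close>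

lemma card_noncrossing_triples:
  fixes \<epsilon> :: real
  assumes P: "equipartition V \<P>" and fin: "finite V" and t: "2 \<le> \<epsilon> * card \<P>"
  shows "card {e \<in> nsets V 3. \<exists>X\<in>\<P>. \<exists>x\<in>X. \<exists>y\<in>X. x \<noteq> y \<and> {x, y} \<subseteq> e} \<le> \<epsilon> * real (card V) ^ 3"
proof -
  have part: "partition_on V \<P>" using P by (simp add: equipartition_def)
  have finP: "finite \<P>" using finite_elements[OF fin part] .
  have t0: "0 < card \<P>" using t by (cases "card \<P> = 0") auto
  have finX: "finite X" "X \<subseteq> V" if "X \<in> \<P>" for X
    using partition_onD1[OF part] that fin by (auto intro: finite_subset)
  have sumP: "(\<Sum>X\<in>\<P>. card X) = card V" by (rule sum_card_partition_on[OF part fin])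
  have "card \<P> = (\<Sum>X\<in>\<P>. 1)" by simp
  also have "\<dots> \<le> (\<Sum>X\<in>\<P>. card X)"
    using finX partition_onD3[OF part] by (intro sum_mono) (metis One_nat_def Suc_leI card_gt_0_iff)
  finally have tn: "card \<P> \<le> card V" by (simp add: sumP)
  have "{e \<in> nsets V 3. \<exists>X\<in>\<P>. \<exists>x\<in>X. \<exists>y\<in>X. x \<noteq> y \<and> {x, y} \<subseteq> e}
      \<subseteq> (\<Union>X\<in>\<P>. (\<lambda>(x, y, z). {x, y, z}) ` (X \<times> X \<times> V))"
  proof clarify
    fix e X x y assume e: "e \<in> nsets V 3" and X: "X \<in> \<P>" "x \<in> X" "y \<in> X" "x \<noteq> y" "{x, y} \<subseteq> e"
    have "card e = 3" "finite e" "e \<subseteq> V" using e by (auto simp: nsets_def)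
    then have "card (e - {x, y}) = 1" using X by (simp add: card_Diff_subset)
    then obtain z where z: "e - {x, y} = {z}" by (rule card_1_singletonE)
    then have "e = {x, y, z}" "z \<in> V" using X \<open>e \<subseteq> V\<close> by blast+
    then show "e \<in> (\<Union>X\<in>\<P>. (\<lambda>(x, y, z). {x, y, z}) ` (X \<times> X \<times> V))"
      using X by (intro UN_I[of X] image_eqI[of _ _ "(x, y, z)"]) auto
  qed
  then have "card {e \<in> nsets V 3. \<exists>X\<in>\<P>. \<exists>x\<in>X. \<exists>y\<in>X. x \<noteq> y \<and> {x, y} \<subseteq> e}
      \<le> card (\<Union>X\<in>\<P>. (\<lambda>(x, y, z). {x, y, z}) ` (X \<times> X \<times> V))"
    by (rule card_mono[rotated]) (use finP finX fin in auto)
  also have "\<dots> \<le> (\<Sum>X\<in>\<P>. card ((\<lambda>(x, y, z). {x, y, z}) ` (X \<times> X \<times> V)))" by (rule card_UN_le[OF finP])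
  also have "\<dots> \<le> (\<Sum>X\<in>\<P>. card (X \<times> X \<times> V))"
    by (intro sum_mono card_image_le) (use finX fin in auto)
  also have "\<dots> = (\<Sum>X\<in>\<P>. card X * card X) * card V" by (simp add: card_cartesian_product sum_distrib_right mult.assoc)
  finally have "card \<P> * card {e \<in> nsets V 3. \<exists>X\<in>\<P>. \<exists>x\<in>X. \<exists>y\<in>X. x \<noteq> y \<and> {x, y} \<subseteq> e}
      \<le> card \<P> * ((\<Sum>X\<in>\<P>. card X * card X) * card V)" by simp
  also have "\<dots> = (\<Sum>X\<in>\<P>. (card \<P> * card X) * card X) * card V" by (simp add: sum_distrib_left mult.assoc)
  also have "\<dots> \<le> (\<Sum>X\<in>\<P>. (2 * card V) * card X) * card V"
  proof (intro mult_right_mono sum_mono)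
    fix X assume "X \<in> \<P>"
    then have "card \<P> * card X \<le> card V + card \<P>" by (rule equipartition_card_le[OF P fin])
    then show "card \<P> * card X \<le> 2 * card V" using tn by linarith
  qed auto
  also have "\<dots> = 2 * card V ^ 3" unfolding sum_distrib_left[symmetric] sumP by (simp add: power3_eq_cube)
  finally have "real (card \<P> * card {e \<in> nsets V 3. \<exists>X\<in>\<P>. \<exists>x\<in>X. \<exists>y\<in>X. x \<noteq> y \<and> {x, y} \<subseteq> e}) \<le> real (2 * card V ^ 3)"
    by (rule of_nat_mono)
  then have "real (card \<P>) * card {e \<in> nsets V 3. \<exists>X\<in>\<P>. \<exists>x\<in>X. \<exists>y\<in>X. x \<noteq> y \<and> {x, y} \<subseteq> e} \<le> 2 * real (card V) ^ 3"
    by simp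
  also have "\<dots> \<le> (\<epsilon> * card \<P>) * real (card V) ^ 3" using t by (intro mult_right_mono) auto
  finally have "real (card \<P>) * card {e \<in> nsets V 3. \<exists>X\<in>\<P>. \<exists>x\<in>X. \<exists>y\<in>X. x \<noteq> y \<and> {x, y} \<subseteq> e}
      \<le> real (card \<P>) * (\<epsilon> * real (card V) ^ 3)" by (simp add: mult_ac)
  then show ?thesis using t0 by simp
qed

text \<open>All colour classes are quasirandom of density \<open>1 / l\<close>, so every crossing
  triple is unexceptional for \<open>decomposition\<close>, and the regularity of the triads follows
  from the homogeneity of the triples of parts.\<close>

lemma decomposition_of_homogeneous_equipartition:
  fixes \<epsilon>1 \<epsilon> \<delta> :: real
  assumes P: "equipartition V \<P>" and finV: "finite V" and t: "2 \<le> \<epsilon>1 * card \<P>" and l: "0 < l"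
    and \<delta>: "\<delta> \<le> \<epsilon>1 * (1 / real l) ^ 3"
    and hom: "\<And>X Y Z. X \<in> \<P> \<Longrightarrow> Y \<in> \<P> \<Longrightarrow> Z \<in> \<P> \<Longrightarrow> X \<noteq> Y \<Longrightarrow> X \<noteq> Z \<Longrightarrow> Y \<noteq> Z \<Longrightarrow> homogeneous_triple F \<delta> X Y Z"
    and col: "\<And>X Y. X \<in> \<P> \<Longrightarrow> Y \<in> \<P> \<Longrightarrow> \<exists>col. quasirandom_colouring l (\<epsilon> / 2) X Y col"
  shows "\<exists>Vs P. decomposition (card \<P>) l \<epsilon>1 \<epsilon> V Vs P \<and> all_triads_disc23 (card \<P>) l \<epsilon>1 \<epsilon> F Vs P"
proof -
  have part: "partition_on V \<P>" using P by (simp add: equipartition_def)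
  have finP: "finite \<P>" using finite_elements[OF finV part] .
  define t where "t = card \<P>"
  have t0: "0 < t" using t by (cases "card \<P> = 0") (auto simp: t_def)
  obtain xs where xs: "distinct xs" "set xs = \<P>" "sorted (map card xs)" using exists_sorted_by_card[OF finP] by blast
  have len: "length xs = t" using xs distinct_card by (fastforce simp: t_def)
  \<comment> \<open>The list \<open>xs\<close> is ordered by size and indexed from 0, the parts of a
    decomposition from 1.\<close>
  define Vs where "Vs i = xs ! (i - 1)" for i
  have VsP: "Vs i \<in> \<P>" if "i \<in> {1..t}" for i using that len xs(2) by (auto simp: Vs_def)
  have Vs_inj: "Vs i \<noteq> Vs j" if "i \<in> {1..t}" "j \<in> {1..t}" "i \<noteq> j" for i j
    using that len xs(1) by (auto simp: Vs_def nth_eq_iff_index_eq)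
  have Vs_surj: "\<exists>i\<in>{1..t}. X = Vs i" if "X \<in> \<P>" for X
  proof -
    have "X \<in> set xs" using that xs(2) by simp
    then obtain n where "n < length xs" "X = xs ! n" unfolding in_set_conv_nth by blast
    then show ?thesis using len by (intro bexI[of _ "Suc n"]) (auto simp: Vs_def)
  qed
  have Vs_disj: "Vs i \<inter> Vs j = {}" if "i \<in> {1..t}" "j \<in> {1..t}" "i \<noteq> j" for i j
    using partition_onD2[OF part] VsP Vs_inj that by (simp add: disjoint_def)
  have Vs_fin: "finite (Vs i)" and Vs_ne: "Vs i \<noteq> {}" if "i \<in> {1..t}" for i
    using VsP[OF that] partition_onD1[OF part] partition_onD3[OF part] finV by (auto intro: finite_subset)
  have Vs_un: "(\<Union>i\<in>{1..t}. Vs i) = V"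
    using partition_onD1[OF part] VsP Vs_surj by blast
  obtain C where C: "\<And>X Y. X \<in> \<P> \<Longrightarrow> Y \<in> \<P> \<Longrightarrow> quasirandom_colouring l (\<epsilon> / 2) X Y (C X Y)"
  proof -
    have "\<forall>X Y. \<exists>c. X \<in> \<P> \<longrightarrow> Y \<in> \<P> \<longrightarrow> quasirandom_colouring l (\<epsilon> / 2) X Y c"
      using col by blast
    from this[unfolded choice_iff] obtain f where
      f: "\<forall>X Y. X \<in> \<P> \<longrightarrow> Y \<in> \<P> \<longrightarrow> quasirandom_colouring l (\<epsilon> / 2) X Y (f X Y)"
      by (elim exE)
    show ?thesis by (rule that[of f], rule f[THEN spec, THEN spec, THEN mp, THEN mp])
  qed
  define E where "E X Y \<alpha> = {{x, y} | x y. x \<in> X \<and> y \<in> Y \<and> C X Y x y = \<alpha>}" for X Y \<alpha>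
  \<comment> \<open>The classes are indexed by unordered pairs, but the colouring
    \<open>C X Y\<close> is oriented; the part with the smaller index comes first.\<close>
  define Pc where "Pc e = E (Vs (Min e)) (Vs (Max e))" for e
  have part_less: "indexed_partition (K2 (Vs i) (Vs j)) {1..l} (Pc {i, j})"
    and dens_less: "\<alpha> \<in> {1..l} \<Longrightarrow> disc2_density (Vs i) (Vs j) (Pc {i, j} \<alpha>) \<epsilon> (1 / real l)"
    if ij: "i \<in> {1..t}" "j \<in> {1..t}" "i < j" for i j \<alpha>
  proof -
    have Pc: "Pc {i, j} = E (Vs i) (Vs j)" using ij by (simp add: Pc_def)
    have disj: "Vs i \<inter> Vs j = {}" using Vs_disj ij by simp
    note C' = C[OF VsP[OF ij(1)] VsP[OF ij(2)], unfolded quasirandom_colouring_def]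
    have "disjoint_family_on (E (Vs i) (Vs j)) {1..l}"
      unfolding disjoint_family_on_def
    proof (intro ballI impI, rule ccontr)
      fix \<alpha> \<beta> assume "\<alpha> \<noteq> \<beta>" "E (Vs i) (Vs j) \<alpha> \<inter> E (Vs i) (Vs j) \<beta> \<noteq> {}"
      then obtain x y x' y' where xy: "x \<in> Vs i" "y \<in> Vs j" "x' \<in> Vs i" "y' \<in> Vs j" "{x, y} = {x', y'}"
        "C (Vs i) (Vs j) x y = \<alpha>" "C (Vs i) (Vs j) x' y' = \<beta>" unfolding E_def by blast
      then have "x = x'" "y = y'" using disj by (auto simp: doubleton_eq_iff)
      then show False using xy \<open>\<alpha> \<noteq> \<beta>\<close> by simp
    qed
    moreover have "(\<Union>\<alpha>\<in>{1..l}. E (Vs i) (Vs j) \<alpha>) = K2 (Vs i) (Vs j)"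
    proof (intro equalityI subsetI)
      fix e assume "e \<in> (\<Union>\<alpha>\<in>{1..l}. E (Vs i) (Vs j) \<alpha>)"
      then show "e \<in> K2 (Vs i) (Vs j)" unfolding E_def K2_def using disj by blast
    next
      fix e assume "e \<in> K2 (Vs i) (Vs j)"
      then obtain x y where "e = {x, y}" "x \<in> Vs i" "y \<in> Vs j" unfolding K2_def by blast
      then show "e \<in> (\<Union>\<alpha>\<in>{1..l}. E (Vs i) (Vs j) \<alpha>)"
        unfolding E_def using conjunct1[OF C'] by blast
    qed
    ultimately show "indexed_partition (K2 (Vs i) (Vs j)) {1..l} (Pc {i, j})"
      unfolding indexed_partition_def Pc by blast
    assume "\<alpha> \<in> {1..l}"
    then show "disc2_density (Vs i) (Vs j) (Pc {i, j} \<alpha>) \<epsilon> (1 / real l)"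
      unfolding Pc E_def using conjunct2[OF C'] Vs_fin Vs_ne ij
      by (intro disc2_density_of_colour_class[OF disj]) auto
  qed
  have part_ij: "indexed_partition (K2 (Vs i) (Vs j)) {1..l} (Pc {i, j})"
    if "i \<in> {1..t}" "j \<in> {1..t}" "i \<noteq> j" for i j
    using part_less[of i j] part_less[of j i] that K2_commute[of "Vs i" "Vs j"]
    by (cases "i < j") (auto simp: insert_commute not_less)
  have dens: "disc2_density (Vs i) (Vs j) (Pc {i, j} \<alpha>) \<epsilon> (1 / real l)"
    if "i \<in> {1..t}" "j \<in> {1..t}" "i \<noteq> j" "\<alpha> \<in> {1..l}" for i j \<alpha>
    using dens_less[of i j \<alpha>] dens_less[of j i \<alpha>] that disc2_density_commute[of "Vs i" "Vs j"]
    by (cases "i < j") (auto simp: insert_commute not_less)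
  have sub: "Pc {i, j} \<alpha> \<subseteq> K2 (Vs i) (Vs j)" if "i \<in> {1..t}" "j \<in> {1..t}" "i \<noteq> j" "\<alpha> \<in> {1..l}" for i j \<alpha>
    using part_ij[OF that(1-3)] that(4) unfolding indexed_partition_def by blast
  have cover: "\<exists>\<alpha>\<in>{1..l}. {x, y} \<in> Pc {i, j} \<alpha>" if "i \<in> {1..t}" "j \<in> {1..t}" "i \<noteq> j" "x \<in> Vs i" "y \<in> Vs j" for i j x y
  proof -
    have "{x, y} \<in> K2 (Vs i) (Vs j)" using that Vs_disj[of i j] unfolding K2_def by blast
    then show ?thesis using part_ij[OF that(1-3)] unfolding indexed_partition_def by blast
  qed
  have "decomposition t l \<epsilon>1 \<epsilon> V Vs Pc"
    unfolding decomposition_def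
  proof (intro conjI allI impI ballI)
    show "indexed_partition V {1..t} Vs"
      unfolding indexed_partition_def disjoint_family_on_def using Vs_disj Vs_un by blast
    show "card (Vs i) \<le> card (Vs j)" if "i \<in> {1..t}" "j \<in> {1..t}" "i \<le> j" for i j
    proof -
      have "i - 1 \<le> j - 1" "j - 1 < length (map card xs)" using that len by auto
      then have "map card xs ! (i - 1) \<le> map card xs ! (j - 1)" using xs(3) by (rule sorted_nth_mono[rotated])
      then show ?thesis using that len by (simp add: Vs_def)
    qed
    show "card (Vs t) \<le> card (Vs 1) + 1"
      using P VsP[of t] VsP[of 1] t0 unfolding equipartition_def by auto
    show "indexed_partition (K2 (Vs i) (Vs j)) {1..l} (Pc {i, j})" if "{i, j} \<in> nsets {1..t} 2" for i j
      using part_ij that by simp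
    let ?good = "\<lambda>e. \<exists>x y z i j k \<alpha> \<beta> \<gamma>.
        e = {x, y, z} \<and> {i, j, k} \<in> nsets {1..t} 3 \<and>
        \<alpha> \<in> {1..l} \<and> \<beta> \<in> {1..l} \<and> \<gamma> \<in> {1..l} \<and>
        {x, y} \<in> Pc {i, j} \<alpha> \<and> {x, z} \<in> Pc {i, k} \<beta> \<and> {y, z} \<in> Pc {j, k} \<gamma> \<and>
        disc2_density (Vs i) (Vs j) (Pc {i, j} \<alpha>) \<epsilon> (1 / real l) \<and>
        disc2_density (Vs i) (Vs k) (Pc {i, k} \<beta>) \<epsilon> (1 / real l) \<and>
        disc2_density (Vs j) (Vs k) (Pc {j, k} \<gamma>) \<epsilon> (1 / real l)"
    let ?B = "{e \<in> nsets V 3. \<not> ?good e}"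
    have "?B \<subseteq> {e \<in> nsets V 3. \<exists>X\<in>\<P>. \<exists>x\<in>X. \<exists>y\<in>X. x \<noteq> y \<and> {x, y} \<subseteq> e}"
    proof clarify
      fix e assume e: "e \<in> nsets V 3" and bad: "\<not> ?good e"
      obtain x y z where xyz: "e = {x, y, z}" "x \<in> V" "y \<in> V" "z \<in> V" "x \<noteq> y" "x \<noteq> z" "y \<noteq> z"
        using e unfolding nsets_3_eq by blast
      obtain i j k where ijk: "i \<in> {1..t}" "x \<in> Vs i" "j \<in> {1..t}" "y \<in> Vs j" "k \<in> {1..t}" "z \<in> Vs k"
        using xyz Vs_un by blast
      have "i = j \<or> i = k \<or> j = k"
      proof (rule ccontr)
        assume "\<not> ?thesis"
        then have ne: "i \<noteq> j" "i \<noteq> k" "j \<noteq> k" by auto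
        obtain \<alpha> \<beta> \<gamma> where abc: "\<alpha> \<in> {1..l}" "{x, y} \<in> Pc {i, j} \<alpha>" "\<beta> \<in> {1..l}" "{x, z} \<in> Pc {i, k} \<beta>"
          "\<gamma> \<in> {1..l}" "{y, z} \<in> Pc {j, k} \<gamma>"
          using cover[OF ijk(1,3) ne(1) ijk(2,4)] cover[OF ijk(1,5) ne(2) ijk(2,6)] cover[OF ijk(3,5) ne(3) ijk(4,6)] by blast
        have "{i, j, k} \<in> nsets {1..t} 3" using ijk ne by (simp only: nsets_tripleton) simp
        with bad xyz(1) abc dens[OF ijk(1,3) ne(1) abc(1)] dens[OF ijk(1,5) ne(2) abc(3)] dens[OF ijk(3,5) ne(3) abc(5)]
        show False by blast
      qed
      then show "\<exists>X\<in>\<P>. \<exists>x\<in>X. \<exists>y\<in>X. x \<noteq> y \<and> {x, y} \<subseteq> e"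
      proof (elim disjE)
        assume "i = j"
        then show ?thesis using ijk VsP xyz by (intro bexI[of _ "Vs i"] bexI[of _ x] bexI[of _ y]) auto
      next
        assume "i = k"
        then show ?thesis using ijk VsP xyz by (intro bexI[of _ "Vs i"] bexI[of _ x] bexI[of _ z]) auto
      next
        assume "j = k"
        then show ?thesis using ijk VsP xyz by (intro bexI[of _ "Vs j"] bexI[of _ y] bexI[of _ z]) auto
      qed
    qed
    then have "card ?B \<le> card {e \<in> nsets V 3. \<exists>X\<in>\<P>. \<exists>x\<in>X. \<exists>y\<in>X. x \<noteq> y \<and> {x, y} \<subseteq> e}"
      by (rule card_mono[rotated]) (simp add: finite_imp_finite_nsets finV)
    then show "real (card ?B) \<le> \<epsilon>1 * real (card V) ^ 3"
      using card_noncrossing_triples[OF P finV t] by linarith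
  qed
  moreover have "all_triads_disc23 t l \<epsilon>1 \<epsilon> F Vs Pc"
    unfolding all_triads_disc23_def Let_def
  proof (intro allI impI ballI)
    fix i j k \<alpha> \<beta> \<gamma>
    assume "{i, j, k} \<in> nsets {1..t} 3" and abc: "\<alpha> \<in> {1..l}" "\<beta> \<in> {1..l}" "\<gamma> \<in> {1..l}"
    then have ijk: "i \<in> {1..t}" "j \<in> {1..t}" "k \<in> {1..t}" "i \<noteq> j" "i \<noteq> k" "j \<noteq> k"
      unfolding nsets_tripleton by blast+
    define G where "G = triad_edges Pc i j k \<alpha> \<beta> \<gamma>"
    note s1 = sub[OF ijk(1,2,4) abc(1)] and s2 = sub[OF ijk(1,3,5) abc(2)] and s3 = sub[OF ijk(2,3,6) abc(3)]
    have disj: "Vs i \<inter> Vs j = {}" "Vs i \<inter> Vs k = {}" "Vs j \<inter> Vs k = {}" using Vs_disj ijk by auto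
    note K = K2_Int_K2_empty[OF disj]
    have G1: "G \<inter> K2 (Vs i) (Vs j) = Pc {i, j} \<alpha>" and G2: "G \<inter> K2 (Vs i) (Vs k) = Pc {i, k} \<beta>"
      and G3: "G \<inter> K2 (Vs j) (Vs k) = Pc {j, k} \<gamma>"
      unfolding G_def triad_edges_def using s1 s2 s3 K by blast+
    have "disc23 (Vs i) (Vs j) (Vs k) (F \<inter> triangles G) G \<epsilon>1 \<epsilon>"
    proof (rule disc23_of_homogeneous_triple[OF disj])
      show "G \<subseteq> K2 (Vs i) (Vs j) \<union> K2 (Vs i) (Vs k) \<union> K2 (Vs j) (Vs k)"
        unfolding G_def triad_edges_def using s1 s2 s3 by blast
      show "homogeneous_triple F \<delta> (Vs i) (Vs j) (Vs k)" by (intro hom VsP Vs_inj ijk)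
      show "\<delta> \<le> \<epsilon>1 * (1 / real l) ^ 3" by (rule \<delta>)
    qed (use l dens ijk abc Vs_fin in \<open>simp_all only: G1 G2 G3\<close>, simp_all)
    then show "disc23 (Vs i) (Vs j) (Vs k) (F \<inter> triangles (triad_edges Pc i j k \<alpha> \<beta> \<gamma>)) (triad_edges Pc i j k \<alpha> \<beta> \<gamma>) \<epsilon>1 \<epsilon>"
      by (simp only: G_def)
  qed
  ultimately show ?thesis unfolding t_def by blast
qed

text \<open>The prescribed lower bound \<open>l0\<close> itself is taken as the number of colours.
  Thus \<open>\<epsilon>2\<close> is evaluated only at \<open>l0\<close>, and the homogeneity needed
  for triads of density \<open>1 / l0\<close> is fixed before the partition is chosen.\<close>

lemma zero_vdisc3_error_imp_zero_disc23_error: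
  assumes her: "hereditary_property \<H>" and zero: "zero_vdisc3_error \<H>"
  shows "zero_disc23_error \<H>"
  unfolding zero_disc23_error_def
proof (intro allI impI)
  fix t0 l0 :: nat and \<epsilon>1 :: real and \<epsilon>2 :: "nat \<Rightarrow> real"
  assume t0: "1 \<le> t0" and l0: "1 \<le> l0" and \<epsilon>1: "0 < \<epsilon>1" and \<epsilon>2: "\<forall>n. 0 < \<epsilon>2 n \<and> \<epsilon>2 n \<le> 1"
  define \<delta> where "\<delta> = min (1 / 2) (\<epsilon>1 * (1 / real l0) ^ 3)"
  have \<delta>: "0 < \<delta>" "\<delta> < 1" "\<delta> \<le> \<epsilon>1 * (1 / real l0) ^ 3" using \<epsilon>1 l0 by (auto simp: \<delta>_def)
  \<comment> \<open>With at least \<open>2 / \<epsilon>1\<close> parts, the non-crossing triples fit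
    into the exceptional set of a decomposition.\<close>
  obtain t1 :: nat where t1: "2 / \<epsilon>1 \<le> t1" using real_arch_simple by blast
  have l0': "0 < l0" and e2: "0 < \<epsilon>2 l0 / 2" using l0 \<epsilon>2 by auto
  obtain m0 where m0: "0 < m0" and colour: "\<forall>(U::'a set) (W::'a set). finite U \<longrightarrow> finite W \<longrightarrow> m0 \<le> card U \<longrightarrow> m0 \<le> card W \<longrightarrow>
    (\<exists>col. quasirandom_colouring l0 (\<epsilon>2 l0 / 2) U W col)"
    using exists_quasirandom_colouring[OF l0' e2, where ?'b = 'a and ?'c = 'a] by (elim exE conjE) rule
  have "1 \<le> max t0 t1" using t0 by simp
  from zero_vdisc3_error_homogeneous[OF her zero \<delta>(1,2) this]
  obtain T N where TN: "\<forall>(V, F)\<in>\<H>. N \<le> card V \<longrightarrow>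
    (\<exists>\<P>. equipartition V \<P> \<and> max t0 t1 \<le> card \<P> \<and> card \<P> \<le> T \<and>
      (\<forall>X\<in>\<P>. \<forall>Y\<in>\<P>. \<forall>Z\<in>\<P>. X \<noteq> Y \<longrightarrow> X \<noteq> Z \<longrightarrow> Y \<noteq> Z \<longrightarrow> homogeneous_triple F \<delta> X Y Z))"
    by blast
  show "\<exists>N T L. \<forall>(V, F)\<in>\<H>. N \<le> card V \<longrightarrow>
          (\<exists>t l Vs P. t0 \<le> t \<and> t \<le> T \<and> l0 \<le> l \<and> l \<le> L \<and>
             decomposition t l \<epsilon>1 (\<epsilon>2 l) V Vs P \<and>
             all_triads_disc23 t l \<epsilon>1 (\<epsilon>2 l) F Vs P)"
  proof (rule exI[of _ "N + T * (m0 + 1)"], rule exI[of _ T], rule exI[of _ l0], clarify)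
    fix V F assume H: "(V, F) \<in> \<H>" and large: "N + T * (m0 + 1) \<le> card V"
    have finV: "finite V" using her H by (auto simp: hereditary_property_def finite_three_graph_def)
    have "N \<le> card V" using large by simp
    then obtain \<P> where P: "equipartition V \<P>" "max t0 t1 \<le> card \<P>" "card \<P> \<le> T"
      and hom: "\<forall>X\<in>\<P>. \<forall>Y\<in>\<P>. \<forall>Z\<in>\<P>. X \<noteq> Y \<longrightarrow> X \<noteq> Z \<longrightarrow> Y \<noteq> Z \<longrightarrow> homogeneous_triple F \<delta> X Y Z"
      using TN H by fast
    have part: "partition_on V \<P>" using P by (simp add: equipartition_def)
    have finX: "finite X" if "X \<in> \<P>" for X using partition_onD1[OF part] that finV by (auto intro: finite_subset)
    have size: "m0 \<le> card X" if "X \<in> \<P>" for X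
    proof -
      have "T * (m0 + 1) \<le> card \<P> * (card X + 1)" using equipartition_card_ge[OF P(1) finV that] large by simp
      also have "\<dots> \<le> T * (card X + 1)" using P by (intro mult_right_mono) auto
      finally have "m0 + 1 \<le> card X + 1" using P t0 by (simp only: mult_le_cancel1)
      then show ?thesis by simp
    qed
    have "real t1 \<le> card \<P>" using P by simp
    then have "2 / \<epsilon>1 \<le> card \<P>" using t1 by linarith
    then have t2: "2 \<le> \<epsilon>1 * card \<P>" using \<epsilon>1 by (simp add: field_simps)
    have "\<exists>Vs P. decomposition (card \<P>) l0 \<epsilon>1 (\<epsilon>2 l0) V Vs P \<and> all_triads_disc23 (card \<P>) l0 \<epsilon>1 (\<epsilon>2 l0) F Vs P"
    proof (rule decomposition_of_homogeneous_equipartition[OF P(1) finV t2 l0' \<delta>(3)])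
      show "homogeneous_triple F \<delta> X Y Z" if "X \<in> \<P>" "Y \<in> \<P>" "Z \<in> \<P>" "X \<noteq> Y" "X \<noteq> Z" "Y \<noteq> Z" for X Y Z
        using hom that by blast
      fix X Y assume XY: "X \<in> \<P>" "Y \<in> \<P>"
      show "\<exists>col. quasirandom_colouring l0 (\<epsilon>2 l0 / 2) X Y col"
        by (rule colour[THEN spec, THEN spec, THEN mp, THEN mp, THEN mp, THEN mp]) (intro finX size XY)+
    qed
    then obtain Vs Pc where "decomposition (card \<P>) l0 \<epsilon>1 (\<epsilon>2 l0) V Vs Pc" "all_triads_disc23 (card \<P>) l0 \<epsilon>1 (\<epsilon>2 l0) F Vs Pc"
      by (elim exE conjE)
    then show "\<exists>t l Vs P. t0 \<le> t \<and> t \<le> T \<and> l0 \<le> l \<and> l \<le> l0 \<and>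
             decomposition t l \<epsilon>1 (\<epsilon>2 l) V Vs P \<and> all_triads_disc23 t l \<epsilon>1 (\<epsilon>2 l) F Vs P"
      using P by (intro exI[of _ "card \<P>"] exI[of _ l0]) auto
  qed
qed

section \<open>Counting triangles in triads\<close>

lemma sum_filter_of_bool:
  fixes f :: "'b \<Rightarrow> real"
  shows "finite A \<Longrightarrow> (\<Sum>x\<in>{x\<in>A. P x}. f x) = (\<Sum>x\<in>A. f x * of_bool (P x))"
  by (simp add: sum.inter_filter of_bool_def if_distrib cong: if_cong)

text \<open>Telescoping: with \<open>a\<close>, \<open>b\<close>, \<open>c\<close> for the three
  indicators, \<open>a*b*c - p1*p2*p3 = (a - p1)*b*c + p1*(b - p2)*c + p1*p2*(c - p3)\<close>. For
  fixed \<open>z\<close> the first term is summed over a box of neighbours of \<open>z\<close>; for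
  fixed \<open>y\<close> the second is summed over \<open>U\<close> and the neighbours of
  \<open>y\<close>; the third is a plain box sum. Each term costs one \<epsilon>.\<close>

lemma triangle_counting:
  fixes p1 p2 p3 \<epsilon> :: real
  assumes fin: "finite A" "finite B" "finite C" and sub: "U \<subseteq> A" "W \<subseteq> B" "Z \<subseteq> C"
    and p: "0 \<le> p1" "p1 \<le> 1" "0 \<le> p2" "p2 \<le> 1" and \<epsilon>: "0 \<le> \<epsilon>"
    and a: "\<And>U' W'. U' \<subseteq> A \<Longrightarrow> W' \<subseteq> B \<Longrightarrow> \<bar>\<Sum>x\<in>U'. \<Sum>y\<in>W'. of_bool (a x y) - p1\<bar> \<le> \<epsilon> * (real (card A) * card B)"
    and b: "\<And>U' Z'. U' \<subseteq> A \<Longrightarrow> Z' \<subseteq> C \<Longrightarrow> \<bar>\<Sum>x\<in>U'. \<Sum>z\<in>Z'. of_bool (b x z) - p2\<bar> \<le> \<epsilon> * (real (card A) * card C)"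
    and c: "\<And>W' Z'. W' \<subseteq> B \<Longrightarrow> Z' \<subseteq> C \<Longrightarrow> \<bar>\<Sum>y\<in>W'. \<Sum>z\<in>Z'. of_bool (c y z) - p3\<bar> \<le> \<epsilon> * (real (card B) * card C)"
  shows "\<bar>(\<Sum>x\<in>U. \<Sum>y\<in>W. \<Sum>z\<in>Z. of_bool (a x y \<and> b x z \<and> c y z)) - p1 * p2 * p3 * (real (card U) * card W * card Z)\<bar>
    \<le> 3 * \<epsilon> * (real (card A) * card B * card C)"
proof -
  let ?P = "real (card A) * card B * card C"
  have finU: "finite U" "finite W" "finite Z" using sub fin by (auto intro: finite_subset)
  have le: "card U \<le> card A" "card W \<le> card B" "card Z \<le> card C" using sub fin by (auto intro: card_mono)
  define S1 where "S1 = (\<Sum>z\<in>Z. \<Sum>x\<in>{x\<in>U. b x z}. \<Sum>y\<in>{y\<in>W. c y z}. of_bool (a x y) - p1)"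
  define S2 where "S2 = (\<Sum>y\<in>W. \<Sum>x\<in>U. \<Sum>z\<in>{z\<in>Z. c y z}. of_bool (b x z) - p2)"
  define S3 where "S3 = (\<Sum>y\<in>W. \<Sum>z\<in>Z. of_bool (c y z) - p3)"
  have e1: "S1 = (\<Sum>x\<in>U. \<Sum>y\<in>W. \<Sum>z\<in>Z. (of_bool (a x y) - p1) * of_bool (b x z) * of_bool (c y z))"
  proof -
    have "S1 = (\<Sum>z\<in>Z. \<Sum>x\<in>U. \<Sum>y\<in>W. (of_bool (a x y) - p1) * of_bool (b x z) * of_bool (c y z))"
      unfolding S1_def sum_filter_of_bool[OF finU(1)] sum_filter_of_bool[OF finU(2)]
      by (intro sum.cong refl, subst sum_distrib_right) (intro sum.cong refl, simp add: mult_ac)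
    also have "\<dots> = (\<Sum>x\<in>U. \<Sum>z\<in>Z. \<Sum>y\<in>W. (of_bool (a x y) - p1) * of_bool (b x z) * of_bool (c y z))"
      by (rule sum.swap)
    also have "\<dots> = (\<Sum>x\<in>U. \<Sum>y\<in>W. \<Sum>z\<in>Z. (of_bool (a x y) - p1) * of_bool (b x z) * of_bool (c y z))"
      by (rule sum.cong[OF refl], rule sum.swap)
    finally show ?thesis .
  qed
  have e2: "S2 = (\<Sum>x\<in>U. \<Sum>y\<in>W. \<Sum>z\<in>Z. (of_bool (b x z) - p2) * of_bool (c y z))"
  proof -
    have "S2 = (\<Sum>y\<in>W. \<Sum>x\<in>U. \<Sum>z\<in>Z. (of_bool (b x z) - p2) * of_bool (c y z))"
      unfolding S2_def sum_filter_of_bool[OF finU(3)] by simp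
    also have "\<dots> = (\<Sum>x\<in>U. \<Sum>y\<in>W. \<Sum>z\<in>Z. (of_bool (b x z) - p2) * of_bool (c y z))" by (rule sum.swap)
    finally show ?thesis .
  qed
  have "(\<Sum>x\<in>U. \<Sum>y\<in>W. \<Sum>z\<in>Z. of_bool (a x y \<and> b x z \<and> c y z)) - p1 * p2 * p3 * (real (card U) * card W * card Z)
      = (\<Sum>x\<in>U. \<Sum>y\<in>W. \<Sum>z\<in>Z. of_bool (a x y \<and> b x z \<and> c y z) - p1 * p2 * p3)"
    by (simp add: sum_subtractf)
  also have "\<dots> = (\<Sum>x\<in>U. \<Sum>y\<in>W. \<Sum>z\<in>Z. (of_bool (a x y) - p1) * of_bool (b x z) * of_bool (c y z)
      + p1 * ((of_bool (b x z) - p2) * of_bool (c y z)) + p1 * p2 * (of_bool (c y z) - p3))"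
    by (intro sum.cong refl) (auto simp: of_bool_def algebra_simps)
  also have "\<dots> = S1 + p1 * S2 + p1 * p2 * (card U * S3)"
    unfolding e1 e2 S3_def by (simp add: sum.distrib sum_distrib_left mult_ac)
  finally have eq: "(\<Sum>x\<in>U. \<Sum>y\<in>W. \<Sum>z\<in>Z. of_bool (a x y \<and> b x z \<and> c y z)) - p1 * p2 * p3 * (real (card U) * card W * card Z)
      = S1 + p1 * S2 + p1 * p2 * (card U * S3)" .
  have "\<bar>S1\<bar> \<le> (\<Sum>z\<in>Z. \<epsilon> * (real (card A) * card B))"
    unfolding S1_def by (rule order_trans[OF sum_abs], rule sum_mono, rule a) (use sub in auto)
  also have "\<dots> = card Z * (\<epsilon> * (real (card A) * card B))" by simp
  also have "\<dots> \<le> card C * (\<epsilon> * (real (card A) * card B))" using le \<epsilon> by (intro mult_right_mono) auto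
  finally have b1: "\<bar>S1\<bar> \<le> \<epsilon> * ?P" by (simp add: mult_ac)
  have "\<bar>S2\<bar> \<le> (\<Sum>y\<in>W. \<epsilon> * (real (card A) * card C))"
    unfolding S2_def by (rule order_trans[OF sum_abs], rule sum_mono, rule b) (use sub in auto)
  also have "\<dots> = card W * (\<epsilon> * (real (card A) * card C))" by simp
  also have "\<dots> \<le> card B * (\<epsilon> * (real (card A) * card C))" using le \<epsilon> by (intro mult_right_mono) auto
  finally have b2: "\<bar>S2\<bar> \<le> \<epsilon> * ?P" by (simp add: mult_ac)
  have "\<bar>S3\<bar> \<le> \<epsilon> * (real (card B) * card C)" unfolding S3_def by (rule c) (use sub in auto)
  then have "card U * \<bar>S3\<bar> \<le> card A * (\<epsilon> * (real (card B) * card C))" using le \<epsilon> by (intro mult_mono) auto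
  then have b3: "\<bar>card U * S3\<bar> \<le> \<epsilon> * ?P" by (simp add: abs_mult mult_ac)
  have "\<bar>p1 * S2\<bar> \<le> 1 * (\<epsilon> * ?P)" unfolding abs_mult using p b2 by (intro mult_mono) auto
  moreover have "\<bar>p1 * p2 * (card U * S3)\<bar> \<le> 1 * (\<epsilon> * ?P)"
    unfolding abs_mult[of "p1 * p2"] using p b3 by (intro mult_mono) (auto simp: abs_mult mult_le_one)
  ultimately show ?thesis unfolding eq using b1 by linarith
qed

lemma disc2_sum:
  assumes disj: "A \<inter> B = {}" and fin: "finite A" "finite B" and d: "disc2 A B E \<epsilon>" and sub: "U \<subseteq> A" "W \<subseteq> B"
  shows "\<bar>\<Sum>x\<in>U. \<Sum>y\<in>W. of_bool ({x, y} \<in> E) - card E / (real (card A) * card B)\<bar> \<le> \<epsilon> * (real (card A) * card B)"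
proof -
  have finU: "finite U" "finite W" using sub fin by (auto intro: finite_subset)
  have "card (E \<inter> K2 U W) = (\<Sum>x\<in>U. card {y\<in>W. {x, y} \<in> E})"
    by (rule card_Int_K2) (use disj sub finU in auto)
  then have "real (card (E \<inter> K2 U W)) = (\<Sum>x\<in>U. \<Sum>y\<in>W. of_bool ({x, y} \<in> E))"
    by (simp only: of_nat_sum sum_of_bool_card[OF finU(2)])
  then have "(\<Sum>x\<in>U. \<Sum>y\<in>W. of_bool ({x, y} \<in> E) - card E / (real (card A) * card B))
      = real (card (E \<inter> K2 U W)) - card E / (real (card A) * card B) * card U * card W"
    by (simp add: sum_subtractf)
  then show ?thesis using d sub unfolding disc2_def Let_def by (simp add: mult.assoc)
qed

text \<open>This turns a box, as tested by \<open>vdisc3\<close>, into a subgraph, as tested by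
  \<open>disc23\<close>: only the edges inside the box are kept.\<close>

lemma triangles_restrict:
  assumes "U \<inter> W = {}" "U \<inter> Z = {}" "W \<inter> Z = {}"
  shows "triangles {e\<in>G. e \<in> K2 U W \<union> K2 U Z \<union> K2 W Z} = triangles G \<inter> K3 U W Z"
proof (intro equalityI subsetI IntI)
  fix e assume e: "e \<in> triangles {e\<in>G. e \<in> K2 U W \<union> K2 U Z \<union> K2 W Z}"
  show "e \<in> triangles G" using e triangles_mono[of "{e\<in>G. e \<in> K2 U W \<union> K2 U Z \<union> K2 W Z}" G] by blast
  show "e \<in> K3 U W Z"
    using e triangles_subset_K3[OF assms, of "{e\<in>G. e \<in> K2 U W \<union> K2 U Z \<union> K2 W Z}"] by blast
next
  fix e assume e: "e \<in> triangles G \<inter> K3 U W Z"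
  then obtain x y z where xyz: "e = {x, y, z}" "x \<in> U" "y \<in> W" "z \<in> Z" "x \<noteq> y" "x \<noteq> z" "y \<noteq> z"
    unfolding K3_def by blast
  have K: "{x, y} \<in> K2 U W" "{x, z} \<in> K2 U Z" "{y, z} \<in> K2 W Z" using xyz unfolding K2_def by blast+
  have "{x, y} \<in> G \<and> {x, z} \<in> G \<and> {y, z} \<in> G"
    using e mem_triangles_iff[OF xyz(5-7), of G] unfolding xyz(1) by simp
  then show "e \<in> triangles {e\<in>G. e \<in> K2 U W \<union> K2 U Z \<union> K2 W Z}"
    unfolding xyz(1) mem_triangles_iff[OF xyz(5-7)] using K by simp
qed

lemma sum_triple_product:
  fixes f g h :: "nat \<Rightarrow> real"
  shows "(\<Sum>(\<alpha>, \<beta>, \<gamma>)\<in>I \<times> J \<times> K. f \<alpha> * g \<beta> * h \<gamma>) = sum f I * sum g J * sum h K"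
proof -
  have "(\<Sum>(\<alpha>, \<beta>, \<gamma>)\<in>I \<times> J \<times> K. f \<alpha> * g \<beta> * h \<gamma>) = (\<Sum>\<alpha>\<in>I. \<Sum>(\<beta>, \<gamma>)\<in>J \<times> K. f \<alpha> * (g \<beta> * h \<gamma>))"
    by (simp add: sum.cartesian_product case_prod_unfold mult.assoc)
  also have "\<dots> = (\<Sum>\<alpha>\<in>I. f \<alpha> * (\<Sum>\<beta>\<in>J. \<Sum>\<gamma>\<in>K. g \<beta> * h \<gamma>))"
    by (simp add: sum.cartesian_product sum_distrib_left case_prod_unfold)
  also have "\<dots> = sum f I * (sum g J * sum h K)" by (simp only: sum_product[symmetric] sum_distrib_right)
  finally show ?thesis by (simp add: mult.assoc)
qed

lemma sum_density_indexed_partition: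
  assumes "indexed_partition (K2 A B) {1..l} Q" "A \<inter> B = {}" "finite A" "finite B" "A \<noteq> {}" "B \<noteq> {}"
  shows "(\<Sum>\<alpha>\<in>{1..l}. card (Q \<alpha>) / (real (card A) * card B)) = 1"
proof -
  have fin: "finite (Q \<alpha>)" if "\<alpha> \<in> {1..l}" for \<alpha>
    using assms that finite_K2[of A B] unfolding indexed_partition_def by (metis UN_upper finite_subset)
  have "card (K2 A B) = card (\<Union>\<alpha>\<in>{1..l}. Q \<alpha>)" using assms(1) by (simp add: indexed_partition_def)
  also have "\<dots> = (\<Sum>\<alpha>\<in>{1..l}. card (Q \<alpha>))"
    by (rule card_UN_disjoint) (use assms(1) fin in \<open>auto simp: indexed_partition_def disjoint_family_on_def\<close>)
  finally have eq: "(\<Sum>\<alpha>\<in>{1..l}. real (card (Q \<alpha>))) = real (card A) * card B"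
    using card_K2[of A B] assms by (simp flip: of_nat_mult of_nat_sum)
  have "real (card A) * card B \<noteq> 0" using assms by simp
  then show ?thesis unfolding sum_divide_distrib[symmetric] eq by (rule divide_self)
qed

text \<open>Every crossing triple is a triangle of exactly one triad. So the edges in a box are
  counted triad by triad, as \<open>d3\<close> times the number of triangles, and that number is
  estimated by triangle counting. The predicted density \<open>D\<close> is the same for all boxes;
  replacing it by the actual density doubles the error.\<close>

lemma vdisc3_of_disc23_triads:
  fixes \<epsilon>1 \<epsilon>2 :: real
  assumes disj: "A \<inter> B = {}" "A \<inter> C = {}" "B \<inter> C = {}" and fin: "finite A" "finite B" "finite C"
    and ne: "A \<noteq> {}" "B \<noteq> {}" "C \<noteq> {}"
    and Q: "indexed_partition (K2 A B) {1..l} Q1" "indexed_partition (K2 A C) {1..l} Q2"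
      "indexed_partition (K2 B C) {1..l} Q3"
    and triads: "\<And>\<alpha> \<beta> \<gamma>. \<alpha> \<in> {1..l} \<Longrightarrow> \<beta> \<in> {1..l} \<Longrightarrow> \<gamma> \<in> {1..l} \<Longrightarrow>
      disc23 A B C (F \<inter> triangles (Q1 \<alpha> \<union> Q2 \<beta> \<union> Q3 \<gamma>)) (Q1 \<alpha> \<union> Q2 \<beta> \<union> Q3 \<gamma>) \<epsilon>1 \<epsilon>2"
    and \<epsilon>: "0 \<le> \<epsilon>1" "0 \<le> \<epsilon>2" "l * \<epsilon>2 \<le> 1"
  shows "vdisc3 A B C (F \<inter> K3 A B C) (2 * (8 * \<epsilon>1 + 3 * real l ^ 3 * \<epsilon>2))"
proof -
  define P where "P = real (card A) * card B * card C"
  have pos: "0 < real (card A)" "0 < real (card B)" "0 < real (card C)" using fin ne by (auto simp: card_gt_0_iff)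
  have P: "0 < P" using pos by (simp add: P_def)
  define I where "I = {1..l} \<times> {1..l} \<times> {1..l}"
  define p1 p2 p3 where "p1 \<alpha> = card (Q1 \<alpha>) / (real (card A) * card B)"
    and "p2 \<beta> = card (Q2 \<beta>) / (real (card A) * card C)" and "p3 \<gamma> = card (Q3 \<gamma>) / (real (card B) * card C)" for \<alpha> \<beta> \<gamma>
  have p_nn: "0 \<le> p1 \<alpha>" "0 \<le> p2 \<alpha>" "0 \<le> p3 \<alpha>" for \<alpha> by (auto simp: p1_def p2_def p3_def)
  have p_sum: "sum p1 {1..l} = 1" "sum p2 {1..l} = 1" "sum p3 {1..l} = 1"
    unfolding p1_def p2_def p3_def by (rule sum_density_indexed_partition; fact)+
  have p_le: "p1 \<alpha> \<le> 1" "p2 \<alpha> \<le> 1" if "\<alpha> \<in> {1..l}" for \<alpha>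
    using member_le_sum[of \<alpha> "{1..l}" p1] member_le_sum[of \<alpha> "{1..l}" p2] that p_nn p_sum by auto
  have Qsub: "Q1 \<alpha> \<subseteq> K2 A B" "Q2 \<alpha> \<subseteq> K2 A C" "Q3 \<alpha> \<subseteq> K2 B C" if "\<alpha> \<in> {1..l}" for \<alpha>
    using Q that unfolding indexed_partition_def by blast+
  define G where "G i = (case i of (\<alpha>, \<beta>, \<gamma>) \<Rightarrow> Q1 \<alpha> \<union> Q2 \<beta> \<union> Q3 \<gamma>)" for i
  define d3 where "d3 i = real (card (F \<inter> triangles (G i))) / real (card (triangles (G i)))" for i
  define \<pi> where "\<pi> i = (case i of (\<alpha>, \<beta>, \<gamma>) \<Rightarrow> p1 \<alpha> * p2 \<beta> * p3 \<gamma>)" for i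
  \<comment> \<open>Bounding each error \<open>\<epsilon>1 * d2 ^ 3\<close> by
    \<open>\<epsilon>1\<close> would lose a factor \<open>l ^ 3\<close>. The witness
    \<open>d2\<close> may differ from triad to triad, but it exceeds each of the three class
    densities by at most \<open>\<epsilon>2\<close>. Since the class densities of each pair sum to
    1, the products \<open>\<pi>'\<close> sum to \<open>(1 + l * \<epsilon>2) ^ 3\<close>, which is
    at most 8.\<close>
  define \<pi>' where "\<pi>' i = (case i of (\<alpha>, \<beta>, \<gamma>) \<Rightarrow> (p1 \<alpha> + \<epsilon>2) * (p2 \<beta> + \<epsilon>2) * (p3 \<gamma> + \<epsilon>2))" for i
  have finK: "finite (K3 A B C)" by (rule finite_K3[OF fin])
  note K = K2_Int_K2_empty[OF disj]
  have triad: "\<bar>real (card (F \<inter> triangles (G i) \<inter> K3 U W Z)) - d3 i * \<pi> i * (real (card U) * card W * card Z)\<bar>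
      \<le> (\<epsilon>1 * \<pi>' i + 3 * \<epsilon>2) * P"
    if i: "i \<in> I" and sub: "U \<subseteq> A" "W \<subseteq> B" "Z \<subseteq> C" for i U W Z
  proof -
    obtain \<alpha> \<beta> \<gamma> where abc: "i = (\<alpha>, \<beta>, \<gamma>)" "\<alpha> \<in> {1..l}" "\<beta> \<in> {1..l}" "\<gamma> \<in> {1..l}" using i by (auto simp: I_def)
    have finU: "finite U" "finite W" "finite Z" using sub fin by (auto intro: finite_subset)
    have disjU: "U \<inter> W = {}" "U \<inter> Z = {}" "W \<inter> Z = {}" using disj sub by blast+
    have Gi: "G i = Q1 \<alpha> \<union> Q2 \<beta> \<union> Q3 \<gamma>" by (simp add: G_def abc)
    note Qs = Qsub(1)[OF abc(2)] Qsub(2)[OF abc(3)] Qsub(3)[OF abc(4)]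
    have GK: "G i \<inter> K2 A B = Q1 \<alpha>" "G i \<inter> K2 A C = Q2 \<beta>" "G i \<inter> K2 B C = Q3 \<gamma>"
      unfolding Gi using Qs K by blast+
    have TG: "finite (triangles (G i))"
      using triangles_subset_K3[OF disj, of "G i"] Qs finK unfolding Gi by (blast intro: finite_subset)
    have "disc23 A B C (F \<inter> triangles (G i)) (G i) \<epsilon>1 \<epsilon>2" using triads[OF abc(2-4)] unfolding Gi .
    then obtain d2 where d2: "0 < d2" and dd: "disc2_density A B (Q1 \<alpha>) \<epsilon>2 d2" "disc2_density A C (Q2 \<beta>) \<epsilon>2 d2"
        "disc2_density B C (Q3 \<gamma>) \<epsilon>2 d2"
      and sg: "\<And>E'. E' \<subseteq> G i \<Longrightarrow> \<bar>real (card (F \<inter> triangles (G i) \<inter> triangles E')) - d3 i * real (card (triangles E'))\<bar>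
            \<le> \<epsilon>1 * d2 ^ 3 * real (card A) * real (card B) * real (card C)"
      unfolding disc23_def Let_def GK d3_def[symmetric] by blast
    have "d2 * (real (card A) * card B) \<le> card (Q1 \<alpha>) + \<epsilon>2 * (real (card A) * card B)"
      using dd(1) unfolding disc2_density_def abs_le_iff by (simp add: mult.assoc)
    then have d21: "d2 \<le> p1 \<alpha> + \<epsilon>2" using pos by (simp add: p1_def field_simps)
    have "d2 * (real (card A) * card C) \<le> card (Q2 \<beta>) + \<epsilon>2 * (real (card A) * card C)"
      using dd(2) unfolding disc2_density_def abs_le_iff by (simp add: mult.assoc)
    then have d22: "d2 \<le> p2 \<beta> + \<epsilon>2" using pos by (simp add: p2_def field_simps)
    have "d2 * (real (card B) * card C) \<le> card (Q3 \<gamma>) + \<epsilon>2 * (real (card B) * card C)"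
      using dd(3) unfolding disc2_density_def abs_le_iff by (simp add: mult.assoc)
    then have d23: "d2 \<le> p3 \<gamma> + \<epsilon>2" using pos by (simp add: p3_def field_simps)
    have "d2 * d2 * d2 \<le> (p1 \<alpha> + \<epsilon>2) * (p2 \<beta> + \<epsilon>2) * (p3 \<gamma> + \<epsilon>2)"
      using d2 d21 d22 d23 by (intro mult_mono) auto
    then have d2\<pi>: "d2 ^ 3 \<le> \<pi>' i" by (simp add: \<pi>'_def abc power3_eq_cube)
    define E' where "E' = {e\<in>G i. e \<in> K2 U W \<union> K2 U Z \<union> K2 W Z}"
    have TE: "triangles E' = triangles (G i) \<inter> K3 U W Z" unfolding E'_def by (rule triangles_restrict[OF disjU])
    have "F \<inter> triangles (G i) \<inter> triangles E' = F \<inter> triangles (G i) \<inter> K3 U W Z" using TE by blast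
    then have 1: "\<bar>real (card (F \<inter> triangles (G i) \<inter> K3 U W Z)) - d3 i * real (card (triangles E'))\<bar> \<le> \<epsilon>1 * d2 ^ 3 * P"
      using sg[of E'] by (simp add: E'_def P_def mult.assoc)
    have "\<epsilon>1 * d2 ^ 3 * P \<le> \<epsilon>1 * \<pi>' i * P" using d2\<pi> \<epsilon> P by (intro mult_right_mono mult_left_mono) auto
    note 1 = order_trans[OF 1 this]
    have mem: "{x, y, z} \<in> triangles (G i) \<longleftrightarrow> {x, y} \<in> Q1 \<alpha> \<and> {x, z} \<in> Q2 \<beta> \<and> {y, z} \<in> Q3 \<gamma>"
      if "x \<in> U" "y \<in> W" "z \<in> Z" for x y z
    proof -
      have xyz: "x \<noteq> y" "x \<noteq> z" "y \<noteq> z" using that disjU by blast+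
      have "{x, y} \<in> K2 A B" "{x, z} \<in> K2 A C" "{y, z} \<in> K2 B C" using that sub xyz unfolding K2_def by blast+
      then show ?thesis unfolding mem_triangles_iff[OF xyz] using GK by blast
    qed
    have "card (triangles (G i) \<inter> K3 U W Z) = (\<Sum>x\<in>U. \<Sum>y\<in>W. card {z\<in>Z. {x, y, z} \<in> triangles (G i)})"
      by (rule card_Int_K3[OF disjU finU])
    also have "real \<dots> = (\<Sum>x\<in>U. \<Sum>y\<in>W. \<Sum>z\<in>Z. of_bool ({x, y, z} \<in> triangles (G i)))"
      by (simp only: of_nat_sum sum_of_bool_card[OF finU(3)])
    also have "\<dots> = (\<Sum>x\<in>U. \<Sum>y\<in>W. \<Sum>z\<in>Z. of_bool ({x, y} \<in> Q1 \<alpha> \<and> {x, z} \<in> Q2 \<beta> \<and> {y, z} \<in> Q3 \<gamma>))"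
      by (intro sum.cong refl) (simp add: mem)
    finally have cT: "real (card (triangles E')) = (\<Sum>x\<in>U. \<Sum>y\<in>W. \<Sum>z\<in>Z. of_bool ({x, y} \<in> Q1 \<alpha> \<and> {x, z} \<in> Q2 \<beta> \<and> {y, z} \<in> Q3 \<gamma>))"
      unfolding TE .
    have "\<bar>real (card (triangles E')) - \<pi> i * (real (card U) * card W * card Z)\<bar> \<le> 3 * \<epsilon>2 * P"
      unfolding cT \<pi>_def abc prod.case P_def
    proof (rule triangle_counting[OF fin sub])
      show "0 \<le> p1 \<alpha>" "p1 \<alpha> \<le> 1" "0 \<le> p2 \<beta>" "p2 \<beta> \<le> 1" "0 \<le> \<epsilon>2" using p_nn p_le abc \<epsilon> by auto
    qed (unfold p1_def p2_def p3_def; rule disc2_sum; use disj fin dd in \<open>simp add: disc2_density_def\<close>)+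
    moreover have d3: "0 \<le> d3 i" "d3 i \<le> 1"
      using card_mono[OF TG, of "F \<inter> triangles (G i)"] by (auto simp: d3_def divide_le_eq_1)
    ultimately have "d3 i * \<bar>real (card (triangles E')) - \<pi> i * (real (card U) * card W * card Z)\<bar> \<le> 1 * (3 * \<epsilon>2 * P)"
      by (intro mult_mono) auto
    have 2: "\<bar>d3 i * real (card (triangles E')) - d3 i * \<pi> i * (real (card U) * card W * card Z)\<bar> \<le> 3 * \<epsilon>2 * P"
    proof -
      have "\<bar>d3 i * s - d3 i * \<pi> i * t\<bar> = d3 i * \<bar>s - \<pi> i * t\<bar>" for s t
        using d3(1) by (simp add: right_diff_distrib[symmetric] abs_mult mult.assoc)
      then show ?thesis using \<open>d3 i * _ \<le> 1 * _\<close> by simp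
    qed
    have "(\<epsilon>1 * \<pi>' i + 3 * \<epsilon>2) * P = \<epsilon>1 * \<pi>' i * P + 3 * \<epsilon>2 * P" by (simp add: algebra_simps)
    then show ?thesis using 1 2 unfolding abs_le_iff by linarith
  qed
  define D where "D = (\<Sum>i\<in>I. d3 i * \<pi> i)"
  define \<eta> where "\<eta> = 8 * \<epsilon>1 + 3 * real l ^ 3 * \<epsilon>2"
  have box: "\<bar>real (card (F \<inter> K3 U W Z)) - D * (real (card U) * card W * card Z)\<bar> \<le> \<eta> * P"
    if sub: "U \<subseteq> A" "W \<subseteq> B" "Z \<subseteq> C" for U W Z
  proof -
    have disjU: "U \<inter> W = {}" "U \<inter> Z = {}" "W \<inter> Z = {}" using disj sub by blast+
    have finKU: "finite (K3 U W Z)" using K3_mono[OF sub] finK by (rule finite_subset)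
    have mem: "\<exists>!i. i \<in> I \<and> e \<in> triangles (G i)" if "e \<in> K3 U W Z" for e
    proof -
      obtain x y z where xyz: "e = {x, y, z}" "x \<in> U" "y \<in> W" "z \<in> Z" "x \<noteq> y" "x \<noteq> z" "y \<noteq> z"
        using \<open>e \<in> K3 U W Z\<close> unfolding K3_def by blast
      have KK: "{x, y} \<in> K2 A B" "{x, z} \<in> K2 A C" "{y, z} \<in> K2 B C" using xyz sub unfolding K2_def by blast+
      have iff: "e \<in> triangles (G (\<alpha>, \<beta>, \<gamma>)) \<longleftrightarrow> {x, y} \<in> Q1 \<alpha> \<and> {x, z} \<in> Q2 \<beta> \<and> {y, z} \<in> Q3 \<gamma>"
        if "\<alpha> \<in> {1..l}" "\<beta> \<in> {1..l}" "\<gamma> \<in> {1..l}" for \<alpha> \<beta> \<gamma>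
        unfolding xyz(1) mem_triangles_iff[OF xyz(5-7)] G_def prod.case
        using Qsub(1)[OF that(1)] Qsub(2)[OF that(2)] Qsub(3)[OF that(3)] KK K by blast
      obtain \<alpha> where a: "\<alpha> \<in> {1..l}" "{x, y} \<in> Q1 \<alpha>" using Q(1) KK(1) unfolding indexed_partition_def by blast
      obtain \<beta> where b: "\<beta> \<in> {1..l}" "{x, z} \<in> Q2 \<beta>" using Q(2) KK(2) unfolding indexed_partition_def by blast
      obtain \<gamma> where c: "\<gamma> \<in> {1..l}" "{y, z} \<in> Q3 \<gamma>" using Q(3) KK(3) unfolding indexed_partition_def by blast
      have uniq: "\<alpha>' = \<alpha>" if "indexed_partition X {1..l} R" "e \<in> R \<alpha>" "e \<in> R \<alpha>'" "\<alpha> \<in> {1..l}" "\<alpha>' \<in> {1..l}"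
        for X R and e :: "'a set" and \<alpha> \<alpha>'
        using that unfolding indexed_partition_def disjoint_family_on_def by blast
      show ?thesis
      proof (rule ex1I[of _ "(\<alpha>, \<beta>, \<gamma>)"])
        show "(\<alpha>, \<beta>, \<gamma>) \<in> I \<and> e \<in> triangles (G (\<alpha>, \<beta>, \<gamma>))"
          using a b c iff[of \<alpha> \<beta> \<gamma>] by (simp add: I_def)
        fix i assume i: "i \<in> I \<and> e \<in> triangles (G i)"
        obtain \<alpha>' \<beta>' \<gamma>' where i': "i = (\<alpha>', \<beta>', \<gamma>')" "\<alpha>' \<in> {1..l}" "\<beta>' \<in> {1..l}" "\<gamma>' \<in> {1..l}"
          using i by (auto simp: I_def)
        then have "{x, y} \<in> Q1 \<alpha>'" "{x, z} \<in> Q2 \<beta>'" "{y, z} \<in> Q3 \<gamma>'" using i iff[OF i'(2-4)] by simp_all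
        then show "i = (\<alpha>, \<beta>, \<gamma>)"
          using uniq[OF Q(1) a(2) _ a(1) i'(2)] uniq[OF Q(2) b(2) _ b(1) i'(3)] uniq[OF Q(3) c(2) _ c(1) i'(4)] i'(1) by simp
      qed
    qed
    have "F \<inter> K3 U W Z = (\<Union>i\<in>I. F \<inter> triangles (G i) \<inter> K3 U W Z)" using mem by blast
    then have "card (F \<inter> K3 U W Z) = card (\<Union>i\<in>I. F \<inter> triangles (G i) \<inter> K3 U W Z)" by simp
    also have "\<dots> = (\<Sum>i\<in>I. card (F \<inter> triangles (G i) \<inter> K3 U W Z))"
    proof (rule card_UN_disjoint)
      show "\<forall>i\<in>I. \<forall>j\<in>I. i \<noteq> j \<longrightarrow> F \<inter> triangles (G i) \<inter> K3 U W Z \<inter> (F \<inter> triangles (G j) \<inter> K3 U W Z) = {}"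
        using mem by blast
    qed (use finKU in \<open>auto simp: I_def\<close>)
    finally have "real (card (F \<inter> K3 U W Z)) - D * (real (card U) * card W * card Z)
        = (\<Sum>i\<in>I. real (card (F \<inter> triangles (G i) \<inter> K3 U W Z)) - d3 i * \<pi> i * (real (card U) * card W * card Z))"
      by (simp add: D_def sum_subtractf sum_distrib_right)
    then have "\<bar>real (card (F \<inter> K3 U W Z)) - D * (real (card U) * card W * card Z)\<bar>
        \<le> (\<Sum>i\<in>I. \<bar>real (card (F \<inter> triangles (G i) \<inter> K3 U W Z)) - d3 i * \<pi> i * (real (card U) * card W * card Z)\<bar>)"
      by (simp only: sum_abs)
    also have "\<dots> \<le> (\<Sum>i\<in>I. (\<epsilon>1 * \<pi>' i + 3 * \<epsilon>2) * P)" by (rule sum_mono) (rule triad[OF _ sub])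
    also have "\<dots> = (\<epsilon>1 * sum \<pi>' I + 3 * real l ^ 3 * \<epsilon>2) * P"
    proof -
      have "card I = l ^ 3" by (simp add: I_def card_cartesian_product power3_eq_cube)
      then show ?thesis by (simp add: sum.distrib sum_distrib_left sum_distrib_right algebra_simps)
    qed
    also have "sum \<pi>' I = (1 + l * \<epsilon>2) * (1 + l * \<epsilon>2) * (1 + l * \<epsilon>2)"
      unfolding \<pi>'_def I_def sum_triple_product sum.distrib p_sum by simp
    also have "(\<epsilon>1 * ((1 + l * \<epsilon>2) * (1 + l * \<epsilon>2) * (1 + l * \<epsilon>2)) + 3 * real l ^ 3 * \<epsilon>2) * P \<le> \<eta> * P"
    proof (rule mult_right_mono)
      have "(1 + l * \<epsilon>2) * (1 + l * \<epsilon>2) * (1 + l * \<epsilon>2) \<le> 2 * 2 * 2" using \<epsilon> by (intro mult_mono) auto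
      then have "\<epsilon>1 * ((1 + l * \<epsilon>2) * (1 + l * \<epsilon>2) * (1 + l * \<epsilon>2)) \<le> \<epsilon>1 * 8" using \<epsilon> by (intro mult_left_mono) auto
      then show "\<epsilon>1 * ((1 + l * \<epsilon>2) * (1 + l * \<epsilon>2) * (1 + l * \<epsilon>2)) + 3 * real l ^ 3 * \<epsilon>2 \<le> \<eta>" by (simp add: \<eta>_def)
    qed (use P in simp)
    finally show ?thesis .
  qed
  \<comment> \<open>The whole triple is itself a test box, which compares the actual density with
    \<open>D\<close>.\<close>
  define d where "d = card (F \<inter> K3 A B C) / P"
  have "\<bar>d * P - D * P\<bar> \<le> \<eta> * P" using box[of A B C] P by (simp add: d_def P_def)
  then have "\<bar>d - D\<bar> * P \<le> \<eta> * P" using P by (simp add: left_diff_distrib[symmetric] abs_mult)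
  then have dD: "\<bar>d - D\<bar> \<le> \<eta>" using P by simp
  have "\<bar>real (card (F \<inter> K3 A B C \<inter> K3 U W Z)) - d * real (card U) * real (card W) * real (card Z)\<bar>
      \<le> 2 * \<eta> * real (card A) * real (card B) * real (card C)" if sub: "U \<subseteq> A" "W \<subseteq> B" "Z \<subseteq> C" for U W Z
  proof -
    define v where "v = real (card U) * card W * card Z"
    have "real (card U) * card W * card Z \<le> P"
      unfolding P_def using sub fin by (intro mult_mono) (auto intro: card_mono)
    then have v: "0 \<le> v" "v \<le> P" by (auto simp: v_def)
    have "\<bar>d - D\<bar> * v \<le> \<eta> * P" using dD v by (intro mult_mono) auto
    then have "\<bar>d * v - D * v\<bar> \<le> \<eta> * P" using v by (simp add: left_diff_distrib[symmetric] abs_mult)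
    moreover have "\<bar>real (card (F \<inter> K3 U W Z)) - D * v\<bar> \<le> \<eta> * P" unfolding v_def by (rule box[OF sub])
    ultimately have "\<bar>real (card (F \<inter> K3 U W Z)) - d * v\<bar> \<le> 2 * (\<eta> * P)" unfolding abs_le_iff by linarith
    moreover have "F \<inter> K3 A B C \<inter> K3 U W Z = F \<inter> K3 U W Z" using K3_mono[OF sub] by blast
    ultimately show ?thesis by (simp add: v_def P_def mult.assoc)
  qed
  then show ?thesis
    unfolding vdisc3_def Let_def d_def P_def \<eta>_def by blast
qed

section \<open>Equipartitions from decompositions\<close>

lemma vdisc3_mono: "vdisc3 A B C E \<epsilon> \<Longrightarrow> \<epsilon> \<le> \<epsilon>' \<Longrightarrow> vdisc3 A B C E \<epsilon>'"
  unfolding vdisc3_def Let_def by (meson mult_right_mono of_nat_0_le_iff order_trans)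

lemma zero_disc23_error_imp_zero_vdisc3_error:
  assumes her: "hereditary_property \<H>" and zero: "zero_disc23_error \<H>"
  shows "zero_vdisc3_error \<H>"
  unfolding zero_vdisc3_error_def
proof (intro allI impI)
  fix \<epsilon> :: real and t0 :: nat
  assume \<epsilon>: "0 < \<epsilon>" and t0: "1 \<le> t0"
  \<comment> \<open>The contributions \<open>16 * \<epsilon>1\<close> and
    \<open>6 * l ^ 3 * \<epsilon>2 l\<close> to the error become at most
    \<open>\<epsilon> / 2\<close> each, and \<open>1 / (l + 1)\<close> gives
    \<open>l * \<epsilon>2 l \<le> 1\<close>. Using \<open>l + 1\<close> keeps
    \<open>\<epsilon>2\<close> positive at 0.\<close>
  define \<epsilon>1 where "\<epsilon>1 = \<epsilon> / 32"
  define \<epsilon>2 where "\<epsilon>2 l = min (1 / (real l + 1)) (\<epsilon> / (12 * (real l + 1) ^ 3))" for l :: nat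
  have \<epsilon>1: "0 < \<epsilon>1" using \<epsilon> by (simp add: \<epsilon>1_def)
  have \<epsilon>2: "0 < \<epsilon>2 l \<and> \<epsilon>2 l \<le> 1" for l using \<epsilon> by (auto simp: \<epsilon>2_def min_le_iff_disj)
  have l\<epsilon>2: "l * \<epsilon>2 l \<le> 1" for l
  proof -
    have "l * \<epsilon>2 l \<le> l * (1 / (real l + 1))" by (intro mult_left_mono) (auto simp: \<epsilon>2_def)
    also have "\<dots> \<le> 1" by (simp add: field_simps)
    finally show ?thesis .
  qed
  have small: "2 * (8 * \<epsilon>1 + 3 * real l ^ 3 * \<epsilon>2 l) \<le> \<epsilon>" for l
  proof -
    have "real l ^ 3 * \<epsilon>2 l \<le> (real l + 1) ^ 3 * (\<epsilon> / (12 * (real l + 1) ^ 3))"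
      using \<epsilon>2[of l] by (intro mult_mono power_mono) (auto simp: \<epsilon>2_def)
    also have "\<dots> = \<epsilon> / 12" by simp
    finally show ?thesis by (simp add: \<epsilon>1_def)
  qed
  obtain N T L where NTL: "\<forall>(V, F)\<in>\<H>. N \<le> card V \<longrightarrow>
          (\<exists>t l Vs P. t0 \<le> t \<and> t \<le> T \<and> 1 \<le> l \<and> l \<le> L \<and>
             decomposition t l \<epsilon>1 (\<epsilon>2 l) V Vs P \<and> all_triads_disc23 t l \<epsilon>1 (\<epsilon>2 l) F Vs P)"
  proof -
    have all\<epsilon>2: "\<forall>n. 0 < \<epsilon>2 n \<and> \<epsilon>2 n \<le> 1" using \<epsilon>2 by blast
    from zero[unfolded zero_disc23_error_def, THEN spec, of t0, THEN mp, OF t0, THEN spec, of 1, THEN mp, OF order_refl,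
        THEN spec, of \<epsilon>1, THEN mp, OF \<epsilon>1, THEN spec, of \<epsilon>2, THEN mp, OF all\<epsilon>2]
    show ?thesis using that by (elim exE)
  qed
  show "\<exists>T N. \<forall>(V, F)\<in>\<H>. N \<le> card V \<longrightarrow>
        (\<exists>\<P>. equipartition V \<P> \<and> t0 \<le> card \<P> \<and> card \<P> \<le> T \<and>
             (\<forall>X\<in>\<P>. \<forall>Y\<in>\<P>. \<forall>Z\<in>\<P>. X \<noteq> Y \<longrightarrow> X \<noteq> Z \<longrightarrow> Y \<noteq> Z \<longrightarrow> vdisc3 X Y Z (F \<inter> K3 X Y Z) \<epsilon>))"
  proof (rule exI[of _ T], rule exI[of _ "N + T"], clarify)
    fix V F assume H: "(V, F) \<in> \<H>" and large: "N + T \<le> card V"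
    have finV: "finite V" using her H by (auto simp: hereditary_property_def finite_three_graph_def)
    have "N \<le> card V" using large by simp
    then obtain t l Vs P where t: "t0 \<le> t" "t \<le> T" and l: "1 \<le> l" "l \<le> L"
      and dec: "decomposition t l \<epsilon>1 (\<epsilon>2 l) V Vs P" and triads: "all_triads_disc23 t l \<epsilon>1 (\<epsilon>2 l) F Vs P"
      using NTL H by fast
    have part: "indexed_partition V {1..t} Vs"
      and mono: "\<And>i j. i \<in> {1..t} \<Longrightarrow> j \<in> {1..t} \<Longrightarrow> i \<le> j \<Longrightarrow> card (Vs i) \<le> card (Vs j)"
      and last: "card (Vs t) \<le> card (Vs 1) + 1"
      and edges: "\<And>i j. {i, j} \<in> nsets {1..t} 2 \<Longrightarrow> indexed_partition (K2 (Vs i) (Vs j)) {1..l} (P {i, j})"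
      using dec unfolding decomposition_def by blast+
    have t1: "1 \<in> {1..t}" "t \<in> {1..t}" using t t0 by auto
    have Vs_sub: "Vs i \<subseteq> V" if "i \<in> {1..t}" for i using part that unfolding indexed_partition_def by blast
    have Vs_fin: "finite (Vs i)" if "i \<in> {1..t}" for i using Vs_sub[OF that] finV by (rule finite_subset)
    have Vs_disj: "Vs i \<inter> Vs j = {}" if "i \<in> {1..t}" "j \<in> {1..t}" "i \<noteq> j" for i j
      using part that unfolding indexed_partition_def disjoint_family_on_def by blast
    \<comment> \<open>A decomposition may have empty parts, a partition may not. If the smallest
      part were empty, every part would have at most one vertex and \<open>V\<close> fewer than
      \<open>t \<le> T\<close>; this is why \<open>T\<close> is added to the threshold.\<close>
    have "card (Vs 1) \<noteq> 0"
    proof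
      assume 0: "card (Vs 1) = 0"
      have le: "card (Vs i) \<le> (if i = 1 then 0 else 1)" if "i \<in> {1..t}" for i
        using mono[OF that t1(2)] last that 0 by auto
      have "card V = card (\<Union>i\<in>{1..t}. Vs i)" using part by (simp add: indexed_partition_def)
      also have "\<dots> \<le> (\<Sum>i\<in>{1..t}. card (Vs i))" by (rule card_UN_le) simp
      also have "\<dots> \<le> (\<Sum>i\<in>{1..t}. if i = 1 then 0 else 1)" by (rule sum_mono) (rule le)
      also have "\<dots> < (\<Sum>i\<in>{1..t}. 1)" using t1 by (intro sum_strict_mono_ex1) auto
      also have "\<dots> = t" by simp
      finally show False using large t by simp
    qed
    then have Vs_ne: "Vs i \<noteq> {}" if "i \<in> {1..t}" for i
      using mono[OF t1(1) that] that by auto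
    have Vs_inj: "inj_on Vs {1..t}"
      using Vs_disj Vs_ne by (intro inj_onI) (metis Int_absorb)
    define \<P> where "\<P> = Vs ` {1..t}"
    have "card \<P> = t" unfolding \<P>_def using card_image[OF Vs_inj] by simp
    moreover have "equipartition V \<P>"
      unfolding equipartition_def
    proof (intro conjI ballI)
      show "partition_on V \<P>"
      proof (rule partition_onI)
        show "\<Union>\<P> = V" using part by (simp add: indexed_partition_def \<P>_def)
        show "disjnt X Y" if "X \<in> \<P>" "Y \<in> \<P>" "X \<noteq> Y" for X Y
          using that Vs_disj unfolding \<P>_def disjnt_def by blast
        show "{} \<notin> \<P>" using Vs_ne unfolding \<P>_def by blast
      qed
      fix X Y assume "X \<in> \<P>" "Y \<in> \<P>"
      then obtain i j where ij: "i \<in> {1..t}" "X = Vs i" "j \<in> {1..t}" "Y = Vs j" unfolding \<P>_def by blast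
      have "card (Vs i) \<le> card (Vs t)" "card (Vs 1) \<le> card (Vs j)"
        using mono[OF ij(1) t1(2)] mono[OF t1(1) ij(3)] ij by auto
      then show "card X \<le> card Y + 1" using last ij by simp
    qed
    moreover have "vdisc3 X Y Z (F \<inter> K3 X Y Z) \<epsilon>"
      if "X \<in> \<P>" "Y \<in> \<P>" "Z \<in> \<P>" "X \<noteq> Y" "X \<noteq> Z" "Y \<noteq> Z" for X Y Z
    proof -
      from \<open>X \<in> \<P>\<close> \<open>Y \<in> \<P>\<close> \<open>Z \<in> \<P>\<close> obtain i j k where i: "i \<in> {1..t}" "X = Vs i" and j: "j \<in> {1..t}" "Y = Vs j"
        and k: "k \<in> {1..t}" "Z = Vs k" unfolding \<P>_def by blast
      have ne: "i \<noteq> j" "i \<noteq> k" "j \<noteq> k" using \<open>X \<noteq> Y\<close> \<open>X \<noteq> Z\<close> \<open>Y \<noteq> Z\<close> i j k by auto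
      have ijk: "{i, j, k} \<in> nsets {1..t} 3" unfolding nsets_tripleton using i j k ne by blast
      have "vdisc3 (Vs i) (Vs j) (Vs k) (F \<inter> K3 (Vs i) (Vs j) (Vs k)) (2 * (8 * \<epsilon>1 + 3 * real l ^ 3 * \<epsilon>2 l))"
      proof (rule vdisc3_of_disc23_triads[where ?Q1.0 = "P {i, j}" and ?Q2.0 = "P {i, k}" and ?Q3.0 = "P {j, k}"])
        show "indexed_partition (K2 (Vs i) (Vs j)) {1..l} (P {i, j})"
          "indexed_partition (K2 (Vs i) (Vs k)) {1..l} (P {i, k})"
          "indexed_partition (K2 (Vs j) (Vs k)) {1..l} (P {j, k})"
          by (rule edges, use i j k ne in simp)+
        show "disc23 (Vs i) (Vs j) (Vs k) (F \<inter> triangles (P {i, j} \<alpha> \<union> P {i, k} \<beta> \<union> P {j, k} \<gamma>))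
            (P {i, j} \<alpha> \<union> P {i, k} \<beta> \<union> P {j, k} \<gamma>) \<epsilon>1 (\<epsilon>2 l)"
          if "\<alpha> \<in> {1..l}" "\<beta> \<in> {1..l}" "\<gamma> \<in> {1..l}" for \<alpha> \<beta> \<gamma>
          using triads ijk that unfolding all_triads_disc23_def Let_def triad_edges_def by blast
      qed (use i j k ne Vs_disj Vs_fin Vs_ne \<epsilon>1 \<epsilon>2[of l] l\<epsilon>2 in auto)
      then show ?thesis unfolding i j k by (rule vdisc3_mono[OF _ small])
    qed
    ultimately show "\<exists>\<P>. equipartition V \<P> \<and> t0 \<le> card \<P> \<and> card \<P> \<le> T \<and>
             (\<forall>X\<in>\<P>. \<forall>Y\<in>\<P>. \<forall>Z\<in>\<P>. X \<noteq> Y \<longrightarrow> X \<noteq> Z \<longrightarrow> Y \<noteq> Z \<longrightarrow> vdisc3 X Y Z (F \<inter> K3 X Y Z) \<epsilon>)"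
      using t by blast
  qed
qed

theorem theorem2p48:
  fixes \<H> :: "'a three_graph set"
  assumes "hereditary_property \<H>"
  shows "zero_disc23_error \<H> \<longleftrightarrow> zero_vdisc3_error \<H>"
  using zero_disc23_error_imp_zero_vdisc3_error[OF assms] zero_vdisc3_error_imp_zero_disc23_error[OF assms]
  by blast

end
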